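(* Let $X$ be a Banach space with a basis $(e_i)$. Then: (a) $\Delta(X)\neq\emptyset$, and if $\gamma=(\gamma_\alpha)_{\alpha<\omega_1}\in\Delta(X)$ then $\gamma_\alpha\in[0,1]$ for all $\alpha<\omega_1$. (b) $X$ contains (a subspace isomorphic to) $\ell_1$ if and only if there exists $\gamma\in\Delta(X)$ with $\gamma_1=1$. (c) If $\gamma\in\Delta(X)$ then $\gamma_\alpha\ge\gamma_\beta$ whenever $\alpha\le\beta<\omega_1$. (d) If $\gamma\in\Delta(X)$ and $\alpha,\beta<\omega_1$, then $\gamma_\alpha\gamma_\beta\le\gamma_{\beta+\alpha}$. (e) If $\gamma\in\Delta(X)$, $\alpha<\omega_1$ and $n\in\mathbb N$, then $\gamma_{\alpha\cdot n}\ge(\gamma_\alpha)^n$. (f) If $\gamma\in\Delta(X)$ then $\gamma$ is a continuous function of $\alpha$ (for the order topology on $\omega_1$). (g) For all $\alpha<\omega_1$, $\ddot\delta_\alpha(X)=\sup\{\gamma_\alpha:\gamma\in\ddot\Delta(X)\}$.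
   Context: Spaces are separable infinite-dimensional Banach spaces; ordinal sums and products are the usual ones. For a basic sequence $(x_i)$, $(y_i)\prec(x_i)$ means that $(y_i)$ is a (finite or infinite) block basis of $(x_i)$, $[x_i]$ is the closed linear span, and $\operatorname{supp}(y)$ is the set of indices of nonzero coefficients of $y$ with respect to $(x_i)$. For finite $F,G\subseteq\mathbb N$, $F<G$ means $\max F<\min G$ (or one is empty); $n\le F$ means $n\le\min F$. Schreier classes: for sets $\mathcal F,\mathcal G$ of finite subsets of $\mathbb N$, $\mathcal F[\mathcal G]=\{\bigcup_1^nG_i: n\in\mathbb N, G_1<\dots<G_n, G_i\in\mathcal G, (\min G_i)_1^n\in\mathcal F\}$. $\mathcal S_0=\{\{n\}:n\in\mathbb N\}\cup\{\emptyset\}$, $\mathcal S_1=\{F:\min F\ge|F|\}\cup\{\emptyset\}$, $\mathcal S_{\alpha+1}=\mathcal S_1[\mathcal S_\alpha]$, and for a limit ordinal $\alpha<\omega_1$ one fixes $\alpha_n\uparrow\alpha$ and sets $\mathcal S_\alpha=\{F:\text{for some }n,\ F\in\mathcal S_{\alpha_n}\text{ and }F\ge n\}$. A finite block sequence $(y_i)_1^k\prec(x_i)$ is $\alpha$-admissible w.r.t. $(x_i)$ if $(\min\operatorname{supp}(y_i))_{i=1}^k\in\mathcal S_\alpha$ (supports w.r.t. $(x_i)$). $\delta_\alpha(x_i)$ is the supremum of $\delta\ge0$ such that $\|\sum_1^ky_i\|\ge\delta\sum_1^k\|y_i\|$ for all $(y_i)_1^k\prec(x_i)$ $\alpha$-admissible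 w.r.t. $(x_i)$; $\delta_\alpha((x_i),|\cdot|)$ is the same quantity for an equivalent norm $|\cdot|$. For $X$ with basis $(e_i)$: $\dot\delta_\alpha(X)=\dot\delta_\alpha(e_i)=\sup\{\delta_\alpha(x_i):(x_i)\prec(e_i)\}$ and $\ddot\delta_\alpha(X)=\sup\{\dot\delta_\alpha((e_i),|\cdot|):|\cdot|\text{ an equivalent norm on }X\}$. A basic sequence $(x_i)$ $\Delta$-stabilizes $\gamma=(\gamma_\alpha)_{\alpha<\omega_1}\subseteq\mathbb R$ if there exist $\varepsilon_n\downarrow0$ so that for every $\alpha<\omega_1$ there is $m\in\mathbb N$ such that for all $n\ge m$, if $(y_i)\prec(x_i)_n^\infty$ then $|\delta_\alpha(y_i)-\gamma_\alpha|<\varepsilon_n$. $\Delta(X)$ is the set of all $\gamma$ such that some $(x_i)\prec(e_i)$ $\Delta$-stabilizes $\gamma$. $\ddot\Delta(X)$ is the set of all $\gamma$ such that some $(x_i)\prec(e_i)$ $\Delta$-stabilizes $\gamma$ under some equivalent norm $|\cdot|$ on $[x_i]_{i\in\mathbb N}$. *)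

theory Defs
  imports "HOL-Analysis.Analysis"
begin

section \<open>The ordinals below \<open>\<omega>\<^sub>1\<close>\<close>

text \<open>The elements of \<open>omega1\<close> are the ordinals \<open>\<alpha> < \<omega>\<^sub>1\<close>: the type is the canonical well-order of
  the least uncountable cardinal (\<open>cardSuc natLeq\<close>).\<close>

lemma cardSuc_natLeq_nonempty: "Field (cardSuc natLeq) \<noteq> {}"
  using cardSuc_finite[OF natLeq_Card_order] by (auto simp: Field_natLeq)

typedef omega1 = "Field (cardSuc natLeq)"
  using cardSuc_natLeq_nonempty by blast

lemma cardSuc_natLeq_Well_order: "Well_order (cardSuc natLeq)"
  using cardSuc_Card_order[OF natLeq_Card_order] by (rule card_order_on_well_order_on)

instantiation omega1 :: wellorder
begin

definition less_eq_omega1 :: "omega1 \<Rightarrow> omega1 \<Rightarrow> bool" where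
  "\<alpha> \<le> \<beta> \<longleftrightarrow> (Rep_omega1 \<alpha>, Rep_omega1 \<beta>) \<in> cardSuc natLeq"

definition less_omega1 :: "omega1 \<Rightarrow> omega1 \<Rightarrow> bool" where
  "\<alpha> < \<beta> \<longleftrightarrow> \<alpha> \<le> \<beta> \<and> \<not> \<beta> \<le> (\<alpha>::omega1)"

instance
proof -
  let ?r = "cardSuc natLeq"
  have wo: "Well_order ?r" by (rule cardSuc_natLeq_Well_order)
  then have refl: "(Rep_omega1 x, Rep_omega1 x) \<in> ?r"
    and total: "(Rep_omega1 x, Rep_omega1 y) \<in> ?r \<or> (Rep_omega1 y, Rep_omega1 x) \<in> ?r" for x y
    using Rep_omega1[of x] Rep_omega1[of y]
    unfolding well_order_on_def linear_order_on_def partial_order_on_def preorder_on_def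
      refl_on_def total_on_def by metis+
  have tr: "trans ?r" and anti: "antisym ?r" and wf: "wf (?r - Id)"
    using wo unfolding well_order_on_def linear_order_on_def partial_order_on_def preorder_on_def
    by auto
  have less: "x < y \<longleftrightarrow> (Rep_omega1 x, Rep_omega1 y) \<in> ?r - Id" for x y
    unfolding less_omega1_def less_eq_omega1_def
    using total[of x y] refl anti by (auto dest: antisymD simp: Rep_omega1_inject)
  show "OFCLASS(omega1, wellorder_class)"
  proof (intro_classes)
    fix x y z :: omega1
    show "x < y \<longleftrightarrow> x \<le> y \<and> \<not> y \<le> x" by (simp add: less_omega1_def)
    show "x \<le> x" using refl by (simp add: less_eq_omega1_def)
    show "x \<le> y \<Longrightarrow> y \<le> z \<Longrightarrow> x \<le> z" using tr by (auto simp: less_eq_omega1_def dest: transD)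
    show "x \<le> y \<Longrightarrow> y \<le> x \<Longrightarrow> x = y"
      using anti by (auto simp: less_eq_omega1_def Rep_omega1_inject dest: antisymD)
    show "x \<le> y \<or> y \<le> x" using total by (simp add: less_eq_omega1_def)
  next
    fix P :: "omega1 \<Rightarrow> bool" and a :: omega1
    assume step: "\<And>x. (\<And>y. y < x \<Longrightarrow> P y) \<Longrightarrow> P x"
    have "wf {(x, y). x < (y::omega1)}"
      by (rule wf_subset[OF wf_inv_image[OF wf, of Rep_omega1]]) (auto simp: inv_image_def less)
    then show "P a"
      by (induction rule: wf_induct_rule) (auto intro: step)
  qed
qed

end

lemma uncountable_omega1:
  includes cardinal_syntax
  shows "uncountable (UNIV :: omega1 set)"
proof
  assume "countable (UNIV :: omega1 set)"
  then have "countable (Field (cardSuc natLeq))"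
    by (metis countable_image type_definition.Rep_range type_definition_omega1)
  then obtain f :: "nat set \<Rightarrow> nat" where "inj_on f (Field (cardSuc natLeq))"
    by (auto simp: countable_def)
  then have "|Field (cardSuc natLeq)| \<le>o |UNIV :: nat set|"
    by (auto simp flip: card_of_ordLeq)
  moreover have "|Field (cardSuc natLeq)| =o cardSuc natLeq"
    by (rule card_of_Field_ordIso[OF cardSuc_Card_order[OF natLeq_Card_order]])
  moreover have "|UNIV :: nat set| =o natLeq"
    using card_of_Field_ordIso[OF natLeq_Card_order] by (simp add: Field_natLeq)
  ultimately have "cardSuc natLeq \<le>o natLeq"
    by (meson ordIso_ordLeq_trans ordIso_symmetric ordLeq_ordIso_trans)
  then show False
    using cardSuc_greater[OF natLeq_Card_order] not_ordLess_ordLeq by blast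
qed

lemma countable_lessThan_omega1:
  includes cardinal_syntax
  shows "countable {..<\<alpha>::omega1}"
proof -
  let ?r = "cardSuc natLeq" let ?a = "Rep_omega1 \<alpha>"
  have "|underS ?r ?a| <o ?r"
    by (rule card_of_underS[OF cardSuc_Card_order[OF natLeq_Card_order] Rep_omega1])
  then have "|underS ?r ?a| \<le>o natLeq"
    using cardSuc_ordLeq_ordLess[OF natLeq_Card_order card_of_Card_order] by blast
  moreover have "natLeq =o |UNIV :: nat set|"
    using card_of_Field_ordIso[OF natLeq_Card_order] by (simp add: Field_natLeq ordIso_symmetric)
  ultimately have "|underS ?r ?a| \<le>o |UNIV :: nat set|"
    using ordLeq_ordIso_trans by blast
  then obtain f :: "nat set \<Rightarrow> nat" where "inj_on f (underS ?r ?a)"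
    by (auto simp flip: card_of_ordLeq)
  then have "countable (underS ?r ?a)" by (auto simp: countable_def)
  moreover have "Rep_omega1 ` {..<\<alpha>} \<subseteq> underS ?r ?a"
    by (auto simp: underS_def less_omega1_def less_eq_omega1_def Rep_omega1_inject)
  ultimately have "countable (Rep_omega1 ` {..<\<alpha>})" by (rule countable_subset[rotated])
  then show ?thesis
    by (rule countable_image_inj_on) (simp add: inj_on_def Rep_omega1_inject)
qed

lemma countable_strict_bound_omega1:
  assumes "countable (A :: omega1 set)"
  shows "\<exists>\<beta>. \<forall>\<alpha>\<in>A. \<alpha> < \<beta>"
proof (rule ccontr)
  assume "\<not> ?thesis"
  then have "UNIV = (\<Union>\<alpha>\<in>A. {..<\<alpha>} \<union> {\<alpha>})"
    by (force simp: not_less le_less)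
  moreover have "countable (\<Union>\<alpha>\<in>A. {..<\<alpha>} \<union> {\<alpha>})"
    using assms countable_lessThan_omega1 by auto
  ultimately show False using uncountable_omega1 by simp
qed

instantiation omega1 :: linorder_topology
begin

definition open_omega1 :: "omega1 set \<Rightarrow> bool" where
  "open_omega1 = generate_topology (range (\<lambda>a. {..<a}) \<union> range (\<lambda>a. {a<..}))"

instance by intro_classes (rule open_omega1_def)

end

definition osuc :: "omega1 \<Rightarrow> omega1" where
  "osuc \<alpha> = (LEAST \<beta>. \<alpha> < \<beta>)"

text \<open>\<open>\<alpha> + \<beta>\<close> is the least ordinal that is \<open>\<ge> \<alpha>\<close> and exceeds every \<open>\<alpha> + \<beta>'\<close> with \<open>\<beta>' < \<beta>\<close>; the
  usual three recursion equations are derived below.\<close>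

function oadd :: "omega1 \<Rightarrow> omega1 \<Rightarrow> omega1" where
  "oadd \<alpha> \<beta> = (LEAST \<gamma>. \<alpha> \<le> \<gamma> \<and> (\<forall>\<beta>'. \<beta>' < \<beta> \<longrightarrow> oadd \<alpha> \<beta>' < \<gamma>))"
  by pat_completeness auto
termination
  by (relation "inv_image {(x, y). x < y} snd") (auto intro: wf)

declare oadd.simps [simp del]

instantiation omega1 :: "{zero, one, plus}"
begin

definition zero_omega1 :: omega1 where "0 = (LEAST \<alpha>::omega1. True)"
definition one_omega1 :: omega1 where "1 = osuc 0"
definition plus_omega1 :: "omega1 \<Rightarrow> omega1 \<Rightarrow> omega1" where "\<alpha> + \<beta> = oadd \<alpha> \<beta>"

instance ..

end

definition limit_ord :: "omega1 \<Rightarrow> bool" where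
  "limit_ord \<alpha> \<longleftrightarrow> \<alpha> \<noteq> 0 \<and> (\<nexists>\<beta>. \<alpha> = osuc \<beta>)"

text \<open>The ordinal product \<open>\<alpha> \<cdot> n\<close> with a finite right factor (that is, \<open>\<alpha> + \<dots> + \<alpha>\<close>, \<open>n\<close> times).\<close>

primrec omult_nat :: "omega1 \<Rightarrow> nat \<Rightarrow> omega1" where
  "omult_nat \<alpha> 0 = 0"
| "omult_nat \<alpha> (Suc n) = omult_nat \<alpha> n + \<alpha>"

lemma omega1_zero_le [simp]: "(0::omega1) \<le> \<alpha>"
  unfolding zero_omega1_def by (rule Least_le) simp

lemma omega1_not_less_0 [simp]: "\<not> \<alpha> < (0::omega1)"
  by (simp add: not_less)

lemma less_osuc: "\<alpha> < osuc \<alpha>"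
  unfolding osuc_def by (rule LeastI_ex) (use countable_strict_bound_omega1[of "{\<alpha>}"] in auto)

lemma less_osuc_iff: "\<beta> < osuc \<alpha> \<longleftrightarrow> \<beta> \<le> \<alpha>"
  using less_osuc[of \<alpha>] not_less_Least[of \<beta> "\<lambda>\<beta>. \<alpha> < \<beta>"] unfolding osuc_def by force

lemma osuc_le_iff: "osuc \<alpha> \<le> \<beta> \<longleftrightarrow> \<alpha> < \<beta>"
  using less_osuc_iff[of \<beta> \<alpha>] by (simp add: not_le flip: not_less)

lemma osuc_inject: "osuc \<alpha> = osuc \<beta> \<longleftrightarrow> \<alpha> = \<beta>"
  by (metis less_osuc_iff less_osuc order_antisym)

lemma limit_ord_osuc_less: "limit_ord \<theta> \<Longrightarrow> \<alpha> < \<theta> \<Longrightarrow> osuc \<alpha> < \<theta>"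
  by (metis limit_ord_def osuc_le_iff order_le_less)

lemma omega1_add_le_iff: "\<alpha> + \<beta> \<le> \<gamma> \<longleftrightarrow> \<alpha> \<le> \<gamma> \<and> (\<forall>\<beta>'<\<beta>. \<alpha> + \<beta>' < \<gamma>)" for \<alpha> \<beta> \<gamma> :: omega1
proof -
  let ?P = "\<lambda>\<gamma>. \<alpha> \<le> \<gamma> \<and> (\<forall>\<beta>'. \<beta>' < \<beta> \<longrightarrow> oadd \<alpha> \<beta>' < \<gamma>)"
  have "countable (insert \<alpha> (oadd \<alpha> ` {..<\<beta>}))"
    using countable_lessThan_omega1 by auto
  from countable_strict_bound_omega1[OF this] have "\<exists>\<gamma>. ?P \<gamma>"
    by (auto intro: less_imp_le)
  then have "?P (oadd \<alpha> \<beta>)" by (subst (1 2) oadd.simps) (rule LeastI_ex)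
  moreover have "?P \<gamma> \<Longrightarrow> oadd \<alpha> \<beta> \<le> \<gamma>" by (subst oadd.simps) (rule Least_le)
  ultimately show ?thesis unfolding plus_omega1_def by fastforce
qed

lemma omega1_add_strict_mono: "\<beta>' < \<beta> \<Longrightarrow> \<alpha> + \<beta>' < \<alpha> + \<beta>" for \<alpha> \<beta> :: omega1
  using omega1_add_le_iff[of \<alpha> \<beta> "\<alpha> + \<beta>"] by blast

lemma omega1_add_0 [simp]: "\<alpha> + 0 = \<alpha>" for \<alpha> :: omega1
  by (rule order_antisym) (use omega1_add_le_iff[of \<alpha> 0] in auto)

lemma omega1_add_osuc: "\<alpha> + osuc \<beta> = osuc (\<alpha> + \<beta>)"
proof (rule order_antisym)
  have "\<alpha> + \<beta>' < osuc (\<alpha> + \<beta>)" if "\<beta>' \<le> \<beta>" for \<beta>'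
    using that omega1_add_strict_mono[of \<beta>' \<beta> \<alpha>] by (auto simp: less_osuc_iff le_less)
  moreover have "\<alpha> \<le> osuc (\<alpha> + \<beta>)"
    using omega1_add_le_iff[of \<alpha> \<beta> "\<alpha> + \<beta>"] less_osuc[of "\<alpha> + \<beta>"] by auto
  ultimately show "\<alpha> + osuc \<beta> \<le> osuc (\<alpha> + \<beta>)"
    by (subst omega1_add_le_iff) (auto simp: less_osuc_iff)
  show "osuc (\<alpha> + \<beta>) \<le> \<alpha> + osuc \<beta>"
    by (simp add: osuc_le_iff omega1_add_strict_mono less_osuc)
qed

lemma omega1_add_limit_le_iff:
  assumes "limit_ord \<theta>"
  shows "\<alpha> + \<theta> \<le> \<gamma> \<longleftrightarrow> (\<forall>\<beta><\<theta>. \<alpha> + \<beta> \<le> \<gamma>)"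
proof
  assume L: "\<forall>\<beta><\<theta>. \<alpha> + \<beta> \<le> \<gamma>"
  have "\<alpha> + \<beta> < \<gamma>" if "\<beta> < \<theta>" for \<beta>
    using L limit_ord_osuc_less[OF assms that] by (auto simp: omega1_add_osuc osuc_le_iff)
  moreover have "0 < \<theta>"
    using assms by (auto simp: limit_ord_def order.strict_iff_order)
  then have "\<alpha> \<le> \<gamma>" using L by fastforce
  ultimately show "\<alpha> + \<theta> \<le> \<gamma>" by (subst omega1_add_le_iff) blast
qed (auto simp: omega1_add_le_iff[of \<alpha> \<theta>] less_imp_le)

section \<open>Schreier families\<close>

text \<open>\<open>L \<alpha> n\<close> is the term \<open>\<alpha>\<^bsub>n+1\<^esub>\<close> of the sequence chosen for the limit ordinal \<open>\<alpha>\<close>;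
  the values of \<open>L\<close> at non-limit ordinals are irrelevant.\<close>

definition fundamental_sequences :: "(omega1 \<Rightarrow> nat \<Rightarrow> omega1) \<Rightarrow> bool" where
  "fundamental_sequences L \<longleftrightarrow>
     (\<forall>\<alpha>. limit_ord \<alpha> \<longrightarrow>
        strict_mono (L \<alpha>) \<and> (\<forall>n. L \<alpha> n < \<alpha>) \<and> (\<forall>\<beta><\<alpha>. \<exists>n. \<beta> < L \<alpha> n))"

lemma fundamental_sequences_exist: "\<exists>L. fundamental_sequences L"
proof -
  have "\<exists>f :: nat \<Rightarrow> omega1. strict_mono f \<and> (\<forall>n. f n < \<alpha>) \<and> (\<forall>\<beta><\<alpha>. \<exists>n. \<beta> < f n)" if lim: "limit_ord \<alpha>" for \<alpha>
  proof -
    have ne: "{..<\<alpha>} \<noteq> {}"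
      using lim omega1_zero_le[of \<alpha>] by (auto simp: limit_ord_def le_less)
    define g where "g = from_nat_into {..<\<alpha>}"
    have g: "range g = {..<\<alpha>}"
      unfolding g_def by (rule range_from_nat_into[OF ne countable_lessThan_omega1])
    define f where "f = rec_nat (osuc (g 0)) (\<lambda>n a. osuc (max a (g (Suc n))))"
    have f0: "f 0 = osuc (g 0)" and fS: "f (Suc n) = osuc (max (f n) (g (Suc n)))" for n
      by (simp_all add: f_def)
    have g_less: "g n < \<alpha>" for n using g by auto
    have "f n < \<alpha>" for n
      by (induction n) (auto simp: f0 fS g_less max_def intro!: limit_ord_osuc_less[OF lim])
    moreover have "strict_mono f"
      by (rule strict_monoI_Suc) (auto simp: fS less_osuc_iff)
    moreover have "g n < f n" for n
      by (cases n) (auto simp: f0 fS less_osuc_iff)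
    moreover have "\<exists>n. \<beta> = g n" if "\<beta> < \<alpha>" for \<beta>
      using that g by auto
    ultimately have "strict_mono f \<and> (\<forall>n. f n < \<alpha>) \<and> (\<forall>\<beta><\<alpha>. \<exists>n. \<beta> < f n)"
      by blast
    then show ?thesis by (rule exI[of _ f])
  qed
  then have "\<forall>\<alpha>. \<exists>f :: nat \<Rightarrow> omega1. limit_ord \<alpha> \<longrightarrow> strict_mono f \<and> (\<forall>n. f n < \<alpha>) \<and> (\<forall>\<beta><\<alpha>. \<exists>n. \<beta> < f n)"
    by blast
  from choice[OF this] show ?thesis unfolding fundamental_sequences_def .
qed

text \<open>Here \<open>\<nat> = {1, 2, \<dots>}\<close>: the members of all families are finite sets of positive integers.\<close>

definition schreier0 :: "nat set set" where
  "schreier0 = insert {} {{n} | n. 1 \<le> n}"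

definition schreier1 :: "nat set set" where
  "schreier1 = insert {} {F. finite F \<and> F \<noteq> {} \<and> card F \<le> Min F}"

text \<open>\<open>F[G]\<close>; the sets \<open>G\<^sub>1 < \<dots> < G\<^sub>n\<close> (the list \<open>Gs\<close>) are nonempty, so that their minima exist, and
  \<open>n = 0\<close> is allowed (it contributes \<open>\<emptyset>\<close> if \<open>\<emptyset> \<in> F\<close>).\<close>

definition family_comp :: "nat set set \<Rightarrow> nat set set \<Rightarrow> nat set set" where
  "family_comp \<F> \<G> =
     {\<Union>(set Gs) | Gs. set Gs \<subseteq> \<G> - {{}} \<and> sorted_wrt (\<lambda>G H. Max G < Min H) Gs \<and> Min ` set Gs \<in> \<F>}"

text \<open>The condition \<open>L \<alpha> n < \<alpha>\<close> only serves the termination proof: it always holds when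
  \<open>fundamental_sequences L\<close>.\<close>

function schreier :: "(omega1 \<Rightarrow> nat \<Rightarrow> omega1) \<Rightarrow> omega1 \<Rightarrow> nat set set" where
  "schreier L \<alpha> =
     (if \<alpha> = 0 then schreier0
      else if \<exists>\<beta>. \<alpha> = osuc \<beta> then family_comp schreier1 (schreier L (THE \<beta>. \<alpha> = osuc \<beta>))
      else {F. \<exists>n\<in>{n. L \<alpha> n < \<alpha>}. F \<in> schreier L (L \<alpha> n) \<and> (\<forall>k\<in>F. n + 1 \<le> k)})"
  by pat_completeness auto
termination
  by (relation "inv_image {(x, y). x < y} snd")
     (auto intro: wf simp: osuc_inject less_osuc)

declare schreier.simps [simp del]

lemma schreier_0: "schreier L 0 = schreier0"
  by (subst schreier.simps) simp

lemma schreier_osuc: "schreier L (osuc \<alpha>) = family_comp schreier1 (schreier L \<alpha>)"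
proof -
  have "osuc \<alpha> \<noteq> 0" using less_osuc[of \<alpha>] omega1_zero_le[of \<alpha>] by auto
  then show ?thesis by (subst schreier.simps) (auto simp: osuc_inject)
qed

lemma schreier_limit:
  assumes "fundamental_sequences L" "limit_ord \<alpha>"
  shows "schreier L \<alpha> = {F. \<exists>n. F \<in> schreier L (L \<alpha> n) \<and> (\<forall>k\<in>F. n + 1 \<le> k)}"
  using assms by (subst schreier.simps) (auto simp: fundamental_sequences_def limit_ord_def)

section \<open>Bases and block bases\<close>

text \<open>A sequence \<open>(x\<^sub>1, x\<^sub>2, \<dots>)\<close> is a function \<open>x :: nat \<Rightarrow> 'a\<close> with \<open>x i\<close> in the role of
  \<open>x\<^bsub>i+1\<^esub>\<close>.\<close>

definition basis_of :: "'a::real_normed_vector set \<Rightarrow> (nat \<Rightarrow> 'a) \<Rightarrow> bool" where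
  "basis_of Y x \<longleftrightarrow> range x \<subseteq> Y \<and> (\<forall>v\<in>Y. \<exists>!a. (\<lambda>i. a i *\<^sub>R x i) sums v)"

definition closed_span :: "(nat \<Rightarrow> 'a::real_normed_vector) \<Rightarrow> 'a set" where
  "closed_span x = closure (span (range x))"

text \<open>The members \<open>y i\<close>, \<open>i \<in> I\<close>, form a block basis of \<open>x\<close>; \<open>I = {..<k}\<close> gives block sequences of
  length \<open>k\<close>, and \<open>I = UNIV\<close> infinite ones.\<close>

definition block_on :: "nat set \<Rightarrow> (nat \<Rightarrow> 'a::real_normed_vector) \<Rightarrow> (nat \<Rightarrow> 'a) \<Rightarrow> bool" where
  "block_on I x y \<longleftrightarrow>
     (\<exists>p a. strict_mono (p :: nat \<Rightarrow> nat) \<and>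
        (\<forall>i\<in>I. y i = (\<Sum>j\<in>{p i..<p (Suc i)}. a j *\<^sub>R x j) \<and> y i \<noteq> 0))"

abbreviation block_basis :: "(nat \<Rightarrow> 'a::real_normed_vector) \<Rightarrow> (nat \<Rightarrow> 'a) \<Rightarrow> bool" where
  "block_basis \<equiv> block_on UNIV"

definition coeffs :: "(nat \<Rightarrow> 'a::real_normed_vector) \<Rightarrow> 'a \<Rightarrow> nat \<Rightarrow> real" where
  "coeffs x v = (THE a. (\<lambda>i. a i *\<^sub>R x i) sums v)"

text \<open>The shift by \<open>Suc\<close> turns the positions of \<open>x\<close> into indices in \<open>{1, 2, \<dots>}\<close>.\<close>

definition supp :: "(nat \<Rightarrow> 'a::real_normed_vector) \<Rightarrow> 'a \<Rightarrow> nat set" where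
  "supp x v = Suc ` {i. coeffs x v i \<noteq> 0}"

definition equivalent_norm_on :: "'a::real_normed_vector set \<Rightarrow> ('a \<Rightarrow> real) \<Rightarrow> bool" where
  "equivalent_norm_on Y N \<longleftrightarrow>
     (\<forall>u\<in>Y. \<forall>v\<in>Y. N (u + v) \<le> N u + N v) \<and>
     (\<forall>r. \<forall>v\<in>Y. N (r *\<^sub>R v) = \<bar>r\<bar> * N v) \<and>
     (\<exists>c C. 0 < c \<and> (\<forall>v\<in>Y. c * norm v \<le> N v \<and> N v \<le> C * norm v))"

definition ell1 :: "(nat \<Rightarrow> real) set" where
  "ell1 = {a. summable (\<lambda>i. \<bar>a i\<bar>)}"

text \<open>\<open>T\<close> is an isomorphism of \<open>\<ell>\<^sub>1\<close> (with its norm \<open>\<Sum>i. \<bar>a i\<bar>\<close>) onto a subspace contained in \<open>Y\<close>.\<close>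

definition contains_ell1 :: "'a::real_normed_vector set \<Rightarrow> bool" where
  "contains_ell1 Y \<longleftrightarrow>
     (\<exists>T :: (nat \<Rightarrow> real) \<Rightarrow> 'a. T ` ell1 \<subseteq> Y \<and>
        (\<forall>a\<in>ell1. \<forall>b\<in>ell1. T (\<lambda>i. a i + b i) = T a + T b) \<and>
        (\<forall>r. \<forall>a\<in>ell1. T (\<lambda>i. r * a i) = r *\<^sub>R T a) \<and>
        (\<exists>c C. 0 < c \<and>
           (\<forall>a\<in>ell1. c * (\<Sum>i. \<bar>a i\<bar>) \<le> norm (T a) \<and> norm (T a) \<le> C * (\<Sum>i. \<bar>a i\<bar>))))"

section \<open>The quantities \<open>\<delta>\<^sub>\<alpha>\<close> and the spectrum \<open>\<Delta>\<close>\<close>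

text \<open>Throughout, \<open>L\<close> is the choice of fundamental sequences and \<open>N\<close> the norm in use.\<close>

definition admissible ::
  "(omega1 \<Rightarrow> nat \<Rightarrow> omega1) \<Rightarrow> omega1 \<Rightarrow> (nat \<Rightarrow> 'a::real_normed_vector) \<Rightarrow> nat \<Rightarrow> (nat \<Rightarrow> 'a) \<Rightarrow> bool"
where
  "admissible L \<alpha> x k y \<longleftrightarrow>
     block_on {..<k} x y \<and> (\<lambda>i. Min (supp x (y i))) ` {..<k} \<in> schreier L \<alpha>"

definition delta ::
  "(omega1 \<Rightarrow> nat \<Rightarrow> omega1) \<Rightarrow> ('a::real_normed_vector \<Rightarrow> real) \<Rightarrow> omega1 \<Rightarrow> (nat \<Rightarrow> 'a) \<Rightarrow> real"
where
  "delta L N \<alpha> x =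
     Sup {d. 0 \<le> d \<and> (\<forall>k y. admissible L \<alpha> x k y \<longrightarrow> N (\<Sum>i<k. y i) \<ge> d * (\<Sum>i<k. N (y i)))}"

text \<open>Only infinite block bases are admitted here: a block basis of length one would always give
  the value \<open>1\<close>.\<close>

definition delta_dot ::
  "(omega1 \<Rightarrow> nat \<Rightarrow> omega1) \<Rightarrow> ('a::real_normed_vector \<Rightarrow> real) \<Rightarrow> omega1 \<Rightarrow> (nat \<Rightarrow> 'a) \<Rightarrow> real"
where
  "delta_dot L N \<alpha> e = Sup {delta L N \<alpha> x | x. block_basis e x}"

definition delta_ddot ::
  "(omega1 \<Rightarrow> nat \<Rightarrow> omega1) \<Rightarrow> omega1 \<Rightarrow> (nat \<Rightarrow> 'a::real_normed_vector) \<Rightarrow> real"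
where
  "delta_ddot L \<alpha> e = Sup {delta_dot L N \<alpha> e | N. equivalent_norm_on UNIV N}"

definition Delta_stabilizes ::
  "(omega1 \<Rightarrow> nat \<Rightarrow> omega1) \<Rightarrow> ('a::real_normed_vector \<Rightarrow> real) \<Rightarrow> (nat \<Rightarrow> 'a) \<Rightarrow> (omega1 \<Rightarrow> real) \<Rightarrow> bool"
where
  "Delta_stabilizes L N x \<gamma> \<longleftrightarrow>
     (\<exists>\<epsilon> :: nat \<Rightarrow> real. decseq \<epsilon> \<and> \<epsilon> \<longlonglongrightarrow> 0 \<and>
        (\<forall>\<alpha>. \<exists>m. \<forall>n\<ge>m. \<forall>y. block_basis (\<lambda>i. x (n + i)) y \<longrightarrow> \<bar>delta L N \<alpha> y - \<gamma> \<alpha>\<bar> < \<epsilon> n))"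

definition Delta ::
  "(omega1 \<Rightarrow> nat \<Rightarrow> omega1) \<Rightarrow> (nat \<Rightarrow> 'a::real_normed_vector) \<Rightarrow> (omega1 \<Rightarrow> real) set"
where
  "Delta L e = {\<gamma>. \<exists>x. block_basis e x \<and> Delta_stabilizes L norm x \<gamma>}"

definition Delta_ddot ::
  "(omega1 \<Rightarrow> nat \<Rightarrow> omega1) \<Rightarrow> (nat \<Rightarrow> 'a::real_normed_vector) \<Rightarrow> (omega1 \<Rightarrow> real) set"
where
  "Delta_ddot L e =
     {\<gamma>. \<exists>x N. block_basis e x \<and> equivalent_norm_on (closed_span x) N \<and> Delta_stabilizes L N x \<gamma>}"

end

theory Submission
  imports Defs
begin

text \<open>The spectrum exists by a stabilization argument with two cases. If some block basis is equivalent
  to the unit vector basis of \<open>\<ell>\<^sub>1\<close>, James's distortion argument produces one that is asymptotically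
  isometric to it, and \<open>\<gamma> = 1\<close>. Otherwise, for every \<open>c > 0\<close>, the tree of finite rational block
  sequences with lower \<open>\<ell>\<^sub>1\<close>-estimate \<open>c\<close> is well-founded and countable, so it has countable rank;
  since \<open>S\<^sub>\<alpha>\<close> has rank at least \<open>\<alpha>\<close>, all \<open>\<delta>\<^sub>\<alpha>\<close> vanish from some \<open>\<beta> < \<omega>\<^sub>1\<close> on. The countably many
  remaining \<open>\<delta>\<^sub>\<alpha>\<close> increase when one passes to block bases and are stabilized by diagonalization.

  Monotonicity and \<open>\<gamma>\<^sub>\<alpha> \<gamma>\<^sub>\<beta> \<le> \<gamma>\<^bsub>\<beta>+\<alpha>\<^esub>\<close> come from comparing Schreier families along sparse
  subsequences: up to such a subsequence, \<open>S\<^sub>\<alpha>\<close> lies in \<open>S\<^sub>\<beta>\<close> for \<open>\<alpha> \<le> \<beta>\<close> and \<open>S\<^bsub>\<beta>+\<alpha>\<^esub>\<close> lies in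
  \<open>S\<^sub>\<alpha>[S\<^sub>\<beta>]\<close>. If \<open>\<gamma>\<^sub>1 = 1\<close>, this and continuity give \<open>\<gamma>\<^sub>\<alpha> = 1\<close> for all \<open>\<alpha>\<close>, which excludes the second
  case. Conversely, a copy of \<open>\<ell>\<^sub>1\<close> in \<open>X\<close> contains, up to small perturbations, a block basis
  equivalent to the unit vector basis of \<open>\<ell>\<^sub>1\<close>: finitely many coordinates can always be annihilated.\<close>

section \<open>Schreier families\<close>

text \<open>The obstacle is the index set. \<open>Delta_stabilizes\<close> asks a single sequence to
  serve uncountably many \<alpha>, while a diagonal argument handles countably many; this forces the
  dichotomy. In its first case a lower estimate with some constant c would not suffice, since it
  only places each \<open>\<delta>\<^sub>\<alpha>\<close> between c and 1; an almost isometric copy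
  squeezes all of them towards 1 at once. Comparisons along a sparse subsequence become inequalities
  for \<gamma> itself because the same subsequence can be taken in every tail, where it is again a
  block basis and so has \<open>\<delta>\<^sub>\<alpha>\<close> close to
  \<open>\<gamma>\<^sub>\<alpha>\<close>. For (g), \<open>\<delta>\<^sub>\<alpha>(x)\<close> is at
  most \<open>\<gamma>\<^sub>\<alpha>\<close> for the limit \<gamma> of any stabilizing block basis
  of x, and conversely \<open>\<gamma>\<^sub>\<alpha>\<close> is a limit of values of
  \<open>\<delta>\<^sub>\<alpha>\<close> at block bases of e. A norm given only on the span of a
  block basis is first extended to X, so that the theory can be developed for equivalent norms on
  the whole space.\<close>

lemma omega1_cases [case_names zero osuc limit]:
  assumes "\<alpha> = 0 \<Longrightarrow> P" "\<And>\<beta>. \<alpha> = osuc \<beta> \<Longrightarrow> P" "limit_ord \<alpha> \<Longrightarrow> P"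
  shows P
  using assms unfolding limit_ord_def by blast

lemma omega1_induct [case_names zero osuc limit]:
  assumes "P 0" "\<And>\<alpha>. P \<alpha> \<Longrightarrow> P (osuc \<alpha>)"
    and "\<And>\<alpha>. limit_ord \<alpha> \<Longrightarrow> (\<And>\<beta>. \<beta> < \<alpha> \<Longrightarrow> P \<beta>) \<Longrightarrow> P \<alpha>"
  shows "P (\<alpha>::omega1)"
proof (induction \<alpha> rule: less_induct)
  case (less \<alpha>)
  show ?case
  proof (cases \<alpha> rule: omega1_cases)
    case (osuc \<beta>)
    then show ?thesis using less assms(2) less_osuc by blast
  qed (use assms less in auto)
qed

lemma fundamental_sequences_less:
  "fundamental_sequences L \<Longrightarrow> limit_ord \<alpha> \<Longrightarrow> L \<alpha> n < \<alpha>"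
  by (auto simp: fundamental_sequences_def)

lemma fundamental_sequences_cofinal:
  "fundamental_sequences L \<Longrightarrow> limit_ord \<alpha> \<Longrightarrow> \<beta> < \<alpha> \<Longrightarrow> \<exists>n. \<beta> < L \<alpha> n"
  by (auto simp: fundamental_sequences_def)

lemma limit_ord_add:
  assumes "limit_ord \<alpha>"
  shows "limit_ord (\<beta> + \<alpha>)"
proof -
  have "0 < \<alpha>" using assms by (auto simp: limit_ord_def order.strict_iff_order)
  then have "\<beta> + 0 < \<beta> + \<alpha>" by (rule omega1_add_strict_mono)
  then have ne: "\<beta> + \<alpha> \<noteq> 0" using omega1_not_less_0 by metis
  have "\<beta> + \<alpha> \<noteq> osuc \<gamma>" for \<gamma>
  proof
    assume eq: "\<beta> + \<alpha> = osuc \<gamma>"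
    have "\<beta> + \<delta> \<le> \<gamma>" if "\<delta> < \<alpha>" for \<delta>
      using omega1_add_strict_mono[OF that, of \<beta>] eq by (simp add: less_osuc_iff)
    then have "\<beta> + \<alpha> \<le> \<gamma>" using omega1_add_limit_le_iff[OF assms] by blast
    then show False using eq less_osuc[of \<gamma>] by simp
  qed
  then show ?thesis using ne by (auto simp: limit_ord_def)
qed

lemma less_limit_add:
  assumes "limit_ord \<alpha>" "\<gamma> < \<beta> + \<alpha>"
  shows "\<exists>\<delta><\<alpha>. \<gamma> < \<beta> + \<delta>"
  using assms omega1_add_limit_le_iff[OF assms(1), of \<beta> \<gamma>] by (meson not_less)

lemma add_one_omega1: "\<alpha> + 1 = osuc \<alpha>"
  by (simp add: one_omega1_def omega1_add_osuc)

lemma Min_image_strict_mono_on: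
  assumes "finite G" "G \<noteq> {}" "strict_mono_on G f"
  shows "Min (f ` G) = f (Min G)"
proof (rule Min_eqI)
  show "f (Min G) \<le> y" if y: "y \<in> f ` G" for y
  proof -
    from y obtain x where x: "x \<in> G" "y = f x" by blast
    have "Min G \<in> G" "Min G \<le> x" using assms x by auto
    then show ?thesis using assms(3) x by (metis strict_mono_on_leD)
  qed
qed (use assms in auto)

lemma Max_image_strict_mono_on:
  assumes "finite G" "G \<noteq> {}" "strict_mono_on G f"
  shows "Max (f ` G) = f (Max G)"
proof (rule Max_eqI)
  show "y \<le> f (Max G)" if y: "y \<in> f ` G" for y
  proof -
    from y obtain x where x: "x \<in> G" "y = f x" by blast
    have "Max G \<in> G" "x \<le> Max G" using assms x by auto
    then show ?thesis using assms(3) x by (metis strict_mono_on_leD)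
  qed
qed (use assms in auto)

section \<open>Spreading and hereditary properties of the Schreier families\<close>

definition spreading :: "nat set set \<Rightarrow> bool" where
  "spreading \<F> \<longleftrightarrow> (\<forall>F\<in>\<F>. \<forall>f. strict_mono_on F f \<longrightarrow> (\<forall>i\<in>F. i \<le> f i) \<longrightarrow> f ` F \<in> \<F>)"

lemma spreadingD:
  "spreading \<F> \<Longrightarrow> F \<in> \<F> \<Longrightarrow> strict_mono_on F f \<Longrightarrow> (\<And>i. i \<in> F \<Longrightarrow> i \<le> f i) \<Longrightarrow> f ` F \<in> \<F>"
  by (auto simp: spreading_def)

lemma spreading_schreier0: "spreading schreier0"
  by (auto simp: spreading_def schreier0_def)

lemma spreading_schreier1: "spreading schreier1"
  unfolding spreading_def
proof (intro ballI allI impI)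
  fix F and f :: "nat \<Rightarrow> nat"
  assume F: "F \<in> schreier1" and f: "strict_mono_on F f" and le: "\<forall>i\<in>F. i \<le> f i"
  show "f ` F \<in> schreier1"
  proof (cases "F = {}")
    case False
    then have fin: "finite F" and c: "card F \<le> Min F" using F by (auto simp: schreier1_def)
    have "card (f ` F) \<le> Min F" using card_image_le[OF fin, of f] c by simp
    also have "\<dots> \<le> f (Min F)" using le fin False by simp
    also have "\<dots> = Min (f ` F)" using Min_image_strict_mono_on[OF fin False f] by simp
    finally show ?thesis using fin by (auto simp: schreier1_def)
  qed (use F in auto)
qed

lemma family_compI:
  assumes "F = \<Union>(set Gs)" "set Gs \<subseteq> \<G> - {{}}"
    "sorted_wrt (\<lambda>G H. Max G < Min H) Gs" "Min ` set Gs \<in> \<F>"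
  shows "F \<in> family_comp \<F> \<G>"
  using assms unfolding family_comp_def by blast

lemma family_compE:
  assumes "F \<in> family_comp \<F> \<G>"
  obtains Gs where "F = \<Union>(set Gs)" "set Gs \<subseteq> \<G> - {{}}"
    "sorted_wrt (\<lambda>G H. Max G < Min H) Gs" "Min ` set Gs \<in> \<F>"
  using assms unfolding family_comp_def by blast

text \<open>The map acts piece by piece. Minima and maxima commute with it, so the pieces stay in
  order and the set of their minima is itself spread; each of the two families absorbs its own
  images.\<close>

lemma spreading_family_comp:
  assumes "spreading \<F>" "spreading \<G>" and fin: "\<And>G. G \<in> \<G> \<Longrightarrow> finite G"
  shows "spreading (family_comp \<F> \<G>)"
  unfolding spreading_def
proof (intro ballI allI impI)
  fix F and f :: "nat \<Rightarrow> nat"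
  assume F: "F \<in> family_comp \<F> \<G>" and f: "strict_mono_on F f" and le: "\<forall>i\<in>F. i \<le> f i"
  from F obtain Gs where Gs: "F = \<Union>(set Gs)" "set Gs \<subseteq> \<G> - {{}}"
    "sorted_wrt (\<lambda>G H. Max G < Min H) Gs" "Min ` set Gs \<in> \<F>"
    by (rule family_compE)
  have G: "finite G" "G \<noteq> {}" "G \<subseteq> F" "strict_mono_on G f" if "G \<in> set Gs" for G
    using that Gs fin f by (auto intro: monotone_on_subset)
  have Minin: "Min G \<in> F" "Max G \<in> F" if "G \<in> set Gs" for G
    using G[OF that] Min_in[of G] Max_in[of G] by blast+
  have "f ` F = \<Union>(set (map ((`) f) Gs))" using Gs(1) by auto
  moreover have "set (map ((`) f) Gs) \<subseteq> \<G> - {{}}"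
  proof -
    have "f ` G \<in> \<G>" if "G \<in> set Gs" for G
      using Gs(2) G[OF that] le that by (intro spreadingD[OF assms(2)]) blast+
    then show ?thesis using G by auto
  qed
  moreover have "sorted_wrt (\<lambda>G H. Max G < Min H) (map ((`) f) Gs)"
    unfolding sorted_wrt_map
    by (rule sorted_wrt_mono_rel[OF _ Gs(3)])
      (simp add: Min_image_strict_mono_on Max_image_strict_mono_on G strict_mono_onD[OF f] Minin)
  moreover have "Min ` set (map ((`) f) Gs) \<in> \<F>"
  proof -
    have "Min ` set (map ((`) f) Gs) = f ` Min ` set Gs"
      unfolding set_map image_image
      by (intro image_cong refl Min_image_strict_mono_on) (use G in auto)
    moreover have "f ` Min ` set Gs \<in> \<F>"
      using Minin le by (intro spreadingD[OF assms(1) Gs(4)] monotone_on_subset[OF f]) auto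
    ultimately show ?thesis by metis
  qed
  ultimately show "f ` F \<in> family_comp \<F> \<G>" by (rule family_compI)
qed

context
  fixes L :: "omega1 \<Rightarrow> nat \<Rightarrow> omega1"
  assumes L: "fundamental_sequences L"
begin

lemma schreier_limit_iff:
  "limit_ord \<alpha> \<Longrightarrow> F \<in> schreier L \<alpha> \<longleftrightarrow> (\<exists>n. F \<in> schreier L (L \<alpha> n) \<and> (\<forall>k\<in>F. n + 1 \<le> k))"
  by (simp add: schreier_limit[OF L])

lemma schreier_finite_pos: "F \<in> schreier L \<alpha> \<Longrightarrow> finite F \<and> 0 \<notin> F"
proof (induction \<alpha> arbitrary: F rule: omega1_induct)
  case zero
  then show ?case by (auto simp: schreier_0 schreier0_def)
next
  case (osuc \<alpha>)
  then show ?case by (fastforce simp: schreier_osuc family_comp_def)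
next
  case (limit \<alpha>)
  then show ?case using schreier_limit_iff fundamental_sequences_less[OF L] by blast
qed

lemma schreier_finite: "F \<in> schreier L \<alpha> \<Longrightarrow> finite F"
  and schreier_pos: "F \<in> schreier L \<alpha> \<Longrightarrow> i \<in> F \<Longrightarrow> 0 < i"
  using schreier_finite_pos by (blast, metis gr0I)

lemma spreading_schreier: "spreading (schreier L \<alpha>)"
proof (induction \<alpha> rule: omega1_induct)
  case zero
  then show ?case by (simp add: schreier_0 spreading_schreier0)
next
  case (osuc \<alpha>)
  then show ?case
    by (simp add: schreier_osuc spreading_family_comp spreading_schreier1 schreier_finite)
next
  case (limit \<alpha>)
  show ?case unfolding spreading_def
  proof (intro ballI allI impI)
    fix F and f :: "nat \<Rightarrow> nat"
    assume F: "F \<in> schreier L \<alpha>" and f: "strict_mono_on F f" "\<forall>i\<in>F. i \<le> f i"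
    then obtain n where n: "F \<in> schreier L (L \<alpha> n)" "\<forall>k\<in>F. n + 1 \<le> k"
      using schreier_limit_iff limit by blast
    then have "f ` F \<in> schreier L (L \<alpha> n)"
      using limit.IH[OF fundamental_sequences_less[OF L limit.hyps]] f by (blast intro: spreadingD)
    then show "f ` F \<in> schreier L \<alpha>"
      using schreier_limit_iff[OF limit.hyps] n(2) f(2) by fastforce
  qed
qed

lemma empty_in_schreier: "{} \<in> schreier L \<alpha>"
proof (induction \<alpha> rule: omega1_induct)
  case zero
  then show ?case by (simp add: schreier_0 schreier0_def)
next
  case (osuc \<alpha>)
  have "\<Union>(set []) \<in> schreier L (osuc \<alpha>)"
    unfolding schreier_osuc family_comp_def
    by (intro CollectI exI[of _ "[]"]) (auto simp: schreier1_def)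
  then show ?case by simp
next
  case (limit \<alpha>)
  then show ?case using schreier_limit_iff fundamental_sequences_less[OF L] by blast
qed

text \<open>A nonempty F is its own single piece. Its minimum is positive, so the one-element set of
  minima lies in \<open>schreier1\<close>.\<close>

lemma schreier_subset_osuc: "schreier L \<alpha> \<subseteq> schreier L (osuc \<alpha>)"
proof
  fix F assume F: "F \<in> schreier L \<alpha>"
  show "F \<in> schreier L (osuc \<alpha>)"
  proof (cases "F = {}")
    case False
    have "Min F \<in> F" using False schreier_finite[OF F] by simp
    then have "\<Union>(set [F]) \<in> schreier L (osuc \<alpha>)"
      unfolding schreier_osuc family_comp_def
      using F False schreier_pos[OF F, of "Min F"]
      by (intro CollectI exI[of _ "[F]"]) (auto simp: schreier1_def)
    then show ?thesis by simp
  qed (simp add: empty_in_schreier)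
qed

lemma singleton_in_schreier: "0 < n \<Longrightarrow> {n} \<in> schreier L \<alpha>"
proof (induction \<alpha> arbitrary: n rule: omega1_induct)
  case zero
  then show ?case by (simp add: schreier_0 schreier0_def)
next
  case (osuc \<alpha>)
  then show ?case using schreier_subset_osuc by blast
next
  case (limit \<alpha>)
  then show ?case
    using schreier_limit_iff[OF limit(1)] fundamental_sequences_less[OF L limit(1), of 0]
    by (auto intro!: exI[of _ 0])
qed

text \<open>At a successor every piece is intersected with H and the empty ones are discarded. The
  number of pieces does not grow and the first minimum does not drop, so the condition of
  \<open>schreier1\<close> survives.\<close>

lemma schreier_hereditary: "F \<in> schreier L \<alpha> \<Longrightarrow> H \<subseteq> F \<Longrightarrow> H \<in> schreier L \<alpha>"
proof (induction \<alpha> arbitrary: F H rule: omega1_induct)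
  case zero
  then show ?case by (auto simp: schreier_0 schreier0_def)
next
  case (osuc \<alpha>)
  from osuc.prems(1)[unfolded schreier_osuc] obtain Gs where Gs: "F = \<Union>(set Gs)" "set Gs \<subseteq> schreier L \<alpha> - {{}}"
    "sorted_wrt (\<lambda>G H. Max G < Min H) Gs" "Min ` set Gs \<in> schreier1"
    by (rule family_compE)
  have fin: "finite G" if "G \<in> set Gs" for G using Gs(2) that schreier_finite by blast
  have ne: "G \<noteq> {}" if "G \<in> set Gs" for G using Gs(2) that by blast
  define Hs where "Hs = map (\<lambda>G. G \<inter> H) (filter (\<lambda>G. G \<inter> H \<noteq> {}) Gs)"
  have "H = \<Union>(set Hs)" using osuc.prems(2) Gs(1) by (auto simp: Hs_def)
  moreover have "set Hs \<subseteq> schreier L \<alpha> - {{}}"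
    using Gs(2) osuc.IH by (auto simp: Hs_def)
  moreover have "sorted_wrt (\<lambda>G H. Max G < Min H) Hs"
    unfolding Hs_def sorted_wrt_map
  proof (rule sorted_wrt_mono_rel)
    show "sorted_wrt (\<lambda>G H. Max G < Min H) (filter (\<lambda>G. G \<inter> H \<noteq> {}) Gs)"
      by (rule sorted_wrt_filter[OF Gs(3)])
    fix G G' assume G: "G \<in> set (filter (\<lambda>G. G \<inter> H \<noteq> {}) Gs)" "G' \<in> set (filter (\<lambda>G. G \<inter> H \<noteq> {}) Gs)"
      and lt: "Max G < Min G'"
    have "Max (G \<inter> H) \<le> Max G" "Min G' \<le> Min (G' \<inter> H)"
      using G fin by (auto intro!: Max_mono Min_antimono)
    then show "Max (G \<inter> H) < Min (G' \<inter> H)" using lt by linarith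
  qed
  moreover have "Min ` set Hs \<in> schreier1"
  proof (cases "Hs = []")
    case False
    \<comment> \<open>Distinct pieces have distinct minima, so the bound on the set of minima is a
      bound on the number of pieces.\<close>
    have inj: "inj_on Min (set Gs)"
    proof -
      have "Min G < Min G'" if "Max G < Min G'" "G \<in> set Gs" for G G'
        using Min_le[OF fin[OF that(2)] Max_in[OF fin ne, OF that(2,2)]] that by linarith
      then have "sorted_wrt (<) (map Min Gs)"
        unfolding sorted_wrt_map by (blast intro: sorted_wrt_mono_rel[OF _ Gs(3)])
      then have "distinct (map Min Gs)" using strict_sorted_iff by blast
      then show ?thesis by (simp add: distinct_map)
    qed
    have Gne: "Min ` set Gs \<noteq> {}" using False by (auto simp: Hs_def filter_empty_conv)
    have "card (Min ` set Hs) \<le> card (set Hs)" by (simp add: card_image_le)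
    also have "\<dots> \<le> card (set Gs)"
      unfolding Hs_def set_map by (rule order.trans[OF card_image_le card_mono]) auto
    also have "\<dots> = card (Min ` set Gs)" by (simp add: card_image inj)
    also have "\<dots> \<le> Min (Min ` set Gs)" using Gs(4) Gne by (auto simp: schreier1_def)
    also have "\<dots> \<le> Min (Min ` set Hs)"
    proof -
      have "Min (Min ` set Gs) \<le> Min K" if "K \<in> set Hs" for K
      proof -
        from that obtain G where G: "G \<in> set Gs" "K = G \<inter> H" "K \<noteq> {}" by (auto simp: Hs_def)
        have "Min (Min ` set Gs) \<le> Min G" using G by simp
        also have "\<dots> \<le> Min K" using G fin by (auto intro!: Min_antimono)
        finally show ?thesis .
      qed
      then show ?thesis using False by simp
    qed
    finally show ?thesis by (simp add: schreier1_def)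
  qed (simp add: schreier1_def)
  ultimately show ?case unfolding schreier_osuc by (rule family_compI)
next
  case (limit \<alpha>)
  then obtain n where n: "F \<in> schreier L (L \<alpha> n)" "\<forall>k\<in>F. n + 1 \<le> k"
    using schreier_limit_iff[OF limit.hyps] by blast
  have "H \<in> schreier L (L \<alpha> n)"
    by (rule limit.IH[OF fundamental_sequences_less[OF L limit.hyps] n(1) limit.prems(2)])
  then show ?case
    using schreier_limit_iff[OF limit.hyps] n(2) limit.prems(2) by blast
qed

text \<open>The families need not increase with \<alpha>: at a limit a set must begin late enough
  for the term it uses. Discarding an initial segment of the integers repairs this, and each limit
  raises the threshold to at least n + 1.\<close>

lemma schreier_eventually_subset:
  "\<alpha> \<le> \<beta> \<Longrightarrow> \<exists>p. \<forall>F\<in>schreier L \<alpha>. (\<forall>k\<in>F. p \<le> k) \<longrightarrow> F \<in> schreier L \<beta>"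
proof (induction \<beta> arbitrary: \<alpha> rule: omega1_induct)
  case zero
  then have "\<alpha> = 0" using omega1_zero_le order_antisym by blast
  then show ?case by blast
next
  case (osuc \<beta>)
  show ?case
  proof (cases "\<alpha> = osuc \<beta>")
    case False
    then have "\<alpha> \<le> \<beta>" using osuc.prems less_osuc_iff by (metis order_le_less)
    then obtain p where "\<forall>F\<in>schreier L \<alpha>. (\<forall>k\<in>F. p \<le> k) \<longrightarrow> F \<in> schreier L \<beta>"
      using osuc.IH by blast
    then show ?thesis using schreier_subset_osuc[of \<beta>] by (intro exI[of _ p]) blast
  qed (simp add: exI[of _ 0])
next
  case (limit \<beta>)
  show ?case
  proof (cases "\<alpha> = \<beta>")
    case False
    then obtain n where n: "\<alpha> < L \<beta> n"
      using limit fundamental_sequences_cofinal[OF L] by (metis order_le_imp_less_or_eq)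
    obtain p where p: "\<forall>F\<in>schreier L \<alpha>. (\<forall>k\<in>F. p \<le> k) \<longrightarrow> F \<in> schreier L (L \<beta> n)"
      using limit.IH[OF fundamental_sequences_less[OF L limit.hyps]] n by (meson less_imp_le)
    have "F \<in> schreier L \<beta>" if "F \<in> schreier L \<alpha>" "\<forall>k\<in>F. max p (n + 1) \<le> k" for F
      using p that schreier_limit_iff[OF limit.hyps] by fastforce
    then show ?thesis by (intro exI[of _ "max p (n + 1)"]) blast
  qed (simp add: exI[of _ 0])
qed

text \<open>Each outer piece G is split into its own pieces. The minima of these pieces form a set
  in \<H> whose minimum is \<open>Min G\<close>, so grouping all minima by G shows that they form a
  member of \<F>[\<H>].\<close>

lemma family_comp_assoc:
  assumes "\<And>G. G \<in> \<G> \<Longrightarrow> finite G"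
  shows "family_comp \<F> (family_comp \<H> \<G>) \<subseteq> family_comp (family_comp \<F> \<H>) \<G>"
proof
  fix F assume "F \<in> family_comp \<F> (family_comp \<H> \<G>)"
  then obtain Gs where Gs: "F = \<Union>(set Gs)" "set Gs \<subseteq> family_comp \<H> \<G> - {{}}"
    "sorted_wrt (\<lambda>G H. Max G < Min H) Gs" "Min ` set Gs \<in> \<F>"
    by (rule family_compE)
  have "\<forall>G\<in>set Gs. \<exists>Ks. G = \<Union>(set Ks) \<and> set Ks \<subseteq> \<G> - {{}} \<and>
      sorted_wrt (\<lambda>G H. Max G < Min H) Ks \<and> Min ` set Ks \<in> \<H>"
    using Gs(2) by (auto simp: family_comp_def)
  then obtain K where K: "\<And>G. G \<in> set Gs \<Longrightarrow> G = \<Union>(set (K G))"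
      "\<And>G. G \<in> set Gs \<Longrightarrow> set (K G) \<subseteq> \<G> - {{}}"
      "\<And>G. G \<in> set Gs \<Longrightarrow> sorted_wrt (\<lambda>G H. Max G < Min H) (K G)"
      "\<And>G. G \<in> set Gs \<Longrightarrow> Min ` set (K G) \<in> \<H>"
    by metis
  have ne: "G \<noteq> {}" if "G \<in> set Gs" for G using Gs(2) that by blast
  have fK: "finite H" "H \<noteq> {}" if "G \<in> set Gs" "H \<in> set (K G)" for G H
    using K(2) that assms by blast+
  have fin: "finite G" if "G \<in> set Gs" for G
    using K(1)[OF that] fK[OF that] by (metis List.finite_set finite_Union)
  have MinG: "Min (Min ` set (K G)) = Min G" if "G \<in> set Gs" for G
  proof -
    have Kne: "K G \<noteq> []" using K(1)[OF that] ne[OF that] by auto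
    show ?thesis
    proof (rule Min_eqI[symmetric])
      have "Min (Min ` set (K G)) \<in> Min ` set (K G)" using Kne by (intro Min_in) auto
      then obtain H where H: "H \<in> set (K G)" "Min (Min ` set (K G)) = Min H" by auto
      then have "Min H \<in> H" using fK[OF that] by simp
      then show "Min (Min ` set (K G)) \<in> G" using H K(1)[OF that] by auto
      fix y assume "y \<in> G"
      then obtain H where H: "H \<in> set (K G)" "y \<in> H" using K(1)[OF \<open>G \<in> set Gs\<close>] by (metis UnionE)
      have "Min (Min ` set (K G)) \<le> Min H" using H by simp
      also have "\<dots> \<le> y" using H fK[OF \<open>G \<in> set Gs\<close>] by simp
      finally show "Min (Min ` set (K G)) \<le> y" .
    qed (use fin[OF that] in auto)
  qed
  have MaxG: "Max (Min ` set (K G)) \<le> Max G" if "G \<in> set Gs" for G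
  proof -
    have Kne: "K G \<noteq> []" using K(1)[OF that] ne[OF that] by auto
    have "Min H \<le> Max G" if H: "H \<in> set (K G)" for H
    proof -
      have "Min H \<in> G" using fK[OF \<open>G \<in> set Gs\<close> H] K(1)[OF \<open>G \<in> set Gs\<close>] H Min_in by blast
      then show ?thesis using fin[OF \<open>G \<in> set Gs\<close>] by simp
    qed
    then show ?thesis using Kne by simp
  qed
  define Ks where "Ks = concat (map K Gs)"
  have "F = \<Union>(set Ks)"
  proof -
    have "\<Union>(set Ks) = (\<Union>G\<in>set Gs. \<Union>(set (K G)))" by (auto simp: Ks_def)
    also have "\<dots> = \<Union>(set Gs)" using K(1) by auto
    finally show ?thesis using Gs(1) by simp
  qed
  moreover have "set Ks \<subseteq> \<G> - {{}}" using K(2) by (auto simp: Ks_def)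
  moreover have "sorted_wrt (\<lambda>G H. Max G < Min H) Ks"
  proof -
    have "sorted_wrt (\<lambda>G H. Max G < Min H) (concat (map K Gs'))"
      if "set Gs' \<subseteq> set Gs" "sorted_wrt (\<lambda>G H. Max G < Min H) Gs'" for Gs'
      using that
    proof (induction Gs')
      case (Cons G Gs')
      have "Max H < Min H'" if H: "H \<in> set (K G)" "G' \<in> set Gs'" "H' \<in> set (K G')" for H H' G'
      proof -
        have G: "G \<in> set Gs" "G' \<in> set Gs" using Cons.prems H by auto
        have "Max H \<in> G" "Min H' \<in> G'"
          using fK[OF G(1) H(1)] fK[OF G(2) H(3)] K(1)[OF G(1)] K(1)[OF G(2)] H
            Max_in[of H] Min_in[of H'] by blast+
        then have "Max H \<le> Max G" "Min G' \<le> Min H'" using fin G by auto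
        moreover have "Max G < Min G'" using Cons.prems H by auto
        ultimately show ?thesis by linarith
      qed
      then show ?case using Cons K(3) by (auto simp: sorted_wrt_append)
    qed simp
    then show ?thesis using Gs(3) by (simp add: Ks_def)
  qed
  moreover have "Min ` set Ks \<in> family_comp \<F> \<H>"
  proof -
    define Ms where "Ms = map (\<lambda>G. Min ` set (K G)) Gs"
    have "Min ` set Ks = \<Union>(set Ms)" by (auto simp: Ks_def Ms_def)
    moreover have "set Ms \<subseteq> \<H> - {{}}" using K(1,4) ne by (fastforce simp: Ms_def)
    moreover have "sorted_wrt (\<lambda>G H. Max G < Min H) Ms"
      unfolding Ms_def sorted_wrt_map
      by (rule sorted_wrt_mono_rel[OF _ Gs(3)]) (use MinG MaxG in fastforce)
    moreover have "Min ` set Ms = Min ` set Gs" unfolding Ms_def set_map image_image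
      by (intro image_cong refl) (use MinG in auto)
    ultimately show ?thesis using Gs(4) by (intro family_compI[of _ Ms]) simp_all
  qed
  ultimately show "F \<in> family_comp (family_comp \<F> \<H>) \<G>"
    by (rule family_compI)
qed

text \<open>A map that works may be replaced by any pointwise larger one, because the target is spreading;
  hence at a limit the maps of the smaller ordinals can be dominated by a single one.\<close>

lemma schreier_add_subset_comp:
  "\<exists>m. strict_mono m \<and> (\<forall>F\<in>schreier L (\<beta> + \<alpha>). m ` F \<in> family_comp (schreier L \<alpha>) (schreier L \<beta>))"
proof (induction \<alpha> rule: omega1_induct)
  case zero
  have "F \<in> family_comp (schreier L 0) (schreier L \<beta>)" if F: "F \<in> schreier L \<beta>" for F
  proof (cases "F = {}")
    case True
    have "\<Union>(set []) \<in> family_comp (schreier L 0) (schreier L \<beta>)"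
      unfolding family_comp_def by (intro CollectI exI[of _ "[]"]) (auto simp: empty_in_schreier)
    then show ?thesis using True by simp
  next
    case False
    have "Min F \<in> F" using False schreier_finite[OF F] by simp
    then have "\<Union>(set [F]) \<in> family_comp (schreier L 0) (schreier L \<beta>)"
      unfolding family_comp_def
      using F False schreier_pos[OF F, of "Min F"]
      by (intro CollectI exI[of _ "[F]"]) (auto simp: singleton_in_schreier)
    then show ?thesis by simp
  qed
  then show ?case by (intro exI[of _ "\<lambda>n. n"]) (auto simp: strict_mono_def)
next
  case (osuc \<alpha>)
  then obtain m where m: "strict_mono m"
    "\<And>F. F \<in> schreier L (\<beta> + \<alpha>) \<Longrightarrow> m ` F \<in> family_comp (schreier L \<alpha>) (schreier L \<beta>)" by blast
  have "m ` F \<in> family_comp (schreier L (osuc \<alpha>)) (schreier L \<beta>)" if F: "F \<in> schreier L (\<beta> + osuc \<alpha>)" for F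
  proof -
    have "F \<in> family_comp schreier1 (schreier L (\<beta> + \<alpha>))"
      using F by (simp add: omega1_add_osuc schreier_osuc)
    then obtain Gs where Gs: "F = \<Union>(set Gs)" "set Gs \<subseteq> schreier L (\<beta> + \<alpha>) - {{}}"
      "sorted_wrt (\<lambda>G H. Max G < Min H) Gs" "Min ` set Gs \<in> schreier1"
      by (rule family_compE)
    have G: "finite G" "G \<noteq> {}" if "G \<in> set Gs" for G
      using Gs(2) that schreier_finite by blast+
    have sm: "strict_mono_on A m" for A using m(1) by (auto simp: strict_mono_on_def strict_mono_def)
    have MM: "Min (m ` G) = m (Min G)" "Max (m ` G) = m (Max G)" if "G \<in> set Gs" for G
      using Min_image_strict_mono_on[OF G sm] Max_image_strict_mono_on[OF G sm] that by auto
    have "m ` F = \<Union>(set (map ((`) m) Gs))" using Gs(1) by auto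
    moreover have "set (map ((`) m) Gs) \<subseteq> family_comp (schreier L \<alpha>) (schreier L \<beta>) - {{}}"
      using Gs(2) m(2) by auto
    moreover have "sorted_wrt (\<lambda>G H. Max G < Min H) (map ((`) m) Gs)"
      unfolding sorted_wrt_map
      by (rule sorted_wrt_mono_rel[OF _ Gs(3)]) (simp add: MM strict_monoD[OF m(1)])
    moreover have "Min ` set (map ((`) m) Gs) \<in> schreier1"
    proof -
      have "Min ` set (map ((`) m) Gs) = m ` Min ` set Gs"
        unfolding set_map image_image by (intro image_cong refl) (use MM in auto)
      then show ?thesis
        using spreadingD[OF spreading_schreier1 Gs(4) sm strict_mono_imp_increasing[OF m(1)]] by metis
    qed
    ultimately have "m ` F \<in> family_comp schreier1 (family_comp (schreier L \<alpha>) (schreier L \<beta>))"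
      by (rule family_compI)
    then show ?thesis
      unfolding schreier_osuc using family_comp_assoc schreier_finite by blast
  qed
  then show ?case using m(1) by blast
next
  case (limit \<alpha>)
  let ?\<theta> = "\<beta> + \<alpha>"
  have lim: "limit_ord ?\<theta>" using limit.hyps by (rule limit_ord_add)
  \<comment> \<open>The sequences chosen for \<open>\<beta> + \<alpha>\<close> and for \<alpha> are
    unrelated, but the ordinals \<open>\<beta> + L \<alpha> k\<close> are cofinal in
    \<open>\<beta> + \<alpha>\<close>, so each term of the former lies below one of them.\<close>
  have "\<exists>k p. \<forall>F\<in>schreier L (L ?\<theta> n). (\<forall>i\<in>F. p \<le> i) \<longrightarrow> F \<in> schreier L (\<beta> + L \<alpha> k)" for n
  proof -
    obtain \<delta> where "\<delta> < \<alpha>" "L ?\<theta> n < \<beta> + \<delta>"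
      using less_limit_add[OF limit.hyps fundamental_sequences_less[OF L lim]] by blast
    moreover obtain k where "\<delta> < L \<alpha> k"
      using fundamental_sequences_cofinal[OF L limit.hyps] \<open>\<delta> < \<alpha>\<close> by blast
    ultimately have "L ?\<theta> n \<le> \<beta> + L \<alpha> k"
      using omega1_add_strict_mono[of \<delta> "L \<alpha> k" \<beta>] by (meson less_imp_le less_trans)
    then show ?thesis using schreier_eventually_subset by blast
  qed
  then obtain k p where kp: "\<And>n F. F \<in> schreier L (L ?\<theta> n) \<Longrightarrow> (\<forall>i\<in>F. p n \<le> i)
      \<Longrightarrow> F \<in> schreier L (\<beta> + L \<alpha> (k n))" by metis
  have "\<forall>n. \<exists>m. strict_mono m \<and> (\<forall>F\<in>schreier L (\<beta> + L \<alpha> (k n)).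
      m ` F \<in> family_comp (schreier L (L \<alpha> (k n))) (schreier L \<beta>))"
    using limit.IH[OF fundamental_sequences_less[OF L limit.hyps]] by blast
  then obtain m where m: "\<And>n. strict_mono (m n)" "\<And>n F. F \<in> schreier L (\<beta> + L \<alpha> (k n)) \<Longrightarrow>
      m n ` F \<in> family_comp (schreier L (L \<alpha> (k n))) (schreier L \<beta>)" by metis
  \<comment> \<open>The shift by \<open>p n\<close> brings sets into the range where the inclusion
    for n holds; the shift by \<open>k n + 1\<close> makes their images begin late enough to use the
    term \<open>k n\<close> at the limit \<alpha>. \<open>M\<close> dominates \<open>g n\<close> at
    every i \<ge> n + 1, and sets using the n-th term consist of such points.\<close>
  define g where "g n i = m n (i + p n + k n + 1)" for n i
  define M where "M = rec_nat 0 (\<lambda>i a. Suc (a + (\<Sum>n\<le>i. g n (Suc i))))"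
  have M0: "M 0 = 0" and MS: "M (Suc i) = Suc (M i + (\<Sum>n\<le>i. g n (Suc i)))" for i
    by (simp_all add: M_def)
  have sM: "strict_mono M" by (rule strict_monoI_Suc) (simp add: MS)
  have gM: "g n i \<le> M i" if ni: "n + 1 \<le> i" for n i
  proof -
    obtain j where j: "i = Suc j" "n \<le> j" using ni by (cases i) simp_all
    have "g n i \<le> (\<Sum>n\<le>j. g n i)" by (rule member_le_sum) (use j in auto)
    then show ?thesis using j MS by simp
  qed
  have "M ` F \<in> family_comp (schreier L \<alpha>) (schreier L \<beta>)" if "F \<in> schreier L ?\<theta>" for F
  proof -
    from that obtain n where n: "F \<in> schreier L (L ?\<theta> n)" "\<forall>i\<in>F. n + 1 \<le> i"
      using schreier_limit_iff[OF lim] by blast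
    let ?h = "\<lambda>i. i + p n + k n + 1"
    have sg: "strict_mono (g n)" unfolding g_def
      using m(1)[of n] by (auto simp: strict_mono_def)
    have "?h ` F \<in> schreier L (L ?\<theta> n)"
      by (rule spreadingD[OF spreading_schreier n(1)]) (auto simp: strict_mono_on_def)
    then have "?h ` F \<in> schreier L (\<beta> + L \<alpha> (k n))" by (rule kp) auto
    from m(2)[OF this] have gF: "g n ` F \<in> family_comp (schreier L (L \<alpha> (k n))) (schreier L \<beta>)"
      by (simp add: g_def image_image)
    have gF': "g n ` F \<in> family_comp (schreier L \<alpha>) (schreier L \<beta>)"
    proof -
      obtain Gs where Gs: "g n ` F = \<Union>(set Gs)" "set Gs \<subseteq> schreier L \<beta> - {{}}"
        "sorted_wrt (\<lambda>G H. Max G < Min H) Gs" "Min ` set Gs \<in> schreier L (L \<alpha> (k n))"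
        using gF by (rule family_compE)
      have "k n + 1 \<le> i" if "i \<in> g n ` F" for i
      proof -
        from that obtain j where "i = m n (j + p n + k n + 1)" by (auto simp: g_def)
        then show ?thesis using strict_mono_imp_increasing[OF m(1)[of n], of "j + p n + k n + 1"] by linarith
      qed
      moreover have "Min G \<in> g n ` F" if "G \<in> set Gs" for G
        using Gs(1,2) that schreier_finite Min_in by blast
      ultimately have "\<forall>i\<in>Min ` set Gs. k n + 1 \<le> i" by blast
      then have "Min ` set Gs \<in> schreier L \<alpha>"
        using schreier_limit_iff[OF limit.hyps] Gs(4) by blast
      then show ?thesis using Gs by (intro family_compI)
    qed
    \<comment> \<open>\<open>q\<close> turns the image under \<open>g n\<close> into the image under
      \<open>M\<close> and only moves points to the right, so spreading applies.\<close>
    define q where "q = M \<circ> inv_into F (g n)"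
    have inj: "inj_on (g n) F" using sg strict_mono_imp_inj_on by (blast intro: inj_on_subset)
    have q: "q (g n i) = M i" if "i \<in> F" for i
      using inv_into_f_f[OF inj that] by (simp add: q_def)
    have "q ` g n ` F \<in> family_comp (schreier L \<alpha>) (schreier L \<beta>)"
    proof (rule spreadingD[OF spreading_family_comp[OF spreading_schreier spreading_schreier] gF'])
      show "strict_mono_on (g n ` F) q"
        using q strict_monoD[OF sM] strict_mono_less[OF sg] by (auto simp: strict_mono_on_def)
    qed (use q gM n(2) schreier_finite in auto)
    moreover have "q ` g n ` F = M ` F" using q by (force simp: image_iff)
    ultimately show ?thesis by simp
  qed
  then show ?case using sM by blast
qed

text \<open>A function that decreases along end-extensions bounds the rank of the tree from above,
  so the conclusion says that this tree has rank at least \<alpha>, even when only points from m on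
  are used. A variable m is what the induction needs: sets are confined beyond a chosen first point
  at a successor, and beyond n at a limit.\<close>

lemma schreier_rank:
  assumes "\<And>F i. insert i F \<in> schreier L \<alpha> \<Longrightarrow> \<forall>j\<in>F. m \<le> j \<and> j < i \<Longrightarrow> m \<le> i \<Longrightarrow> \<rho> (insert i F) < (\<rho> F :: omega1)"
  shows "\<alpha> \<le> \<rho> {}"
  using assms
proof (induction \<alpha> arbitrary: m \<rho> rule: omega1_induct)
  case (osuc \<alpha>)
  \<comment> \<open>The value 2 permits two pieces with first minimum i: {i} and any nonempty member
    of \<open>S\<^sub>\<alpha>\<close> beyond i. Hence a copy of \<open>S\<^sub>\<alpha>\<close>
    sits above {i}, and the step from {} to {i} adds one to the rank.\<close>
  define i where "i = max m 2"
  have "\<alpha> \<le> \<rho> (insert i {})"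
  proof (rule osuc.IH[where m = "Suc i" and \<rho> = "\<lambda>F. \<rho> (insert i F)"])
    fix F j assume F: "insert j F \<in> schreier L \<alpha>" "\<forall>k\<in>F. Suc i \<le> k \<and> k < j" "Suc i \<le> j"
    have fin: "finite (insert j F)" using schreier_finite[OF F(1)] .
    have "Suc i \<le> Min (insert j F)" using fin F by auto
    moreover from this have "{i, Min (insert j F)} \<in> schreier1"
      by (auto simp: schreier1_def i_def simp del: Min_gr_iff Min_ge_iff Min_insert finite_insert)
         (auto simp: card_insert_if)
    ultimately have "\<Union>(set [{i}, insert j F]) \<in> schreier L (osuc \<alpha>)"
      unfolding schreier_osuc using F(1) singleton_in_schreier[of i \<alpha>]
      by (intro family_compI[OF refl]) (auto simp del: Min_insert Min_gr_iff finite_insert simp: i_def)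
    moreover have "\<Union>(set [{i}, insert j F]) = insert j (insert i F)" by auto
    ultimately have "insert j (insert i F) \<in> schreier L (osuc \<alpha>)" by metis
    then have "\<rho> (insert j (insert i F)) < \<rho> (insert i F)"
      using F by (intro osuc.prems) (auto simp: i_def)
    then show "\<rho> (insert i (insert j F)) < \<rho> (insert i F)" by (simp add: insert_commute)
  qed
  also have "\<rho> (insert i {}) < \<rho> {}"
    by (rule osuc.prems) (auto simp: singleton_in_schreier i_def)
  finally show ?case by (simp add: osuc_le_iff)
next
  case (limit \<alpha>)
  have "L \<alpha> n \<le> \<rho> {}" for n
  proof (rule limit.IH[OF fundamental_sequences_less[OF L limit.hyps], where m = "max m (n + 1)"])
    fix F i assume F: "insert i F \<in> schreier L (L \<alpha> n)" "\<forall>j\<in>F. max m (n + 1) \<le> j \<and> j < i" "max m (n + 1) \<le> i"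
    have "insert i F \<in> schreier L \<alpha>"
      using F by (auto simp: schreier_limit_iff[OF limit.hyps] intro!: exI[of _ n])
    then show "\<rho> (insert i F) < \<rho> F" using F by (intro limit.prems) auto
  qed
  then show ?case
    using fundamental_sequences_cofinal[OF L limit.hyps] by (meson leD leI less_le_trans)
qed simp

end

text \<open>The rank of a point is the least strict upper bound of the ranks of its predecessors; it
  exists below \<open>\<omega>\<^sub>1\<close> because these are countably many.\<close>

lemma ex_omega1_rank:
  assumes "wf R" "\<And>t. countable {s. (s, t) \<in> R}"
  shows "\<exists>\<rho> :: 'b \<Rightarrow> omega1. \<forall>s t. (s, t) \<in> R \<longrightarrow> \<rho> s < \<rho> t"
proof -
  define \<rho> :: "'b \<Rightarrow> omega1" where
    "\<rho> = wfrec R (\<lambda>f t. LEAST \<beta>. \<forall>s. (s, t) \<in> R \<longrightarrow> f s < \<beta>)"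
  have \<rho>: "\<rho> t = (LEAST \<beta>. \<forall>s. (s, t) \<in> R \<longrightarrow> \<rho> s < \<beta>)" for t
    unfolding \<rho>_def by (subst wfrec[OF assms(1)]) (simp add: cut_apply cong: imp_cong)
  have "\<forall>s. (s, t) \<in> R \<longrightarrow> \<rho> s < \<rho> t" for t
  proof -
    have "\<exists>\<beta>. \<forall>s. (s, t) \<in> R \<longrightarrow> \<rho> s < \<beta>"
      using countable_strict_bound_omega1[of "\<rho> ` {s. (s, t) \<in> R}"] assms(2) by auto
    from LeastI_ex[OF this] show ?thesis by (subst \<rho>)
  qed
  then show ?thesis by blast
qed

section \<open>Block bases\<close>

text \<open>This is Grunblum's criterion for basic sequences. It involves finite sums only and
  passes to block bases with the same constant.\<close>

definition basic_seq :: "(nat \<Rightarrow> 'a::real_normed_vector) \<Rightarrow> bool" where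
  "basic_seq x \<longleftrightarrow> (\<forall>i. x i \<noteq> 0) \<and>
     (\<exists>K. \<forall>a n m. n \<le> m \<longrightarrow> norm (\<Sum>j<n. a j *\<^sub>R x j) \<le> K * norm (\<Sum>j<m. a j *\<^sub>R x j))"

definition csupp :: "(nat \<Rightarrow> 'a::real_normed_vector) \<Rightarrow> 'a \<Rightarrow> nat set" where
  "csupp x v = {i. coeffs x v i \<noteq> 0}"

text \<open>The cut points of \<open>block_on\<close> are replaced by the order of supports, which
  makes transitivity and passage to subsets of the index set easy. For initial segments and for all
  of the integers both notions agree (\<open>block_on_lessThan_iff\<close>,
  \<open>block_basis_iff\<close>).\<close>

definition successive :: "nat set \<Rightarrow> (nat \<Rightarrow> 'a::real_normed_vector) \<Rightarrow> (nat \<Rightarrow> 'a) \<Rightarrow> bool" where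
  "successive I x y \<longleftrightarrow> (\<forall>i\<in>I. y i \<in> span (range x) \<and> y i \<noteq> 0) \<and>
     (\<forall>i\<in>I. \<forall>j\<in>I. i < j \<longrightarrow> (\<forall>a\<in>csupp x (y i). \<forall>b\<in>csupp x (y j). a < b))"

lemma basic_seq_nonzero: "basic_seq x \<Longrightarrow> x i \<noteq> 0"
  by (simp add: basic_seq_def)

text \<open>Each partial sum is bounded by K times every later one, and these tend to 0.\<close>

lemma basic_seq_sums_0:
  assumes "basic_seq x" "(\<lambda>i. a i *\<^sub>R x i) sums 0"
  shows "a i = 0"
proof -
  obtain K where K: "\<And>a n m. n \<le> m \<Longrightarrow> norm (\<Sum>j<n. a j *\<^sub>R x j) \<le> K * norm (\<Sum>j<m. a j *\<^sub>R x j)"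
    using assms(1) unfolding basic_seq_def by blast
  have "(\<Sum>j<n. a j *\<^sub>R x j) = 0" for n
  proof -
    have "(\<lambda>m. K * norm (\<Sum>j<m. a j *\<^sub>R x j)) \<longlonglongrightarrow> K * norm (0::'a)"
      using assms(2) unfolding sums_def by (intro tendsto_intros)
    then have "norm (\<Sum>j<n. a j *\<^sub>R x j) \<le> K * norm (0::'a)"
      by (rule LIMSEQ_le_const) (use K in blast)
    then show ?thesis by simp
  qed
  from this[of "Suc i"] this[of i] have "a i *\<^sub>R x i = 0" by simp
  then show ?thesis using basic_seq_nonzero[OF assms(1)] by simp
qed

lemma coeffs_eqI:
  assumes "basic_seq x" "(\<lambda>i. a i *\<^sub>R x i) sums v"
  shows "coeffs x v = a"
  unfolding coeffs_def
proof (rule the_equality)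
  show "(\<lambda>i. a i *\<^sub>R x i) sums v" by fact
  fix b assume "(\<lambda>i. b i *\<^sub>R x i) sums v"
  from sums_diff[OF this assms(2)] have "(\<lambda>i. (b i - a i) *\<^sub>R x i) sums 0"
    by (simp add: scaleR_left_diff_distrib)
  from basic_seq_sums_0[OF assms(1) this] show "b = a" by auto
qed

lemma coeffs_finite_sum:
  assumes "basic_seq x" "finite A"
  shows "coeffs x (\<Sum>i\<in>A. a i *\<^sub>R x i) = (\<lambda>i. if i \<in> A then a i else 0)"
proof (rule coeffs_eqI[OF assms(1)])
  have "(\<lambda>i. if i \<in> A then a i *\<^sub>R x i else 0) sums (\<Sum>i\<in>A. a i *\<^sub>R x i)"
    by (rule sums_If_finite_set[OF assms(2)])
  then show "(\<lambda>i. (if i \<in> A then a i else 0) *\<^sub>R x i) sums (\<Sum>i\<in>A. a i *\<^sub>R x i)"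
    by (rule back_subst[of "\<lambda>f. f sums _"]) auto
qed

lemma span_range_finite_sum:
  assumes "v \<in> span (range x)"
  shows "\<exists>A a. finite A \<and> v = (\<Sum>i\<in>A. a i *\<^sub>R x i)"
proof -
  obtain t r where t: "finite t" "t \<subseteq> range x" "v = (\<Sum>a\<in>t. r a *\<^sub>R a)"
    using assms unfolding span_explicit by blast
  obtain A where A: "inj_on x A" "t = x ` A" using t(2) by (metis subset_image_inj)
  have "finite A" using A t(1) finite_imageD by blast
  moreover have "v = (\<Sum>i\<in>A. r (x i) *\<^sub>R x i)"
    using t(3) by (simp add: A(2) sum.reindex[OF A(1)])
  ultimately show ?thesis by (intro exI[of _ A] exI[of _ "\<lambda>i. r (x i)"] conjI)
qed

text \<open>This recovers the number of a block from a position inside it. \<open>block_on\<close>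
  wants one coefficient function for all blocks, and this is how the separate ones are
  glued.\<close>

lemma Least_block_index:
  fixes p :: "nat \<Rightarrow> nat"
  assumes "strict_mono p" "p i \<le> j" "j < p (Suc i)"
  shows "(LEAST i. j < p (Suc i)) = (i::nat)"
proof (rule Least_equality)
  show "j < p (Suc i)" by fact
  fix k assume k: "j < p (Suc k)"
  then have "p i < p (Suc k)" using assms(2) by linarith
  then show "i \<le> k" using strict_mono_less[OF assms(1)] by simp
qed

section \<open>Coefficients and supports of finite combinations\<close>

context
  fixes x :: "nat \<Rightarrow> 'a::real_normed_vector"
  assumes x: "basic_seq x"
begin

lemma csupp_finite_sum: "finite A \<Longrightarrow> csupp x (\<Sum>i\<in>A. a i *\<^sub>R x i) = {i\<in>A. a i \<noteq> 0}"
  by (auto simp: csupp_def coeffs_finite_sum[OF x])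

lemma finite_csupp: "v \<in> span (range x) \<Longrightarrow> finite (csupp x v)"
  using span_range_finite_sum[of v x] by (auto simp: csupp_finite_sum)

lemma span_range_expand:
  assumes "v \<in> span (range x)" "finite A" "csupp x v \<subseteq> A"
  shows "v = (\<Sum>i\<in>A. coeffs x v i *\<^sub>R x i)"
proof -
  obtain B b where B: "finite B" "v = (\<Sum>i\<in>B. b i *\<^sub>R x i)"
    using span_range_finite_sum[OF assms(1)] by blast
  have c: "coeffs x v = (\<lambda>i. if i \<in> B then b i else 0)"
    unfolding B(2) by (rule coeffs_finite_sum[OF x B(1)])
  have "v = (\<Sum>i\<in>B. coeffs x v i *\<^sub>R x i)" unfolding c using B(2) by simp
  also have "\<dots> = (\<Sum>i\<in>A \<union> B. coeffs x v i *\<^sub>R x i)"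
    by (rule sum.mono_neutral_left) (use assms(2) B(1) c in auto)
  also have "\<dots> = (\<Sum>i\<in>A. coeffs x v i *\<^sub>R x i)"
    by (rule sum.mono_neutral_right) (use assms(2,3) B(1) in \<open>auto simp: csupp_def\<close>)
  finally show ?thesis .
qed

lemma span_range_sums: "v \<in> span (range x) \<Longrightarrow> (\<lambda>i. coeffs x v i *\<^sub>R x i) sums v"
  using sums_finite[OF finite_csupp[of v], of "\<lambda>i. coeffs x v i *\<^sub>R x i"]
    span_range_expand[OF _ finite_csupp order_refl, of v]
  by (simp add: csupp_def)

lemma coeffs_lincomb:
  assumes "\<And>i. i \<in> A \<Longrightarrow> u i \<in> span (range x)"
  shows "coeffs x (\<Sum>i\<in>A. b i *\<^sub>R u i) j = (\<Sum>i\<in>A. b i * coeffs x (u i) j)"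
proof -
  have "(\<lambda>j. \<Sum>i\<in>A. b i *\<^sub>R (coeffs x (u i) j *\<^sub>R x j)) sums (\<Sum>i\<in>A. b i *\<^sub>R u i)"
    by (intro sums_sum sums_scaleR_right span_range_sums assms)
  then have "(\<lambda>j. (\<Sum>i\<in>A. b i * coeffs x (u i) j) *\<^sub>R x j) sums (\<Sum>i\<in>A. b i *\<^sub>R u i)"
    by (simp add: scaleR_left.sum)
  from coeffs_eqI[OF x this] show ?thesis by simp
qed

lemma coeffs_scaleR: "v \<in> span (range x) \<Longrightarrow> coeffs x (r *\<^sub>R v) j = r * coeffs x v j"
  using coeffs_lincomb[of "{0::nat}" "\<lambda>_. v" "\<lambda>_. r" j] by simp

lemma coeffs_sum:
  "(\<And>i. i \<in> A \<Longrightarrow> u i \<in> span (range x)) \<Longrightarrow> coeffs x (\<Sum>i\<in>A. u i) j = (\<Sum>i\<in>A. coeffs x (u i) j)"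
  using coeffs_lincomb[of A u "\<lambda>_. 1" j] by simp

lemma csupp_scaleR: "v \<in> span (range x) \<Longrightarrow> r \<noteq> 0 \<Longrightarrow> csupp x (r *\<^sub>R v) = csupp x v"
  by (simp add: csupp_def coeffs_scaleR)

lemma csupp_nonempty: "v \<in> span (range x) \<Longrightarrow> v \<noteq> 0 \<Longrightarrow> csupp x v \<noteq> {}"
  using span_range_expand[of v "{}"] by auto

lemma Min_csupp_in: "v \<in> span (range x) \<Longrightarrow> v \<noteq> 0 \<Longrightarrow> Min (csupp x v) \<in> csupp x v"
  by (simp add: csupp_nonempty finite_csupp)

lemma csupp_term: "csupp x (x i) = {i}"
  using csupp_finite_sum[of "{i}" "\<lambda>_. 1"] by auto

lemma csupp_subset_sum:
  "(\<And>i. i \<in> A \<Longrightarrow> u i \<in> span (range x)) \<Longrightarrow> csupp x (\<Sum>i\<in>A. u i) \<subseteq> (\<Union>i\<in>A. csupp x (u i))"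
  by (auto simp: csupp_def coeffs_sum) (metis sum.not_neutral_contains_not_neutral)

lemma Min_supp: "v \<in> span (range x) \<Longrightarrow> v \<noteq> 0 \<Longrightarrow> Min (supp x v) = Suc (Min (csupp x v))"
  unfolding supp_def csupp_def[symmetric]
  by (rule Min_image_strict_mono_on) (auto simp: finite_csupp csupp_nonempty strict_mono_on_def)

lemma successive_disjoint:
  assumes "successive I x y" "i \<in> I" "j \<in> I" "a \<in> csupp x (y i)" "a \<in> csupp x (y j)"
  shows "i = j"
  using assms unfolding successive_def by (metis less_irrefl linorder_neqE_nat)

lemma block_on_successive:
  assumes "block_on I x y"
  shows "successive I x y"
proof -
  obtain p a where p: "strict_mono (p :: nat \<Rightarrow> nat)"
    "\<And>i. i \<in> I \<Longrightarrow> y i = (\<Sum>j\<in>{p i..<p (Suc i)}. a j *\<^sub>R x j)" "\<And>i. i \<in> I \<Longrightarrow> y i \<noteq> 0"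
    using assms unfolding block_on_def by blast
  have c: "csupp x (y i) \<subseteq> {p i..<p (Suc i)}" if "i \<in> I" for i
    using p(2)[OF that] by (auto simp: csupp_finite_sum)
  have "y i \<in> span (range x)" if "i \<in> I" for i
    unfolding p(2)[OF that] by (intro span_sum span_scale span_base) auto
  moreover have "b < b'" if "i \<in> I" "j \<in> I" "i < j" "b \<in> csupp x (y i)" "b' \<in> csupp x (y j)" for i j b b'
  proof -
    have "b < p (Suc i)" "p j \<le> b'" using that c by fastforce+
    moreover have "p (Suc i) \<le> p j" using that strict_mono_less_eq[OF p(1)] by simp
    ultimately show ?thesis by linarith
  qed
  ultimately show ?thesis using p(3) unfolding successive_def by blast
qed

lemma block_onI:
  assumes p: "strict_mono p" and y: "\<And>i. i \<in> I \<Longrightarrow> y i \<in> span (range x)" "\<And>i. i \<in> I \<Longrightarrow> y i \<noteq> 0"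
    and c: "\<And>i. i \<in> I \<Longrightarrow> csupp x (y i) \<subseteq> {p i..<p (Suc i)}"
  shows "block_on I x y"
proof -
  define a where "a j = coeffs x (y (LEAST i. j < p (Suc i))) j" for j
  have "y i = (\<Sum>j\<in>{p i..<p (Suc i)}. a j *\<^sub>R x j)" if "i \<in> I" for i
  proof -
    have "y i = (\<Sum>j\<in>{p i..<p (Suc i)}. coeffs x (y i) j *\<^sub>R x j)"
      by (rule span_range_expand) (use y c that in auto)
    also have "\<dots> = (\<Sum>j\<in>{p i..<p (Suc i)}. a j *\<^sub>R x j)"
      by (rule sum.cong) (auto simp: a_def Least_block_index[OF p])
    finally show ?thesis .
  qed
  then show ?thesis unfolding block_on_def using p y(2) by blast
qed

lemma block_basis_iff: "block_basis x y \<longleftrightarrow> successive UNIV x y"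
proof
  assume s: "successive UNIV x y"
  then have y: "y i \<in> span (range x)" "y i \<noteq> 0" for i by (auto simp: successive_def)
  show "block_basis x y"
  proof (rule block_onI[where p = "\<lambda>i. Min (csupp x (y i))"])
    have less: "a < Min (csupp x (y (Suc i)))" if "a \<in> csupp x (y i)" for a i
      using s that Min_csupp_in[OF y, of "Suc i"] lessI[of i] unfolding successive_def by blast
    then show "strict_mono (\<lambda>i. Min (csupp x (y i)))"
      by (intro strict_monoI_Suc) (use Min_csupp_in[OF y] in blast)
    show "csupp x (y i) \<subseteq> {Min (csupp x (y i))..<Min (csupp x (y (Suc i)))}" for i
      using less finite_csupp[OF y(1)] by auto
  qed (use y in auto)
qed (rule block_on_successive)

lemma block_on_lessThan_iff: "block_on {..<k} x y \<longleftrightarrow> successive {..<k} x y"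
proof
  assume s: "successive {..<k} x y"
  then have y: "y i \<in> span (range x)" "y i \<noteq> 0" if "i < k" for i
    using that unfolding successive_def by blast+
  define M where "M = Suc (\<Sum>i<k. Max (csupp x (y i)))"
  have M: "a < M" if "i < k" "a \<in> csupp x (y i)" for i a
  proof -
    have "a \<le> Max (csupp x (y i))" using that finite_csupp[OF y(1)] by simp
    also have "\<dots> \<le> (\<Sum>i<k. Max (csupp x (y i)))" by (rule member_le_sum) (use that in auto)
    finally show ?thesis by (simp add: M_def)
  qed
  \<comment> \<open>After the last block the cut points continue beyond \<open>M\<close>, which
    exceeds every support; \<open>block_on\<close> requires an infinite increasing sequence even for
    finitely many blocks.\<close>
  define p where "p i = (if i < k then Min (csupp x (y i)) else M + i)" for i
  have less: "a < p (Suc i)" if "i < k" "a \<in> csupp x (y i)" for a i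
  proof (cases "Suc i < k")
    case True
    then have "a < Min (csupp x (y (Suc i)))"
      using s that Min_csupp_in[OF y[OF True]] unfolding successive_def
      by (metis lessI lessThan_iff)
    then show ?thesis using True by (simp add: p_def)
  next
    case False
    then show ?thesis using M[OF that] by (simp add: p_def)
  qed
  show "block_on {..<k} x y"
  proof (rule block_onI[where p = p])
    have "p i < p (Suc i)" for i
    proof (cases "i < k")
      case True
      then show ?thesis using less[OF True Min_csupp_in[OF y[OF True]]] by (simp add: p_def)
    qed (simp add: p_def)
    then show "strict_mono p" by (rule strict_monoI_Suc)
    show "csupp x (y i) \<subseteq> {p i..<p (Suc i)}" if "i \<in> {..<k}" for i
    proof
      fix a assume a: "a \<in> csupp x (y i)"
      have "p i \<le> a" using that a finite_csupp[OF y(1)] by (simp add: p_def)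
      then show "a \<in> {p i..<p (Suc i)}" using less a that by simp
    qed
  qed (use y in auto)
qed (rule block_on_successive)

lemma successiveD:
  assumes "successive I x y" "i \<in> I"
  shows "y i \<in> span (range x)" "y i \<noteq> 0"
  using assms by (auto simp: successive_def)

lemma successive_Min_less:
  assumes "successive I x y" "i \<in> I" "j \<in> I" "i < j"
  shows "Min (csupp x (y i)) < Min (csupp x (y j))"
  using assms Min_csupp_in[OF successiveD[OF assms(1)]] unfolding successive_def by blast

lemma block_basis_subseq:
  assumes "strict_mono m"
  shows "block_basis x (\<lambda>i. x (m i))"
  using strict_monoD[OF assms]
  by (auto simp: block_basis_iff successive_def csupp_term basic_seq_nonzero[OF x] intro: span_base)

lemma block_basis_tail: "block_basis x (\<lambda>i. x (n + i))"
  by (rule block_basis_subseq) (simp add: strict_mono_def)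

lemma block_basis_refl: "block_basis x x"
  using block_basis_tail[of 0] by simp

context
  fixes y
  assumes y: "block_basis x y"
begin

lemma block_in_span: "y i \<in> span (range x)" and block_nonzero: "y i \<noteq> 0"
  using y successiveD[of UNIV y i] by (auto simp: block_basis_iff)

lemma span_block_subset: "span (range y) \<subseteq> span (range x)"
  using block_in_span by (intro span_minimal subspace_span) auto

text \<open>A sum over the first n blocks is the partial sum up to \<open>p n\<close> of a
  combination of x, so the constant K is inherited.\<close>

lemma basic_seq_block: "basic_seq y"
proof -
  obtain K where K: "\<And>a n m. n \<le> m \<Longrightarrow> norm (\<Sum>j<n. a j *\<^sub>R x j) \<le> K * norm (\<Sum>j<m. a j *\<^sub>R x j)"
    using x unfolding basic_seq_def by blast
  obtain p a where p: "strict_mono (p :: nat \<Rightarrow> nat)"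
    "\<And>i. y i = (\<Sum>j\<in>{p i..<p (Suc i)}. a j *\<^sub>R x j)"
    using y unfolding block_on_def by blast
  have "norm (\<Sum>i<n. b i *\<^sub>R y i) \<le> K * norm (\<Sum>i<m. b i *\<^sub>R y i)" if "n \<le> m" for b n m
  proof -
    \<comment> \<open>Positions before \<open>p 0\<close> belong to no block and get coefficient
      0.\<close>
    define c where "c j = (if j < p 0 then 0 else b (LEAST i. j < p (Suc i)) * a j)" for j
    have "(\<Sum>i<n. b i *\<^sub>R y i) = (\<Sum>j<p n. c j *\<^sub>R x j)" for n
    proof (induction n)
      case (Suc n)
      have "p 0 \<le> p n" using strict_mono_less_eq[OF p(1)] by simp
      then have "b n *\<^sub>R y n = (\<Sum>j\<in>{p n..<p (Suc n)}. c j *\<^sub>R x j)"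
        unfolding p(2) scaleR_sum_right
        by (intro sum.cong) (auto simp: c_def Least_block_index[OF p(1)])
      moreover have "{..<p (Suc n)} = {..<p n} \<union> {p n..<p (Suc n)}"
        using strict_mono_less_eq[OF p(1), of n "Suc n"] by auto
      then have "(\<Sum>j<p (Suc n). c j *\<^sub>R x j) = (\<Sum>j<p n. c j *\<^sub>R x j) + (\<Sum>j\<in>{p n..<p (Suc n)}. c j *\<^sub>R x j)"
        by (simp add: sum.union_disjoint ivl_disj_int)
      ultimately show ?case using Suc by simp
    qed (simp add: c_def)
    moreover have "p n \<le> p m" using that strict_mono_less_eq[OF p(1)] by simp
    ultimately show ?thesis using K by simp
  qed
  then show ?thesis unfolding basic_seq_def using block_nonzero by blast
qed

lemma csupp_block_less: "a \<in> csupp x (y i) \<Longrightarrow> b \<in> csupp x (y j) \<Longrightarrow> i < j \<Longrightarrow> a < b"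
  using y by (auto simp: block_basis_iff successive_def)

end

lemma coeffs_successive_sum:
  assumes "finite I" "successive I x z" "i \<in> I" "j \<in> csupp x (z i)"
  shows "coeffs x (\<Sum>i\<in>I. z i) j = coeffs x (z i) j"
proof -
  have c: "coeffs x (\<Sum>i\<in>I. z i) j = (\<Sum>i\<in>I. coeffs x (z i) j)"
    by (rule coeffs_sum) (rule successiveD[OF assms(2)])
  have "(\<Sum>k\<in>I - {i}. coeffs x (z k) j) = 0"
    by (rule sum.neutral) (use successive_disjoint[OF assms(2)] assms in \<open>auto simp: csupp_def\<close>)
  then show ?thesis
    unfolding c using sum.remove[OF assms(1,3), of "\<lambda>k. coeffs x (z k) j"] by simp
qed

lemma csupp_successive_sum:
  assumes "finite I" "successive I x z"
  shows "csupp x (\<Sum>i\<in>I. z i) = (\<Union>i\<in>I. csupp x (z i))"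
proof
  show "(\<Union>i\<in>I. csupp x (z i)) \<subseteq> csupp x (\<Sum>i\<in>I. z i)"
    using coeffs_successive_sum[OF assms] by (auto simp: csupp_def)
  show "csupp x (\<Sum>i\<in>I. z i) \<subseteq> (\<Union>i\<in>I. csupp x (z i))"
    by (rule csupp_subset_sum) (rule successiveD[OF assms(2)])
qed

lemma successive_scaleR:
  assumes z: "successive I x z" and a: "\<And>i. i \<in> I \<Longrightarrow> a i \<noteq> 0"
  shows "successive I x (\<lambda>i. a i *\<^sub>R z i)"
  unfolding successive_def
proof (intro conjI ballI impI)
  fix i assume i: "i \<in> I"
  show "a i *\<^sub>R z i \<in> span (range x)" "a i *\<^sub>R z i \<noteq> 0"
    using successiveD[OF z i] a[OF i] by (auto intro: span_scale)
next
  fix i j b c assume "i \<in> I" "j \<in> I" "i < j" "b \<in> csupp x (a i *\<^sub>R z i)" "c \<in> csupp x (a j *\<^sub>R z j)"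
  then show "b < c"
    using z a csupp_scaleR successiveD(1)[OF z] unfolding successive_def by (metis (no_types, lifting))
qed

lemma successive_SucI:
  assumes "\<And>i. z i \<in> span (range x)" "\<And>i. z i \<noteq> 0"
    and "\<And>i a b. a \<in> csupp x (z i) \<Longrightarrow> b \<in> csupp x (z (Suc i)) \<Longrightarrow> a < b"
  shows "successive UNIV x z"
proof -
  have "\<forall>a\<in>csupp x (z i). \<forall>b\<in>csupp x (z j). a < b" if "i < j" for i j
    using that
  proof (induction rule: less_Suc_induct)
    case (2 i j k)
    obtain c where "c \<in> csupp x (z j)" using csupp_nonempty[OF assms(1,2)] by blast
    then show ?case using 2 by (meson less_trans)
  qed (use assms in blast)
  then show ?thesis using assms unfolding successive_def by blast
qed

end

lemma csupp_block:
  assumes x: "basic_seq x" and y: "block_basis x y" and v: "v \<in> span (range y)"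
  shows "csupp x v = (\<Union>i\<in>csupp y v. csupp x (y i))"
proof -
  note y' = basic_seq_block[OF x y]
  let ?z = "\<lambda>i. coeffs y v i *\<^sub>R y i"
  have fin: "finite (csupp y v)" by (rule finite_csupp[OF y' v])
  have cz: "csupp x (?z i) = csupp x (y i)" if "i \<in> csupp y v" for i
    using that by (simp add: csupp_scaleR[OF x block_in_span[OF x y]] csupp_def[of y])
  have "successive (csupp y v) x y" using y unfolding block_basis_iff[OF x] successive_def by blast
  then have "successive (csupp y v) x ?z"
    by (rule successive_scaleR[OF x]) (simp add: csupp_def)
  then have "csupp x (\<Sum>i\<in>csupp y v. ?z i) = (\<Union>i\<in>csupp y v. csupp x (?z i))"
    by (rule csupp_successive_sum[OF x fin])
  then show ?thesis using cz span_range_expand[OF y' v fin order_refl] by simp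
qed

section \<open>Supports relative to a sequence and to a block basis of it\<close>

context
  fixes x y :: "nat \<Rightarrow> 'a::real_normed_vector"
  assumes x: "basic_seq x" and y: "block_basis x y"
begin

lemma Min_csupp_block:
  assumes v: "v \<in> span (range y)" "v \<noteq> 0"
  shows "Min (csupp x v) = Min (csupp x (y (Min (csupp y v))))"
proof (rule Min_eqI)
  note y' = basic_seq_block[OF x y]
  let ?i = "Min (csupp y v)"
  have i: "?i \<in> csupp y v" by (rule Min_csupp_in[OF y' v])
  have m: "Min (csupp x (y ?i)) \<in> csupp x (y ?i)"
    by (rule Min_csupp_in[OF x block_in_span[OF x y] block_nonzero[OF x y]])
  then show "Min (csupp x (y ?i)) \<in> csupp x v" using i csupp_block[OF x y v(1)] by blast
  show "finite (csupp x v)" using finite_csupp[OF x] span_block_subset[OF x y] v by blast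
  fix a assume "a \<in> csupp x v"
  then obtain j where j: "j \<in> csupp y v" "a \<in> csupp x (y j)" using csupp_block[OF x y v(1)] by blast
  have "?i \<le> j" using j finite_csupp[OF y' v(1)] by simp
  show "Min (csupp x (y ?i)) \<le> a"
  proof (cases "?i = j")
    case True
    then show ?thesis using j finite_csupp[OF x block_in_span[OF x y]] by simp
  next
    case False
    then show ?thesis using csupp_block_less[OF x y m j(2)] \<open>?i \<le> j\<close> by linarith
  qed
qed

lemma strict_mono_Min_csupp_block: "strict_mono (\<lambda>i. Min (csupp x (y i)))"
  using successive_Min_less[OF x] y by (intro strict_monoI_Suc) (auto simp: block_basis_iff[OF x])

lemma successive_block:
  assumes z: "successive I y z"
  shows "successive I x z"
proof -
  note y' = basic_seq_block[OF x y]
  have "z i \<in> span (range x)" "z i \<noteq> 0" if "i \<in> I" for i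
    using span_block_subset[OF x y] successiveD[OF y' z that] by auto
  moreover have "a < b" if ij: "i \<in> I" "j \<in> I" "i < j" "a \<in> csupp x (z i)" "b \<in> csupp x (z j)" for i j a b
  proof -
    obtain k l where "k \<in> csupp y (z i)" "a \<in> csupp x (y k)" "l \<in> csupp y (z j)" "b \<in> csupp x (y l)"
      using ij csupp_block[OF x y successiveD(1)[OF y' z]] by blast
    then show ?thesis using z ij csupp_block_less[OF x y] unfolding successive_def by blast
  qed
  ultimately show ?thesis unfolding successive_def by blast
qed

lemma block_basis_trans: "block_basis y z \<Longrightarrow> block_basis x z"
  using successive_block[of UNIV z] by (simp add: block_basis_iff[OF x] block_basis_iff[OF basic_seq_block[OF x y]])

text \<open>The order of supports is pulled back from x to its block basis y. The diagonal sequence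
  below is ordered relative to the first sequence and has to be ordered relative to the later
  ones.\<close>

lemma csupp_less_block:
  assumes uv: "u \<in> span (range y)" "v \<in> span (range y)"
    and less: "\<forall>a\<in>csupp x u. \<forall>b\<in>csupp x v. a < b"
    and kl: "k \<in> csupp y u" "l \<in> csupp y v"
  shows "k < l"
proof -
  have m: "Min (csupp x (y i)) \<in> csupp x (y i)" for i
    by (rule Min_csupp_in[OF x block_in_span[OF x y] block_nonzero[OF x y]])
  have "Min (csupp x (y k)) < Min (csupp x (y l))"
    using less kl m csupp_block[OF x y uv(1)] csupp_block[OF x y uv(2)] by blast
  then show ?thesis using strict_mono_less[OF strict_mono_Min_csupp_block] by simp
qed

end

lemma csupp_tail:
  assumes x: "basic_seq x" and v: "v \<in> span (range x)" "csupp x v \<subseteq> {n..}"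
  shows "v \<in> span (range (\<lambda>i. x (n + i)))" "csupp (\<lambda>i. x (n + i)) v = (\<lambda>j. j - n) ` csupp x v"
proof -
  let ?A = "csupp x v" and ?B = "(\<lambda>j. j - n) ` csupp x v"
  have inj: "inj_on (\<lambda>j. j - n) ?A" using v(2) by (intro inj_on_diff_nat) auto
  have "v = (\<Sum>j\<in>?A. coeffs x v j *\<^sub>R x j)"
    by (rule span_range_expand[OF x v(1) finite_csupp[OF x v(1)] order_refl])
  also have "\<dots> = (\<Sum>i\<in>?B. coeffs x v (n + i) *\<^sub>R x (n + i))"
    unfolding sum.reindex[OF inj] by (rule sum.cong) (use v(2) in auto)
  finally have v': "v = (\<Sum>i\<in>?B. coeffs x v (n + i) *\<^sub>R x (n + i))" .
  show "v \<in> span (range (\<lambda>i. x (n + i)))"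
    by (subst v') (intro span_sum span_scale span_base rangeI)
  have "basic_seq (\<lambda>i. x (n + i))" by (rule basic_seq_block[OF x block_basis_tail[OF x]])
  then have "csupp (\<lambda>i. x (n + i)) v = {i \<in> ?B. coeffs x v (n + i) \<noteq> 0}"
    by (subst v') (rule csupp_finite_sum, auto simp: finite_csupp[OF x v(1)])
  also have "\<dots> = ?B" using v(2) by (auto simp: csupp_def subset_iff)
  finally show "csupp (\<lambda>i. x (n + i)) v = ?B" .
qed

text \<open>The n-th term is taken from \<open>X n\<close>, so far out that its support relative to
  \<open>X 0\<close> follows that of the preceding term. All terms from the n-th on lie in the span
  of \<open>X n\<close>, so the tail from n on is itself a block basis of
  \<open>X n\<close>.\<close>

lemma block_basis_diagonal:
  fixes X :: "nat \<Rightarrow> nat \<Rightarrow> 'a::real_normed_vector"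
  assumes X0: "basic_seq (X 0)" and X: "\<And>n. block_basis (X n) (X (Suc n))"
  obtains w where "\<And>n. block_basis (X n) (\<lambda>i. w (n + i))"
proof -
  have bX: "basic_seq (X n)" for n
    by (induction n) (use X0 X basic_seq_block in blast)+
  have blk: "block_basis (X n) (X (n + k))" for n k
  proof (induction k)
    case 0
    then show ?case using block_basis_refl[OF bX] by simp
  next
    case (Suc k)
    show ?case using block_basis_trans[OF bX Suc X] by simp
  qed
  have b0: "block_basis (X 0) (X n)" for n using blk[of 0 n] by simp
  have sp: "X (n + k) i \<in> span (range (X n))" for n k i by (rule block_in_span[OF bX blk])
  have sp0: "X n i \<in> span (range (X 0))" for n i using sp[of 0 n i] by simp
  define s where "s v = csupp (X 0) v" for v
  \<comment> \<open>The j-th term of a block basis has its support in {j..}, because the minima of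
    the supports increase strictly; a term with index beyond the last support is therefore far
    enough out.\<close>
  have ex: "\<exists>j. \<forall>a\<in>s (X n i). \<forall>b\<in>s (X (Suc n) j). a < b" for n i
  proof (intro exI ballI)
    fix a b let ?M = "Suc (Max (s (X n i)))"
    assume a: "a \<in> s (X n i)" and b: "b \<in> s (X (Suc n) ?M)"
    have "a < ?M" using a finite_csupp[OF bX sp0] by (simp add: s_def less_Suc_eq_le)
    also have "?M \<le> Min (s (X (Suc n) ?M))" unfolding s_def
      by (rule strict_mono_imp_increasing[OF strict_mono_Min_csupp_block[OF bX b0]])
    also have "\<dots> \<le> b" using b finite_csupp[OF bX sp0] by (simp add: s_def)
    finally show "a < b" .
  qed
  then obtain g where g: "\<And>n i a b. a \<in> s (X n i) \<Longrightarrow> b \<in> s (X (Suc n) (g n i)) \<Longrightarrow> a < b" by metis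
  define f where "f = rec_nat 0 g"
  have fS: "f (Suc n) = g n (f n)" for n by (simp add: f_def)
  define w where "w n = X n (f n)" for n
  have w_span: "w n \<in> span (range (X m))" if "m \<le> n" for m n
    using sp[of m "n - m" "f n"] that by (simp add: w_def)
  have w0: "w n \<noteq> 0" for n unfolding w_def using basic_seq_nonzero[OF bX] by blast
  have "successive UNIV (X 0) w"
    by (rule successive_SucI[OF bX w_span w0]) (use g in \<open>auto simp: s_def w_def fS\<close>)
  then have w_less: "\<forall>a\<in>s (w i). \<forall>b\<in>s (w j). a < b" if "i < j" for i j
    using that unfolding successive_def s_def by blast
  have "block_basis (X n) (\<lambda>i. w (n + i))" for n
  proof -
    have "k < l" if ij: "i < j" and kl: "k \<in> csupp (X n) (w (n + i))" "l \<in> csupp (X n) (w (n + j))" for i j k l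
    proof (rule csupp_less_block[OF bX b0 _ _ _ kl])
      show "\<forall>a\<in>csupp (X 0) (w (n + i)). \<forall>b\<in>csupp (X 0) (w (n + j)). a < b"
        using w_less[of "n + i" "n + j"] ij by (simp add: s_def)
    qed (auto intro: w_span)
    then show ?thesis using w_span w0 by (auto simp: block_basis_iff[OF bX] successive_def)
  qed
  then show ?thesis using that by blast
qed

section \<open>The quantities \<open>\<delta>\<^sub>\<alpha>\<close>\<close>

lemma Min_UN:
  assumes "finite I" "I \<noteq> {}" "\<And>i. i \<in> I \<Longrightarrow> finite (A i) \<and> A i \<noteq> {}"
  shows "Min (\<Union>i\<in>I. A i) = Min ((\<lambda>i. Min (A i)) ` I)"
proof (rule Min_eqI)
  have "Min ((\<lambda>i. Min (A i)) ` I) \<in> (\<lambda>i. Min (A i)) ` I" using assms by simp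
  then obtain i where "i \<in> I" "Min ((\<lambda>i. Min (A i)) ` I) = Min (A i)" by auto
  then show "Min ((\<lambda>i. Min (A i)) ` I) \<in> (\<Union>i\<in>I. A i)" using assms(3)[of i] Min_in[of "A i"] by (metis UN_I)
  fix y assume "y \<in> (\<Union>i\<in>I. A i)"
  then obtain i where i: "i \<in> I" "y \<in> A i" by blast
  have "Min ((\<lambda>i. Min (A i)) ` I) \<le> Min (A i)" using assms(1) i by (intro Min_le) auto
  also have "\<dots> \<le> y" using assms i by simp
  finally show "Min ((\<lambda>i. Min (A i)) ` I) \<le> y" .
qed (use assms in auto)

text \<open>The norm is a parameter because (g) applies the theory to renormings as well as to the
  given norm.\<close>

locale schreier_norm =
  fixes L :: "omega1 \<Rightarrow> nat \<Rightarrow> omega1" and N :: "'a::real_normed_vector \<Rightarrow> real"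
  assumes L: "fundamental_sequences L" and N: "equivalent_norm_on UNIV N"
begin

lemma N_add: "N (u + v) \<le> N u + N v"
  and N_scaleR: "N (r *\<^sub>R v) = \<bar>r\<bar> * N v"
  using N by (auto simp: equivalent_norm_on_def)

lemma N_bounds: "\<exists>c C. 0 < c \<and> 0 < C \<and> (\<forall>v. c * norm v \<le> N v \<and> N v \<le> C * norm v)"
proof -
  obtain c C where c: "0 < c" "\<And>v. c * norm v \<le> N v" "\<And>v. N v \<le> C * norm v"
    using N unfolding equivalent_norm_on_def by blast
  have "N v \<le> max C 1 * norm v" for v
    using c(3)[of v] mult_right_mono[of C "max C 1" "norm v"] by simp
  then show ?thesis using c(1,2) by (intro exI[of _ c] exI[of _ "max C 1"]) auto
qed

lemma N_0 [simp]: "N 0 = 0"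
  using N_scaleR[of 0 0] by simp

lemma N_pos: "v \<noteq> 0 \<Longrightarrow> 0 < N v"
proof -
  assume v: "v \<noteq> 0"
  obtain c where "0 < c" "c * norm v \<le> N v" using N_bounds by blast
  moreover from this have "0 < c * norm v" using v by simp
  ultimately show ?thesis by linarith
qed

lemma N_nonneg [simp]: "0 \<le> N v"
  by (cases "v = 0") (auto intro: less_imp_le N_pos)

lemma N_sum: "N (\<Sum>i\<in>I. z i) \<le> (\<Sum>i\<in>I. N (z i))"
proof (cases "finite I")
  case True
  then show ?thesis
  proof induction
    case (insert i I)
    then show ?case using N_add[of "z i" "\<Sum>i\<in>I. z i"] by simp
  qed simp
qed simp

lemma N_sum_scaleR: "N (\<Sum>i\<in>I. a i *\<^sub>R z i) \<le> (\<Sum>i\<in>I. \<bar>a i\<bar> * N (z i))"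
  using N_sum[of "\<lambda>i. a i *\<^sub>R z i" I] by (simp add: N_scaleR)

lemma N_minus: "N (- v) = N v"
  using N_scaleR[of "-1" v] by simp

abbreviation mins :: "(nat \<Rightarrow> 'a) \<Rightarrow> (nat \<Rightarrow> 'a) \<Rightarrow> nat \<Rightarrow> nat" where
  "mins x z \<equiv> (\<lambda>i. Suc (Min (csupp x (z i))))"

lemma admissible_iff:
  assumes "basic_seq x"
  shows "admissible L \<alpha> x k z \<longleftrightarrow> successive {..<k} x z \<and> mins x z ` {..<k} \<in> schreier L \<alpha>"
proof -
  have "(\<lambda>i. Min (supp x (z i))) ` {..<k} = mins x z ` {..<k}" if "successive {..<k} x z"
    using successiveD[OF assms that] by (intro image_cong refl) (simp add: Min_supp[OF assms])
  then show ?thesis unfolding admissible_def block_on_lessThan_iff[OF assms] by auto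
qed

text \<open>The one-term sequence consisting of the first vector is \<alpha>-admissible for every
  \<alpha>. The bound makes the suprema in \<open>delta\<close> meaningful.\<close>

lemma delta_set_le_1:
  assumes x: "basic_seq x" and d: "\<And>k z. admissible L \<alpha> x k z \<Longrightarrow> d * (\<Sum>i<k. N (z i)) \<le> N (\<Sum>i<k. z i)"
  shows "d \<le> 1"
proof -
  have "admissible L \<alpha> x 1 x"
    unfolding admissible_iff[OF x]
    by (auto simp: successive_def basic_seq_nonzero[OF x] span_base csupp_term[OF x]
        singleton_in_schreier[OF L] lessThan_Suc)
  from d[OF this] N_pos[OF basic_seq_nonzero[OF x], of 0] show ?thesis by simp
qed

lemma delta_eq:
  "delta L N \<alpha> x = Sup {d. 0 \<le> d \<and> (\<forall>k z. admissible L \<alpha> x k z \<longrightarrow> d * (\<Sum>i<k. N (z i)) \<le> N (\<Sum>i<k. z i))}"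
  by (simp add: delta_def)

lemma delta_geI:
  assumes x: "basic_seq x" and "0 \<le> d"
    and "\<And>k z. successive {..<k} x z \<Longrightarrow> mins x z ` {..<k} \<in> schreier L \<alpha> \<Longrightarrow>
           d * (\<Sum>i<k. N (z i)) \<le> N (\<Sum>i<k. z i)"
  shows "d \<le> delta L N \<alpha> x"
  unfolding delta_eq
proof (rule cSup_upper)
  show "bdd_above {d. 0 \<le> d \<and> (\<forall>k z. admissible L \<alpha> x k z \<longrightarrow> d * (\<Sum>i<k. N (z i)) \<le> N (\<Sum>i<k. z i))}"
    using delta_set_le_1[OF x] by (intro bdd_aboveI[of _ 1]) blast
qed (use assms in \<open>auto simp: admissible_iff[OF x]\<close>)

lemma delta_le:
  assumes "\<And>d. 0 \<le> d \<Longrightarrow> (\<And>k z. admissible L \<alpha> x k z \<Longrightarrow> d * (\<Sum>i<k. N (z i)) \<le> N (\<Sum>i<k. z i)) \<Longrightarrow> d \<le> c"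
  shows "delta L N \<alpha> x \<le> c"
  unfolding delta_eq
proof (rule cSup_least)
  show "{d. 0 \<le> d \<and> (\<forall>k z. admissible L \<alpha> x k z \<longrightarrow> d * (\<Sum>i<k. N (z i)) \<le> N (\<Sum>i<k. z i))} \<noteq> {}"
    by (auto intro!: exI[of _ 0])
qed (use assms in blast)

lemma delta_nonneg: "basic_seq x \<Longrightarrow> 0 \<le> delta L N \<alpha> x"
  by (rule delta_geI) auto

lemma delta_le_1: "basic_seq x \<Longrightarrow> delta L N \<alpha> x \<le> 1"
  by (rule delta_le) (rule delta_set_le_1)

lemma delta_ineq_lessThan:
  assumes x: "basic_seq x" and z: "successive {..<k} x z" "mins x z ` {..<k} \<in> schreier L \<alpha>"
  shows "delta L N \<alpha> x * (\<Sum>i<k. N (z i)) \<le> N (\<Sum>i<k. z i)"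
proof (cases "(\<Sum>i<k. N (z i)) = 0")
  case False
  then have S: "0 < (\<Sum>i<k. N (z i))" by (simp add: less_le sum_nonneg)
  have "delta L N \<alpha> x \<le> N (\<Sum>i<k. z i) / (\<Sum>i<k. N (z i))"
    using z by (intro delta_le) (simp add: admissible_iff[OF x] pos_le_divide_eq[OF S])
  then show ?thesis by (simp add: pos_le_divide_eq[OF S])
qed simp

text \<open>Index sets other than initial segments occur when a block sequence is cut into groups or
  its zero terms are dropped.\<close>

lemma delta_ineq:
  assumes x: "basic_seq x" and I: "finite I" "successive I x z" "mins x z ` I \<in> schreier L \<alpha>"
  shows "delta L N \<alpha> x * (\<Sum>i\<in>I. N (z i)) \<le> N (\<Sum>i\<in>I. z i)"
proof -
  obtain h where h: "bij_betw h {..<card I} I" "strict_mono_on {..<card I} h"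
    using ex_bij_betw_strict_mono_card[OF I(1)] by blast
  have hI: "h i \<in> I" if "i < card I" for i using h(1) that by (auto simp: bij_betw_def)
  have "successive {..<card I} x (\<lambda>i. z (h i))"
    unfolding successive_def
  proof (intro conjI ballI impI)
    fix i assume "i \<in> {..<card I}"
    then show "z (h i) \<in> span (range x)" "z (h i) \<noteq> 0" using hI successiveD[OF x I(2)] by auto
  next
    fix i j a b assume "i \<in> {..<card I}" "j \<in> {..<card I}" "i < j"
      "a \<in> csupp x (z (h i))" "b \<in> csupp x (z (h j))"
    then show "a < b" using hI I(2) strict_mono_onD[OF h(2)] unfolding successive_def by (meson lessThan_iff)
  qed
  moreover have "mins x (\<lambda>i. z (h i)) ` {..<card I} = mins x z ` I"
    using h(1) unfolding bij_betw_def by (metis (no_types, lifting) image_cong image_image)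
  ultimately have "delta L N \<alpha> x * (\<Sum>i<card I. N (z (h i))) \<le> N (\<Sum>i<card I. z (h i))"
    using delta_ineq_lessThan[OF x, of "card I" "\<lambda>i. z (h i)" \<alpha>] I(3) by metis
  then show ?thesis
    using sum.reindex_bij_betw[OF h(1), of "\<lambda>i. N (z i)"] sum.reindex_bij_betw[OF h(1), of z] by simp
qed

text \<open>Passing to a block basis spreads the sets of minima of supports.\<close>

lemma delta_block_mono:
  assumes x: "basic_seq x" and y: "block_basis x y"
  shows "delta L N \<alpha> x \<le> delta L N \<alpha> y"
proof (rule delta_geI[OF basic_seq_block[OF x y] delta_nonneg[OF x]])
  fix k z assume z: "successive {..<k} y z" "mins y z ` {..<k} \<in> schreier L \<alpha>"
  note y' = basic_seq_block[OF x y]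
  let ?m = "\<lambda>i. Min (csupp x (y i))" let ?f = "\<lambda>j. Suc (?m (j - 1))"
  have m: "strict_mono ?m" by (rule strict_mono_Min_csupp_block[OF x y])
  have "?f ` mins y z ` {..<k} \<in> schreier L \<alpha>"
  proof (rule spreadingD[OF spreading_schreier[OF L] z(2)])
    show "strict_mono_on (mins y z ` {..<k}) ?f"
      using strict_monoD[OF m] by (auto simp: strict_mono_on_def)
    show "j \<le> ?f j" for j using strict_mono_imp_increasing[OF m, of "j - 1"] by linarith
  qed
  moreover have "mins x z ` {..<k} = ?f ` mins y z ` {..<k}"
    unfolding image_image using Min_csupp_block[OF x y successiveD[OF y' z(1)]]
    by (intro image_cong refl) simp
  ultimately show "delta L N \<alpha> x * (\<Sum>i<k. N (z i)) \<le> N (\<Sum>i<k. z i)"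
    by (intro delta_ineq_lessThan[OF x] successive_block[OF x y z(1)]) simp
qed

lemma mins_subseq:
  assumes x: "basic_seq x" and m: "strict_mono m" and z: "successive I (\<lambda>i. x (m i)) z"
  shows "mins x z ` I = Suc ` m ` (\<lambda>i. Min (csupp (\<lambda>i. x (m i)) (z i))) ` I"
proof -
  note y = block_basis_subseq[OF x m]
  show ?thesis unfolding image_image
    using Min_csupp_block[OF x y successiveD[OF basic_seq_block[OF x y] z]]
    by (intro image_cong refl) (simp add: csupp_term[OF x])
qed

lemma delta_subseq:
  assumes x: "basic_seq x" and m: "strict_mono m"
    and S: "\<And>P. Suc ` P \<in> schreier L \<alpha> \<Longrightarrow> Suc ` m ` P \<in> schreier L \<beta>"
  shows "delta L N \<beta> x \<le> delta L N \<alpha> (\<lambda>i. x (m i))"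
proof -
  note y = block_basis_subseq[OF x m]
  show ?thesis
  proof (rule delta_geI[OF basic_seq_block[OF x y] delta_nonneg[OF x]])
    fix k z assume z: "successive {..<k} (\<lambda>i. x (m i)) z" "mins (\<lambda>i. x (m i)) z ` {..<k} \<in> schreier L \<alpha>"
    then have "mins x z ` {..<k} \<in> schreier L \<beta>"
      unfolding mins_subseq[OF x m z(1)] by (intro S) (simp add: image_image)
    then show "delta L N \<beta> x * (\<Sum>i<k. N (z i)) \<le> N (\<Sum>i<k. z i)"
      by (intro delta_ineq_lessThan[OF x] successive_block[OF x y z(1)])
  qed
qed

text \<open>The vectors are grouped by the pieces in \<open>S\<^sub>\<beta>\<close>. The group sums
  \<open>u l\<close> are again successive, and the minima of their supports are the minima of the
  pieces, which form a set in \<open>S\<^sub>\<alpha>\<close>. So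
  \<open>\<delta>\<^sub>\<alpha>\<close> estimates the total by the group sums, and
  \<open>\<delta>\<^sub>\<beta>\<close> each group sum by its members.\<close>

lemma delta_comp:
  assumes x: "basic_seq x" and z: "successive {..<k} x z"
    and M: "mins x z ` {..<k} \<in> family_comp (schreier L \<alpha>) (schreier L \<beta>)"
  shows "delta L N \<alpha> x * delta L N \<beta> x * (\<Sum>i<k. N (z i)) \<le> N (\<Sum>i<k. z i)"
proof -
  from M obtain Gs where Gs: "mins x z ` {..<k} = \<Union>(set Gs)" "set Gs \<subseteq> schreier L \<beta> - {{}}"
    "sorted_wrt (\<lambda>G H. Max G < Min H) Gs" "Min ` set Gs \<in> schreier L \<alpha>"
    by (rule family_compE)
  define r where "r = length Gs"
  define I where "I l = {i. i < k \<and> mins x z i \<in> Gs ! l}" for l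
  define u where "u l = (\<Sum>i\<in>I l. z i)" for l
  have G: "finite (Gs ! l)" "Gs ! l \<noteq> {}" "Gs ! l \<in> schreier L \<beta>" if "l < r" for l
    using Gs(2) nth_mem[of l Gs] that schreier_finite[OF L] unfolding r_def by blast+
  have finI: "finite (I l)" for l by (simp add: I_def)
  have MI: "mins x z ` I l = Gs ! l" if "l < r" for l
  proof -
    have "Gs ! l \<subseteq> mins x z ` {..<k}" unfolding Gs(1) using nth_mem that r_def by blast
    then show ?thesis unfolding I_def by blast
  qed
  have Ine: "I l \<noteq> {}" if "l < r" for l using MI[OF that] G(2)[OF that] by auto
  have sI: "successive (I l) x z" for l
    using z unfolding successive_def I_def by blast
  have mono: "mins x z i < mins x z j" if "i < j" "j < k" for i j
    using successive_Min_less[OF x z, of i j] that by simp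
  have ord: "i < j" if "l < l'" "l' < r" "i \<in> I l" "j \<in> I l'" for l l' i j
  proof -
    have "mins x z i \<le> Max (Gs ! l)" "Min (Gs ! l') \<le> mins x z j"
      using that G[of l] G[of l'] by (auto simp: I_def)
    moreover have "Max (Gs ! l) < Min (Gs ! l')"
      using Gs(3) that by (simp add: sorted_wrt_iff_nth_less r_def)
    ultimately have "mins x z i < mins x z j" by linarith
    then show ?thesis using mono[of j i] that(3) by (cases i j rule: linorder_cases) (auto simp: I_def)
  qed
  have disj: "l = l'" if "i \<in> I l" "i \<in> I l'" "l < r" "l' < r" for i l l'
    using ord[of l l' i i] ord[of l' l i i] that by (cases l l' rule: linorder_cases) auto
  have un: "(\<Union>l<r. I l) = {..<k}"
  proof -
    have "\<exists>l<r. mins x z i \<in> Gs ! l" if "i < k" for i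
    proof -
      have "mins x z i \<in> \<Union>(set Gs)" unfolding Gs(1)[symmetric] using that by blast
      then show ?thesis by (auto simp: in_set_conv_nth r_def)
    qed
    then show ?thesis by (auto simp: I_def)
  qed
  have cu: "csupp x (u l) = (\<Union>i\<in>I l. csupp x (z i))" for l
    unfolding u_def by (rule csupp_successive_sum[OF x finI sI])
  have zi: "finite (csupp x (z i)) \<and> csupp x (z i) \<noteq> {}" if "i < k" for i
    using finite_csupp[OF x] csupp_nonempty[OF x] successiveD[OF x z] that by simp
  have Minu: "mins x u l = Min (Gs ! l)" if "l < r" for l
  proof -
    have "Min (csupp x (u l)) = Min ((\<lambda>i. Min (csupp x (z i))) ` I l)"
      unfolding cu by (rule Min_UN) (use zi finI Ine[OF that] in \<open>auto simp: I_def\<close>)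
    then have "mins x u l = Min (Suc ` (\<lambda>i. Min (csupp x (z i))) ` I l)"
      using finI Ine[OF that] by (subst Min_image_strict_mono_on) (auto simp: strict_mono_on_def)
    then show ?thesis using MI[OF that] by (simp add: image_image)
  qed
  have su: "successive {..<r} x u"
    unfolding successive_def
  proof (intro conjI ballI impI)
    fix l assume l: "l \<in> {..<r}"
    show "u l \<in> span (range x)"
      unfolding u_def by (intro span_sum) (use successiveD[OF x z] in \<open>auto simp: I_def\<close>)
    have "csupp x (u l) \<noteq> {}" using cu Ine[of l] l zi by (auto simp: I_def)
    then show "u l \<noteq> 0" using csupp_finite_sum[OF x, of "{}"] by auto
  next
    fix l l' a b assume l: "l \<in> {..<r}" "l' \<in> {..<r}" "l < l'" and "a \<in> csupp x (u l)" "b \<in> csupp x (u l')"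
    then obtain i j where ij: "i \<in> I l" "j \<in> I l'" "a \<in> csupp x (z i)" "b \<in> csupp x (z j)"
      unfolding cu by blast
    moreover have "i < j" using ord[OF l(3) _ ij(1,2)] l by simp
    ultimately show "a < b" using z unfolding successive_def I_def by blast
  qed
  have "mins x u ` {..<r} = Min ` set Gs"
  proof -
    have "mins x u ` {..<r} = Min ` (!) Gs ` {..<r}" unfolding image_image
      by (intro image_cong refl) (simp add: Minu)
    also have "(!) Gs ` {..<r} = set Gs" by (auto simp: r_def in_set_conv_nth)
    finally show ?thesis .
  qed
  then have 1: "delta L N \<alpha> x * (\<Sum>l<r. N (u l)) \<le> N (\<Sum>l<r. u l)"
    using Gs(4) by (intro delta_ineq_lessThan[OF x su]) simp
  have 2: "delta L N \<beta> x * (\<Sum>i\<in>I l. N (z i)) \<le> N (u l)" if "l < r" for l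
    unfolding u_def by (rule delta_ineq[OF x finI sI]) (simp add: MI[OF that] G[OF that])
  have part: "sum f {..<k} = (\<Sum>l<r. sum f (I l))" for f :: "nat \<Rightarrow> 'b::comm_monoid_add"
    unfolding un[symmetric] by (rule sum.UNION_disjoint) (use finI disj in auto)
  have "delta L N \<alpha> x * delta L N \<beta> x * (\<Sum>i<k. N (z i))
      = delta L N \<alpha> x * (\<Sum>l<r. delta L N \<beta> x * (\<Sum>i\<in>I l. N (z i)))"
    by (simp add: part sum_distrib_left mult.assoc)
  also have "\<dots> \<le> delta L N \<alpha> x * (\<Sum>l<r. N (u l))"
    by (intro mult_left_mono sum_mono 2 delta_nonneg[OF x]) simp
  also have "\<dots> \<le> N (\<Sum>l<r. u l)" by (rule 1)
  also have "(\<Sum>l<r. u l) = (\<Sum>i<k. z i)" unfolding part u_def by (rule refl)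
  finally show ?thesis .
qed

lemma delta_add:
  assumes x: "basic_seq x" and m: "strict_mono m"
    and S: "\<And>P. Suc ` P \<in> schreier L \<theta> \<Longrightarrow> Suc ` m ` P \<in> family_comp (schreier L \<alpha>) (schreier L \<beta>)"
  shows "delta L N \<alpha> x * delta L N \<beta> x \<le> delta L N \<theta> (\<lambda>i. x (m i))"
proof -
  note y = block_basis_subseq[OF x m]
  show ?thesis
  proof (rule delta_geI[OF basic_seq_block[OF x y]])
    fix k z assume z: "successive {..<k} (\<lambda>i. x (m i)) z" "mins (\<lambda>i. x (m i)) z ` {..<k} \<in> schreier L \<theta>"
    then have "mins x z ` {..<k} \<in> family_comp (schreier L \<alpha>) (schreier L \<beta>)"
      unfolding mins_subseq[OF x m z(1)] by (intro S) (simp add: image_image)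
    then show "delta L N \<alpha> x * delta L N \<beta> x * (\<Sum>i<k. N (z i)) \<le> N (\<Sum>i<k. z i)"
      by (intro delta_comp[OF x] successive_block[OF x y z(1)])
  qed (simp add: delta_nonneg[OF x])
qed

text \<open>Positions relative to the tail are smaller by n, so admissibility is tested on minima
  moved to the left.\<close>

lemma delta_ineq_tail:
  assumes x: "basic_seq x" and z: "successive {..<k} x z" "\<And>i. i < k \<Longrightarrow> csupp x (z i) \<subseteq> {n..}"
    and M: "(\<lambda>i. Suc (Min (csupp x (z i)) - n)) ` {..<k} \<in> schreier L \<alpha>"
  shows "delta L N \<alpha> (\<lambda>i. x (n + i)) * (\<Sum>i<k. N (z i)) \<le> N (\<Sum>i<k. z i)"
proof (rule delta_ineq_lessThan[OF basic_seq_block[OF x block_basis_tail[OF x]]])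
  let ?y = "\<lambda>i. x (n + i)"
  have sp: "z i \<in> span (range x)" "z i \<noteq> 0" if "i < k" for i using successiveD[OF x z(1)] that by auto
  have t: "z i \<in> span (range ?y)" "csupp ?y (z i) = (\<lambda>j. j - n) ` csupp x (z i)" if "i < k" for i
    using csupp_tail[OF x sp(1) z(2)] that by auto
  show "successive {..<k} ?y z"
    unfolding successive_def
  proof (intro conjI ballI impI)
    fix i j a b assume ij: "i \<in> {..<k}" "j \<in> {..<k}" "i < j" "a \<in> csupp ?y (z i)" "b \<in> csupp ?y (z j)"
    then obtain a' b' where ab: "a' \<in> csupp x (z i)" "b' \<in> csupp x (z j)" "a = a' - n" "b = b' - n"
      using t by auto
    then have "a' < b'" using z(1) ij unfolding successive_def by blast
    moreover have "n \<le> a'" using ab(1) z(2)[of i] ij(1) by (auto simp only: lessThan_iff subset_iff atLeast_iff)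
    ultimately show "a < b" using ab by simp
  qed (use t sp in auto)
  have "mins ?y z ` {..<k} = (\<lambda>i. Suc (Min (csupp x (z i)) - n)) ` {..<k}"
  proof (intro image_cong refl)
    fix i assume i: "i \<in> {..<k}"
    have "Min ((\<lambda>j. j - n) ` csupp x (z i)) = Min (csupp x (z i)) - n"
      by (rule Min_image_strict_mono_on)
        (use i z(2)[of i] finite_csupp[OF x sp(1)] csupp_nonempty[OF x sp] in \<open>auto simp: strict_mono_on_def subset_iff\<close>)
    then show "mins ?y z i = Suc (Min (csupp x (z i)) - n)" using t(2) i by simp
  qed
  then show "mins ?y z ` {..<k} \<in> schreier L \<alpha>" using M by simp
qed

text \<open>Members of \<open>S\<^sub>0\<close> have at most one element and different vectors have
  different minima, so an admissible sequence has length at most 1.\<close>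

lemma delta_0:
  assumes x: "basic_seq x"
  shows "delta L N 0 x = 1"
proof (rule antisym[OF delta_le_1[OF x] delta_geI[OF x]])
  fix k z assume z: "successive {..<k} x z" "mins x z ` {..<k} \<in> schreier L 0"
  have "k \<le> 1"
  proof (rule ccontr)
    assume k: "\<not> k \<le> 1"
    then have "Min (csupp x (z 0)) < Min (csupp x (z 1))" by (intro successive_Min_less[OF x z(1)]) auto
    moreover have "mins x z 0 \<in> mins x z ` {..<k}" "mins x z 1 \<in> mins x z ` {..<k}" using k by auto
    moreover have "a = b" if "F \<in> schreier L 0" "a \<in> F" "b \<in> F" for F and a b :: nat
      using that by (auto simp: schreier_0 schreier0_def)
    ultimately show False using z(2) by (metis less_irrefl nat.inject)
  qed
  then have "k = 0 \<or> k = 1" by auto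
  then show "1 * (\<Sum>i<k. N (z i)) \<le> N (\<Sum>i<k. z i)" by auto
qed simp

section \<open>Properties of a stabilized spectrum\<close>

context
  fixes x :: "nat \<Rightarrow> 'a" and \<gamma> :: "omega1 \<Rightarrow> real"
  assumes x: "basic_seq x" and stab: "Delta_stabilizes L N x \<gamma>"
begin

lemma stabilizes_approx:
  assumes "0 < \<eta>"
  obtains m where "\<And>n y. m \<le> n \<Longrightarrow> block_basis (\<lambda>i. x (n + i)) y \<Longrightarrow> \<bar>delta L N \<alpha> y - \<gamma> \<alpha>\<bar> < \<eta>"
proof -
  obtain \<epsilon> :: "nat \<Rightarrow> real" where e: "\<epsilon> \<longlonglongrightarrow> 0"
    "\<And>\<alpha>. \<exists>m. \<forall>n\<ge>m. \<forall>y. block_basis (\<lambda>i. x (n + i)) y \<longrightarrow> \<bar>delta L N \<alpha> y - \<gamma> \<alpha>\<bar> < \<epsilon> n"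
    using stab unfolding Delta_stabilizes_def by blast
  obtain m where m: "\<And>n y. m \<le> n \<Longrightarrow> block_basis (\<lambda>i. x (n + i)) y \<Longrightarrow> \<bar>delta L N \<alpha> y - \<gamma> \<alpha>\<bar> < \<epsilon> n"
    using e(2)[of \<alpha>] by blast
  have "\<forall>\<^sub>F n in sequentially. \<epsilon> n < \<eta>" using order_tendstoD(2)[OF e(1) assms] .
  then obtain m' where m': "\<And>n. m' \<le> n \<Longrightarrow> \<epsilon> n < \<eta>" by (auto simp: eventually_sequentially)
  show ?thesis
  proof (rule that[of "max m m'"])
    fix n y assume n: "max m m' \<le> n" and y: "block_basis (\<lambda>i. x (n + i)) y"
    have "\<bar>delta L N \<alpha> y - \<gamma> \<alpha>\<bar> < \<epsilon> n" by (rule m) (use n y in auto)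
    also have "\<dots> < \<eta>" by (rule m') (use n in auto)
    finally show "\<bar>delta L N \<alpha> y - \<gamma> \<alpha>\<bar> < \<eta>" .
  qed
qed

lemma basic_tail: "basic_seq (\<lambda>i. x (n + i))"
  by (rule basic_seq_block[OF x block_basis_tail[OF x]])

lemma tail_refl: "block_basis (\<lambda>i. x (n + i)) (\<lambda>i. x (n + i))"
  by (rule block_basis_refl[OF basic_tail])

lemma stabilizes_ge:
  assumes "\<And>n y. block_basis (\<lambda>i. x (n + i)) y \<Longrightarrow> c \<le> delta L N \<alpha> y"
  shows "c \<le> \<gamma> \<alpha>"
proof (rule field_le_epsilon)
  fix \<eta> :: real assume "0 < \<eta>"
  then obtain m where m: "\<And>n y. m \<le> n \<Longrightarrow> block_basis (\<lambda>i. x (n + i)) y \<Longrightarrow> \<bar>delta L N \<alpha> y - \<gamma> \<alpha>\<bar> < \<eta>"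
    using stabilizes_approx by metis
  have "c \<le> delta L N \<alpha> (\<lambda>i. x (m + i))" by (rule assms[OF tail_refl])
  then show "c \<le> \<gamma> \<alpha> + \<eta>" using m[OF order_refl tail_refl] by linarith
qed

lemma stabilizes_le:
  assumes "\<And>n y. block_basis (\<lambda>i. x (n + i)) y \<Longrightarrow> delta L N \<alpha> y \<le> c"
  shows "\<gamma> \<alpha> \<le> c"
proof (rule field_le_epsilon)
  fix \<eta> :: real assume "0 < \<eta>"
  then obtain m where m: "\<And>n y. m \<le> n \<Longrightarrow> block_basis (\<lambda>i. x (n + i)) y \<Longrightarrow> \<bar>delta L N \<alpha> y - \<gamma> \<alpha>\<bar> < \<eta>"
    using stabilizes_approx by metis
  have "delta L N \<alpha> (\<lambda>i. x (m + i)) \<le> c" by (rule assms[OF tail_refl])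
  then show "\<gamma> \<alpha> \<le> c + \<eta>" using m[OF order_refl tail_refl] by linarith
qed

lemma stabilizes_bounds: "0 \<le> \<gamma> \<alpha>" "\<gamma> \<alpha> \<le> 1"
  using stabilizes_ge[of 0 \<alpha>] stabilizes_le[of \<alpha> 1]
    delta_nonneg delta_le_1 basic_seq_block[OF basic_tail] by blast+

lemma stabilizes_0: "\<gamma> 0 = 1"
  using stabilizes_ge[of 1 0] stabilizes_le[of 0 1] delta_0[OF basic_seq_block[OF basic_tail]]
  by (metis order_antisym order_refl)

text \<open>Common frame for monotonicity and multiplicativity. The map m is the same for every
  tail; far enough out \<open>f\<close> is almost at least c, while
  \<open>\<delta>\<^sub>\<theta>\<close> of the subsequence is close to
  \<open>\<gamma> \<theta>\<close>.\<close>

lemma stabilizes_subseq_ge: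
  assumes m: "strict_mono m"
    and le: "\<And>n. f (\<lambda>i. x (n + i)) \<le> delta L N \<theta> (\<lambda>i. x (n + m i))"
    and lim: "\<And>\<eta>. 0 < \<eta> \<Longrightarrow> \<exists>n0. \<forall>n\<ge>n0. c - \<eta> \<le> f (\<lambda>i. x (n + i))"
  shows "c \<le> \<gamma> \<theta>"
proof (rule field_le_epsilon)
  fix \<eta> :: real assume "0 < \<eta>"
  then have \<eta>: "0 < \<eta> / 2" by simp
  obtain n1 where n1: "\<And>n y. n1 \<le> n \<Longrightarrow> block_basis (\<lambda>i. x (n + i)) y \<Longrightarrow> \<bar>delta L N \<theta> y - \<gamma> \<theta>\<bar> < \<eta> / 2"
    using stabilizes_approx[OF \<eta>] by metis
  obtain n0 where n0: "\<forall>n\<ge>n0. c - \<eta> / 2 \<le> f (\<lambda>i. x (n + i))" using lim[OF \<eta>] by blast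
  let ?n = "max n0 n1"
  have "c - \<eta> / 2 \<le> delta L N \<theta> (\<lambda>i. x (?n + m i))"
    using n0 le[of ?n] by (meson max.cobounded1 order_trans)
  moreover have "\<bar>delta L N \<theta> (\<lambda>i. x (?n + m i)) - \<gamma> \<theta>\<bar> < \<eta> / 2"
    by (rule n1[OF max.cobounded2 block_basis_subseq[OF basic_tail m]])
  ultimately show "c \<le> \<gamma> \<theta> + \<eta>" by linarith
qed

lemma stabilizes_antimono:
  assumes "\<alpha> \<le> \<beta>"
  shows "\<gamma> \<beta> \<le> \<gamma> \<alpha>"
proof -
  obtain p where p: "\<And>F. F \<in> schreier L \<alpha> \<Longrightarrow> (\<forall>k\<in>F. p \<le> k) \<Longrightarrow> F \<in> schreier L \<beta>"
    using schreier_eventually_subset[OF L assms] by blast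
  \<comment> \<open>Translation by p pushes sets past the threshold and keeps them in
    \<open>S\<^sub>\<alpha>\<close> by spreading.\<close>
  have S: "Suc ` (+) p ` P \<in> schreier L \<beta>" if P: "Suc ` P \<in> schreier L \<alpha>" for P
  proof (rule p)
    have "(\<lambda>i. i + p) ` Suc ` P \<in> schreier L \<alpha>"
      by (rule spreadingD[OF spreading_schreier[OF L] P]) (auto simp: strict_mono_on_def)
    then show "Suc ` (+) p ` P \<in> schreier L \<alpha>" by (simp add: image_image add.commute)
  qed auto
  show ?thesis
  proof (rule stabilizes_subseq_ge[where f = "delta L N \<beta>" and m = "(+) p"])
    show "delta L N \<beta> (\<lambda>i. x (n + i)) \<le> delta L N \<alpha> (\<lambda>i. x (n + (p + i)))" for n
      by (rule delta_subseq[OF basic_tail]) (use S in \<open>auto simp: strict_mono_def\<close>)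
    fix \<eta> :: real assume "0 < \<eta>"
    then obtain m where "\<And>n y. m \<le> n \<Longrightarrow> block_basis (\<lambda>i. x (n + i)) y \<Longrightarrow> \<bar>delta L N \<beta> y - \<gamma> \<beta>\<bar> < \<eta>"
      using stabilizes_approx by metis
    then have "\<gamma> \<beta> - \<eta> \<le> delta L N \<beta> (\<lambda>i. x (n + i))" if "m \<le> n" for n
      using tail_refl[of n] that by fastforce
    then show "\<exists>n0. \<forall>n\<ge>n0. \<gamma> \<beta> - \<eta> \<le> delta L N \<beta> (\<lambda>i. x (n + i))" by blast
  qed (auto simp: strict_mono_def)
qed

lemma stabilizes_add: "\<gamma> \<alpha> * \<gamma> \<beta> \<le> \<gamma> (\<beta> + \<alpha>)"
proof -
  obtain M where M: "strict_mono M"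
    "\<And>F. F \<in> schreier L (\<beta> + \<alpha>) \<Longrightarrow> M ` F \<in> family_comp (schreier L \<alpha>) (schreier L \<beta>)"
    using schreier_add_subset_comp[OF L] by metis
  \<comment> \<open>\<open>M\<close> acts on indices counted from 1 and \<open>m\<close> on
    positions counted from 0. The subtraction is exact because \<open>M (Suc i)\<close> is
    positive.\<close>
  define m where "m i = M (Suc i) - 1" for i
  have Sm: "Suc (m i) = M (Suc i)" for i
    using strict_mono_imp_increasing[OF M(1), of "Suc i"] by (simp add: m_def)
  have m: "strict_mono m"
    by (rule strict_monoI_Suc) (metis Suc_less_eq Sm lessI strict_mono_less[OF M(1)])
  have S: "Suc ` m ` P \<in> family_comp (schreier L \<alpha>) (schreier L \<beta>)" if "Suc ` P \<in> schreier L (\<beta> + \<alpha>)" for P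
    using M(2)[OF that] by (simp add: image_image Sm)
  show ?thesis
  proof (rule stabilizes_subseq_ge[where f = "\<lambda>y. delta L N \<alpha> y * delta L N \<beta> y" and m = m])
    show "delta L N \<alpha> (\<lambda>i. x (n + i)) * delta L N \<beta> (\<lambda>i. x (n + i)) \<le> delta L N (\<beta> + \<alpha>) (\<lambda>i. x (n + m i))" for n
      by (rule delta_add[OF basic_tail m S])
    fix \<eta> :: real assume \<eta>: "0 < \<eta>"
    have "\<eta> / 2 > 0" using \<eta> by simp
    obtain m1 where m1: "\<And>n y. m1 \<le> n \<Longrightarrow> block_basis (\<lambda>i. x (n + i)) y \<Longrightarrow> \<bar>delta L N \<alpha> y - \<gamma> \<alpha>\<bar> < \<eta> / 2"
      using stabilizes_approx[OF \<open>\<eta> / 2 > 0\<close>] by metis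
    obtain m2 where m2: "\<And>n y. m2 \<le> n \<Longrightarrow> block_basis (\<lambda>i. x (n + i)) y \<Longrightarrow> \<bar>delta L N \<beta> y - \<gamma> \<beta>\<bar> < \<eta> / 2"
      using stabilizes_approx[OF \<open>\<eta> / 2 > 0\<close>] by metis
    have "\<gamma> \<alpha> * \<gamma> \<beta> - \<eta> \<le> delta L N \<alpha> (\<lambda>i. x (n + i)) * delta L N \<beta> (\<lambda>i. x (n + i))" if n: "max m1 m2 \<le> n" for n
    proof -
      let ?a = "delta L N \<alpha> (\<lambda>i. x (n + i))" and ?b = "delta L N \<beta> (\<lambda>i. x (n + i))"
      have a: "\<gamma> \<alpha> \<le> ?a + \<eta> / 2" "\<gamma> \<beta> \<le> ?b + \<eta> / 2"
        using m1[OF order_trans[OF max.cobounded1 n] tail_refl] m2[OF order_trans[OF max.cobounded2 n] tail_refl] by linarith+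
      \<comment> \<open>The factors are replaced one at a time; since
        \<open>\<gamma> \<beta>\<close> and \<open>?a\<close> are at most 1, each replacement costs
        at most \<eta>/2.\<close>
      have "\<gamma> \<alpha> * \<gamma> \<beta> \<le> (?a + \<eta> / 2) * \<gamma> \<beta>" by (intro mult_right_mono a stabilizes_bounds)
      also have "\<dots> \<le> ?a * \<gamma> \<beta> + \<eta> / 2"
        using mult_left_mono[OF stabilizes_bounds(2)[of \<beta>], of "\<eta> / 2"] \<eta> by (simp add: distrib_right)
      also have "?a * \<gamma> \<beta> \<le> ?a * (?b + \<eta> / 2)" by (intro mult_left_mono a delta_nonneg basic_tail)
      also have "\<dots> \<le> ?a * ?b + \<eta> / 2"
        using mult_right_mono[OF delta_le_1[OF basic_tail[of n], of \<alpha>], of "\<eta> / 2"] \<eta> by (simp add: distrib_left)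
      finally show ?thesis by simp
    qed
    then show "\<exists>n0. \<forall>n\<ge>n0. \<gamma> \<alpha> * \<gamma> \<beta> - \<eta> \<le> delta L N \<alpha> (\<lambda>i. x (n + i)) * delta L N \<beta> (\<lambda>i. x (n + i))"
      by blast
  qed (rule m)
qed

lemma stabilizes_omult_nat: "\<gamma> \<alpha> ^ n \<le> \<gamma> (omult_nat \<alpha> n)"
proof (induction n)
  case (Suc n)
  have "\<gamma> \<alpha> ^ Suc n \<le> \<gamma> \<alpha> * \<gamma> (omult_nat \<alpha> n)"
    using mult_left_mono[OF Suc stabilizes_bounds(1)[of \<alpha>]] by simp
  also have "\<dots> \<le> \<gamma> (omult_nat \<alpha> (Suc n))" using stabilizes_add by simp
  finally show ?case .
qed (simp add: stabilizes_0)

text \<open>The subsequence \<open>x \<circ> p\<close> grows so fast that its tail from \<open>n\<close> on lies in the range where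
  \<open>delta (L \<alpha> n)\<close> is already stable; an \<open>\<alpha>\<close>-admissible sequence beginning after \<open>n\<close> is
  \<open>L \<alpha> n\<close>-admissible there.\<close>

lemma stabilizes_limit_ge:
  assumes lim: "limit_ord \<alpha>" and c: "\<And>n. c \<le> \<gamma> (L \<alpha> n)"
  shows "c \<le> \<gamma> \<alpha>"
proof (rule field_le_epsilon)
  fix \<eta> :: real assume "0 < \<eta>"
  then have \<eta>: "0 < \<eta> / 2" by simp
  obtain M where M: "\<And>n y. M \<le> n \<Longrightarrow> block_basis (\<lambda>i. x (n + i)) y \<Longrightarrow> \<bar>delta L N \<alpha> y - \<gamma> \<alpha>\<bar> < \<eta> / 2"
    using stabilizes_approx[OF \<eta>] by metis
  have "\<exists>m. \<forall>n\<ge>m. \<forall>y. block_basis (\<lambda>i. x (n + i)) y \<longrightarrow> \<bar>delta L N (L \<alpha> j) y - \<gamma> (L \<alpha> j)\<bar> < \<eta> / 2" for j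
    using stabilizes_approx[OF \<eta>] by metis
  then obtain m where m: "\<And>j n y. m j \<le> n \<Longrightarrow> block_basis (\<lambda>i. x (n + i)) y \<Longrightarrow>
      \<bar>delta L N (L \<alpha> j) y - \<gamma> (L \<alpha> j)\<bar> < \<eta> / 2" by metis
  \<comment> \<open>For n \<le> j this gives p j \<ge> m n + j: terms from n on lie in the tail
    starting at \<open>m n\<close>, and even relative to that tail the j-th one has position at
    least j, so spreading applies. The summand \<open>M\<close> in \<open>p\<close> keeps the whole
    subsequence where \<open>delta L N \<alpha>\<close> is already close to its limit.\<close>
  define q where "q j = j + (\<Sum>n\<le>j. m n)" for j
  define p where "p j = M + q j" for j
  have q: "strict_mono q" by (rule strict_monoI_Suc) (simp add: q_def)
  have p: "strict_mono p" using q by (simp add: p_def strict_mono_def)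
  have pm: "m n + j \<le> p j" if "n \<le> j" for n j
    using member_le_sum[of n "{..j}" m] that by (simp add: p_def q_def)
  let ?y = "\<lambda>i. x (p i)"
  have y: "block_basis x ?y" by (rule block_basis_subseq[OF x p])
  have y': "block_basis (\<lambda>i. x (M + i)) ?y"
    unfolding p_def using block_basis_subseq[OF basic_tail[of M] q] by (simp add: o_def)
  note by' = basic_seq_block[OF x y]
  \<comment> \<open>\<open>c - \<eta> / 2\<close> may be negative, whereas \<open>delta\<close> is a
    supremum of nonnegative numbers.\<close>
  have "max 0 (c - \<eta> / 2) \<le> delta L N \<alpha> ?y"
  proof (rule delta_geI[OF by'])
    fix k z assume z: "successive {..<k} ?y z" "mins ?y z ` {..<k} \<in> schreier L \<alpha>"
    from z(2) obtain n where n: "mins ?y z ` {..<k} \<in> schreier L (L \<alpha> n)" "\<forall>j\<in>mins ?y z ` {..<k}. n + 1 \<le> j"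
      using schreier_limit_iff[OF L lim] by blast
    have sp: "z i \<in> span (range ?y)" "z i \<noteq> 0" if "i < k" for i using successiveD[OF by' z(1)] that by auto
    have n': "n \<le> j" if "i < k" "j \<in> csupp ?y (z i)" for i j
    proof -
      have "n \<le> Min (csupp ?y (z i))" using n(2) that by auto
      also have "\<dots> \<le> j" using that finite_csupp[OF by' sp(1)] by simp
      finally show ?thesis .
    qed
    have Minx: "Min (csupp x (z i)) = p (Min (csupp ?y (z i)))" if "i < k" for i
      using Min_csupp_block[OF x y sp[OF that]] by (simp add: csupp_term[OF x])
    have "delta L N (L \<alpha> n) (\<lambda>i. x (m n + i)) * (\<Sum>i<k. N (z i)) \<le> N (\<Sum>i<k. z i)"
    proof (rule delta_ineq_tail[OF x])
      show "successive {..<k} x z" by (rule successive_block[OF x y z(1)])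
      show "csupp x (z i) \<subseteq> {m n..}" if i: "i < k" for i
      proof
        fix a assume "a \<in> csupp x (z i)"
        then obtain j where "j \<in> csupp ?y (z i)" "a = p j"
          using csupp_block[OF x y sp(1)[OF i]] by (auto simp: csupp_term[OF x])
        then show "a \<in> {m n..}" using pm[OF n'[OF i]] by fastforce
      qed
      let ?f = "\<lambda>j. Suc (p (j - 1) - m n)"
      have "?f ` mins ?y z ` {..<k} \<in> schreier L (L \<alpha> n)"
      proof (rule spreadingD[OF spreading_schreier[OF L] n(1)])
        show "j \<le> ?f j" if "j \<in> mins ?y z ` {..<k}" for j
        proof -
          have "n + 1 \<le> j" using n(2) that by blast
          then show ?thesis using pm[of n "j - 1"] by linarith
        qed
        show "strict_mono_on (mins ?y z ` {..<k}) ?f"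
        proof (rule strict_mono_onI)
          fix i j assume "i \<in> mins ?y z ` {..<k}" "j \<in> mins ?y z ` {..<k}" "i < j"
          moreover from this have "n + 1 \<le> i" using n(2) by blast
          ultimately have "p (i - 1) < p (j - 1)" "m n \<le> p (i - 1)"
            using strict_monoD[OF p, of "i - 1" "j - 1"] pm[of n "i - 1"] by linarith+
          then show "?f i < ?f j" by linarith
        qed
      qed
      then show "(\<lambda>i. Suc (Min (csupp x (z i)) - m n)) ` {..<k} \<in> schreier L (L \<alpha> n)"
        unfolding image_image using Minx by (simp cong: image_cong_simp)
    qed
    moreover have "max 0 (c - \<eta> / 2) \<le> delta L N (L \<alpha> n) (\<lambda>i. x (m n + i))"
      using m[OF order_refl tail_refl, of n] c[of n] delta_nonneg[OF basic_tail[of "m n"], of "L \<alpha> n"]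
      by linarith
    ultimately show "max 0 (c - \<eta> / 2) * (\<Sum>i<k. N (z i)) \<le> N (\<Sum>i<k. z i)"
      by (meson mult_right_mono order_trans sum_nonneg N_nonneg)
  qed simp
  then show "c \<le> \<gamma> \<alpha> + \<eta>" using M[OF order_refl y'] by linarith
qed

text \<open>Zero and successors are isolated in the order topology. At a limit \<alpha>,
  antitonicity leaves only a downward jump to be excluded, and \<open>stabilizes_limit_ge\<close>
  excludes it by producing an n with \<open>\<gamma> (L \<alpha> n)\<close> close to
  \<open>\<gamma> \<alpha>\<close>.\<close>

lemma stabilizes_continuous: "continuous_on UNIV \<gamma>"
  unfolding continuous_on_eq_continuous_at[OF open_UNIV]
proof (intro ballI)
  fix \<alpha> :: omega1
  have "\<exists>S. open S \<and> \<alpha> \<in> S \<and> (\<forall>\<beta>\<in>S. dist (\<gamma> \<beta>) (\<gamma> \<alpha>) < \<eta>)" if \<eta>: "0 < \<eta>" for \<eta>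
  proof (cases \<alpha> rule: omega1_cases)
    case zero
    then have "\<beta> = \<alpha>" if "\<beta> < osuc \<alpha>" for \<beta>
      using that by (simp add: less_osuc_iff order_antisym)
    then have "\<forall>\<beta>\<in>{..<osuc \<alpha>}. dist (\<gamma> \<beta>) (\<gamma> \<alpha>) < \<eta>"
      using \<eta> by (metis dist_self lessThan_iff)
    then show ?thesis using less_osuc[of \<alpha>] by (intro exI[of _ "{..<osuc \<alpha>}"]) auto
  next
    case (osuc \<alpha>')
    then have "\<beta> = \<alpha>" if "\<alpha>' < \<beta>" "\<beta> < osuc \<alpha>" for \<beta>
      using that by (metis less_osuc_iff osuc_le_iff order_antisym)
    then have "\<forall>\<beta>\<in>{\<alpha>'<..<osuc \<alpha>}. dist (\<gamma> \<beta>) (\<gamma> \<alpha>) < \<eta>"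
      using \<eta> by (metis dist_self greaterThanLessThan_iff)
    then show ?thesis using less_osuc[of \<alpha>] less_osuc[of \<alpha>'] osuc
      by (intro exI[of _ "{\<alpha>'<..<osuc \<alpha>}"]) auto
  next
    case limit
    obtain n where n: "\<gamma> (L \<alpha> n) < \<gamma> \<alpha> + \<eta>"
      using stabilizes_limit_ge[OF limit, of "\<gamma> \<alpha> + \<eta>"] \<eta> by (meson add_le_same_cancel1 not_less)
    have "dist (\<gamma> \<beta>) (\<gamma> \<alpha>) < \<eta>" if "L \<alpha> n < \<beta>" "\<beta> < osuc \<alpha>" for \<beta>
    proof -
      have "\<gamma> \<alpha> \<le> \<gamma> \<beta>" "\<gamma> \<beta> \<le> \<gamma> (L \<alpha> n)"
        using that by (auto intro!: stabilizes_antimono simp: less_osuc_iff)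
      then show ?thesis using n by (simp add: dist_real_def)
    qed
    then show ?thesis using less_osuc[of \<alpha>] fundamental_sequences_less[OF L limit]
      by (intro exI[of _ "{L \<alpha> n<..<osuc \<alpha>}"]) auto
  qed
  note nbhd = this
  show "isCont \<gamma> \<alpha>"
    unfolding isCont_def tendsto_iff eventually_at_topological
  proof (intro allI impI)
    fix \<eta> :: real assume "0 < \<eta>"
    from nbhd[OF this] obtain S where "open S" "\<alpha> \<in> S" "\<forall>\<beta>\<in>S. dist (\<gamma> \<beta>) (\<gamma> \<alpha>) < \<eta>" by blast
    then show "\<exists>S. open S \<and> \<alpha> \<in> S \<and> (\<forall>\<beta>\<in>S. \<beta> \<noteq> \<alpha> \<longrightarrow> \<beta> \<in> UNIV \<longrightarrow> dist (\<gamma> \<beta>) (\<gamma> \<alpha>) < \<eta>)"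
      by (intro exI[of _ S]) simp
  qed
qed

lemma stabilizes_one:
  assumes "\<gamma> 1 = 1"
  shows "\<gamma> \<alpha> = 1"
proof (induction \<alpha> rule: omega1_induct)
  case zero
  then show ?case by (rule stabilizes_0)
next
  case (osuc \<alpha>)
  have "1 \<le> \<gamma> (osuc \<alpha>)" using stabilizes_add[of 1 \<alpha>] assms osuc by (simp add: add_one_omega1)
  then show ?case using stabilizes_bounds(2) order_antisym by blast
next
  case (limit \<alpha>)
  have "1 \<le> \<gamma> \<alpha>" by (rule stabilizes_limit_ge[OF limit(1)]) (simp add: limit fundamental_sequences_less[OF L])
  then show ?case using stabilizes_bounds(2) order_antisym by blast
qed

end

end

section \<open>Lower \<open>\<ell>\<^sub>1\<close>-estimates and stabilization\<close>

context schreier_norm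
begin

text \<open>The weights \<open>N (x i)\<close> make the estimate invariant under scaling of single
  vectors, so nothing has to be normalized.\<close>

definition l1_lower :: "real \<Rightarrow> (nat \<Rightarrow> 'a) \<Rightarrow> bool" where
  "l1_lower c x \<longleftrightarrow> (\<forall>n a. c * (\<Sum>i<n. \<bar>a i\<bar> * N (x i)) \<le> N (\<Sum>i<n. a i *\<^sub>R x i))"

text \<open>This is the \<open>\<ell>\<^sub>1\<close>-norm with respect to the normalized sequence.
  Its virtue is additivity over successive vectors.\<close>

definition l1_norm :: "(nat \<Rightarrow> 'a) \<Rightarrow> 'a \<Rightarrow> real" where
  "l1_norm x v = (\<Sum>j\<in>csupp x v. \<bar>coeffs x v j\<bar> * N (x j))"

lemma l1_lower_finite:
  assumes "l1_lower c x" "finite A"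
  shows "c * (\<Sum>i\<in>A. \<bar>a i\<bar> * N (x i)) \<le> N (\<Sum>i\<in>A. a i *\<^sub>R x i)"
proof -
  obtain n where n: "A \<subseteq> {..<n}" using finite_nat_iff_bounded assms(2) by blast
  let ?b = "\<lambda>i. if i \<in> A then a i else 0"
  have "c * (\<Sum>i<n. \<bar>?b i\<bar> * N (x i)) \<le> N (\<Sum>i<n. ?b i *\<^sub>R x i)"
    by (rule assms(1)[unfolded l1_lower_def, rule_format])
  moreover have "(\<Sum>i<n. \<bar>?b i\<bar> * N (x i)) = (\<Sum>i\<in>A. \<bar>a i\<bar> * N (x i))"
    by (rule sum.mono_neutral_cong_right) (use n in auto)
  moreover have "(\<Sum>i<n. ?b i *\<^sub>R x i) = (\<Sum>i\<in>A. a i *\<^sub>R x i)"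
    by (rule sum.mono_neutral_cong_right) (use n in auto)
  ultimately show ?thesis by simp
qed

lemma l1_norm_bounds:
  assumes x: "basic_seq x" and v: "v \<in> span (range x)"
  shows "N v \<le> l1_norm x v" "l1_lower c x \<Longrightarrow> c * l1_norm x v \<le> N v"
proof -
  have e: "N v = N (\<Sum>i\<in>csupp x v. coeffs x v i *\<^sub>R x i)"
    using span_range_expand[OF x v finite_csupp[OF x v] order_refl] by simp
  show "N v \<le> l1_norm x v" unfolding e l1_norm_def by (rule N_sum_scaleR)
  show "c * l1_norm x v \<le> N v" if "l1_lower c x"
    unfolding e l1_norm_def by (rule l1_lower_finite[OF that finite_csupp[OF x v]])
qed

lemma l1_norm_scaleR:
  assumes x: "basic_seq x" and v: "v \<in> span (range x)"
  shows "l1_norm x (r *\<^sub>R v) = \<bar>r\<bar> * l1_norm x v"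
proof (cases "r = 0")
  case True
  have "csupp x 0 = {}" using csupp_finite_sum[OF x, of "{}"] by simp
  then show ?thesis using True by (simp add: l1_norm_def)
qed (simp add: l1_norm_def csupp_scaleR[OF x v] coeffs_scaleR[OF x v] abs_mult sum_distrib_left mult.assoc)

lemma l1_norm_successive_sum:
  assumes x: "basic_seq x" and I: "finite I" "successive I x z"
  shows "l1_norm x (\<Sum>i\<in>I. z i) = (\<Sum>i\<in>I. l1_norm x (z i))"
proof -
  have "l1_norm x (\<Sum>i\<in>I. z i) = (\<Sum>i\<in>I. \<Sum>j\<in>csupp x (z i). \<bar>coeffs x (\<Sum>i\<in>I. z i) j\<bar> * N (x j))"
    unfolding l1_norm_def csupp_successive_sum[OF x I]
    by (rule sum.UNION_disjoint)
      (use I successive_disjoint[OF x I(2)] finite_csupp[OF x successiveD(1)[OF x I(2)]] in auto)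
  also have "\<dots> = (\<Sum>i\<in>I. l1_norm x (z i))"
    unfolding l1_norm_def by (intro sum.cong refl) (simp add: coeffs_successive_sum[OF x I])
  finally show ?thesis .
qed

lemma l1_norm_pos:
  assumes x: "basic_seq x" and v: "v \<in> span (range x)" "v \<noteq> 0"
  shows "0 < l1_norm x v"
  using l1_norm_bounds(1)[OF x v(1)] N_pos[OF v(2)] by linarith

text \<open>The \<open>\<ell>\<^sub>1\<close>-norm dominates N and is additive over successive
  vectors, so c is a lower bound for all finite block sequences and hence for every \<alpha> at
  once.\<close>

lemma l1_lower_delta:
  assumes x: "basic_seq x" and y: "block_basis x y" and c: "0 \<le> c" "l1_lower c x"
  shows "c \<le> delta L N \<alpha> y"
proof (rule delta_geI[OF basic_seq_block[OF x y] c(1)])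
  fix k z assume "successive {..<k} y z"
  then have z: "successive {..<k} x z" by (rule successive_block[OF x y])
  have sp: "z i \<in> span (range x)" if "i < k" for i using successiveD[OF x z] that by simp
  have "c * (\<Sum>i<k. N (z i)) \<le> c * (\<Sum>i<k. l1_norm x (z i))"
    using l1_norm_bounds(1)[OF x sp] c(1) by (intro mult_left_mono sum_mono) auto
  also have "\<dots> = c * l1_norm x (\<Sum>i<k. z i)" by (simp add: l1_norm_successive_sum[OF x _ z])
  also have "\<dots> \<le> N (\<Sum>i<k. z i)"
    by (rule l1_norm_bounds(2)[OF x _ c(2)]) (use sp in \<open>auto intro: span_sum\<close>)
  finally show "c * (\<Sum>i<k. N (z i)) \<le> N (\<Sum>i<k. z i)" .
qed

text \<open>James's argument: beyond a suitable index the ratio of the norm to the \<open>\<ell>\<^sub>1\<close>-norm hardly drops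
  below its asymptotic infimum \<open>C\<close>; blocks whose ratio is close to \<open>C\<close> therefore span almost
  isometric copies of \<open>\<ell>\<^sub>1\<close>.\<close>

lemma l1_lower_distortion:
  assumes y: "basic_seq y" and c: "0 < c" "l1_lower c y"
  obtains w where "block_basis y w" "\<And>m. l1_lower (1 - 2 / real (Suc m)) (\<lambda>i. w (m + i))"
proof -
  define V where "V n = {v \<in> span (range y). v \<noteq> 0 \<and> csupp y v \<subseteq> {n..}}" for n
  define R where "R n = (\<lambda>v. N v / l1_norm y v) ` V n" for n
  have yV: "y n \<in> V n" for n
    by (auto simp: V_def basic_seq_nonzero[OF y] csupp_term[OF y] intro: span_base)
  have l1pos: "0 < l1_norm y v" if "v \<in> V n" for v n using l1_norm_pos[OF y] that by (auto simp: V_def)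
  have Rb: "c \<le> N v / l1_norm y v" "N v / l1_norm y v \<le> 1" if "v \<in> V n" for v n
    using l1pos[OF that] l1_norm_bounds[OF y] c(2) that by (auto simp: V_def pos_le_divide_eq)
  have Rne: "R n \<noteq> {}" for n using yV by (auto simp: R_def)
  have Rbdd: "bdd_below (R n)" for n using Rb(1) by (intro bdd_belowI[of _ c]) (auto simp: R_def)
  have InfR: "c \<le> Inf (R n)" "Inf (R n) \<le> 1" for n
  proof -
    show "c \<le> Inf (R n)" by (rule cInf_greatest[OF Rne]) (use Rb(1) in \<open>auto simp: R_def\<close>)
    have "Inf (R n) \<le> N (y n) / l1_norm y (y n)" by (rule cInf_lower[OF _ Rbdd]) (use yV in \<open>auto simp: R_def\<close>)
    then show "Inf (R n) \<le> 1" using Rb(2)[OF yV[of n]] by linarith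
  qed
  define C where "C = (SUP n. Inf (R n))"
  have bdd: "bdd_above (range (\<lambda>n. Inf (R n)))" using InfR(2) by (intro bdd_aboveI[of _ 1]) auto
  have InfC: "Inf (R n) \<le> C" for n unfolding C_def by (rule cSUP_upper[OF UNIV_I bdd])
  then have Cpos: "0 < C" using InfR(1)[of 0] c(1) by (meson less_le_trans)
  define \<epsilon> where "\<epsilon> k = 1 / real (Suc k)" for k
  have eps: "0 < \<epsilon> k" for k by (simp add: \<epsilon>_def)
  have eps_mono: "\<epsilon> (m + i) \<le> \<epsilon> m" for m i by (simp add: \<epsilon>_def frac_le)
  have "\<exists>n. C * (1 - \<epsilon> k) < Inf (R n)" for k
  proof -
    have "C * (1 - \<epsilon> k) < C" using Cpos eps[of k] by (simp add: algebra_simps)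
    then have "\<exists>n\<in>UNIV. C * (1 - \<epsilon> k) < Inf (R n)" unfolding C_def using less_cSUP_iff[OF _ bdd] by blast
    then show ?thesis by blast
  qed
  then obtain nn where nn: "\<And>k. C * (1 - \<epsilon> k) < Inf (R (nn k))" by metis
  have ex: "\<exists>v\<in>V n. N v < C * (1 + \<epsilon> k) * l1_norm y v" for n k
  proof -
    have "Inf (R n) < C * (1 + \<epsilon> k)"
      using InfC[of n] mult_pos_pos[OF Cpos eps[of k]] by (simp add: algebra_simps)
    then obtain v where "v \<in> V n" "N v / l1_norm y v < C * (1 + \<epsilon> k)"
      using cInf_lessD[OF Rne] by (auto simp: R_def)
    then show ?thesis using l1pos by (auto simp: pos_divide_less_eq)
  qed
  \<comment> \<open>The k-th vector has ratio below C (1 + \<epsilon>) but lives beyond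
    \<open>nn k\<close>, where no nonzero combination has ratio below C (1 - \<epsilon>), with
    \<epsilon> = \<open>\<epsilon> k\<close>.\<close>
  let ?P = "\<lambda>k v. v \<in> V (nn k) \<and> N v < C * (1 + \<epsilon> k) * l1_norm y v"
  have "\<exists>w. \<forall>k. ?P k (w k) \<and> (\<forall>a\<in>csupp y (w k). \<forall>b\<in>csupp y (w (Suc k)). a < b)"
  proof (rule dependent_nat_choice)
    show "\<exists>v. ?P 0 v" using ex by blast
    fix v k assume v: "?P k v"
    let ?n = "nn (Suc k) + Suc (Max (csupp y v))"
    obtain v' where v': "v' \<in> V ?n" "N v' < C * (1 + \<epsilon> (Suc k)) * l1_norm y v'" using ex by blast
    have "v' \<in> V (nn (Suc k))" using v'(1) by (auto simp: V_def)
    moreover have "a < b" if "a \<in> csupp y v" "b \<in> csupp y v'" for a b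
    proof -
      have "a \<le> Max (csupp y v)" using that v finite_csupp[OF y] by (auto simp: V_def)
      moreover have "?n \<le> b" using that v'(1) by (auto simp: V_def)
      ultimately show ?thesis by linarith
    qed
    ultimately show "\<exists>v'. ?P (Suc k) v' \<and> (\<forall>a\<in>csupp y v. \<forall>b\<in>csupp y v'. a < b)" using v' by blast
  qed
  then obtain w where w: "\<And>k. w k \<in> V (nn k)" "\<And>k. N (w k) < C * (1 + \<epsilon> k) * l1_norm y (w k)"
    "\<And>k a b. a \<in> csupp y (w k) \<Longrightarrow> b \<in> csupp y (w (Suc k)) \<Longrightarrow> a < b" by blast
  have sw: "successive UNIV y w"
    by (rule successive_SucI[OF y]) (use w in \<open>auto simp: V_def\<close>)
  have "l1_lower (1 - 2 / real (Suc m)) (\<lambda>i. w (m + i))" for m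
    unfolding l1_lower_def
  proof (intro allI)
    fix n and a :: "nat \<Rightarrow> real"
    define A where "A = {i. i < n \<and> a i \<noteq> 0}"
    have fA: "finite A" by (simp add: A_def)
    define v where "v = (\<Sum>i\<in>A. a i *\<^sub>R w (m + i))"
    have wsp: "w k \<in> span (range y)" for k using w(1)[of k] by (simp add: V_def)
    have "successive A y (\<lambda>i. w (m + i))" using sw add_less_cancel_left[of m] unfolding successive_def by blast
    then have sA: "successive A y (\<lambda>i. a i *\<^sub>R w (m + i))"
      by (rule successive_scaleR[OF y]) (simp add: A_def)
    have l1v: "l1_norm y v = (\<Sum>i\<in>A. \<bar>a i\<bar> * l1_norm y (w (m + i)))"
      unfolding v_def by (simp add: l1_norm_successive_sum[OF y fA sA] l1_norm_scaleR[OF y wsp])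
    have wm: "csupp y (w (m + i)) \<subseteq> {nn m..}" for i
    proof (cases i)
      case (Suc j)
      show ?thesis
      proof
        fix b assume b: "b \<in> csupp y (w (m + i))"
        obtain d where d: "d \<in> csupp y (w m)" using w(1)[of m] csupp_nonempty[OF y] by (auto simp: V_def)
        have "d < b" using sw b d Suc unfolding successive_def by (metis UNIV_I less_add_same_cancel1 zero_less_Suc)
        moreover have "nn m \<le> d" using w(1)[of m] d by (auto simp: V_def)
        ultimately show "b \<in> {nn m..}" by simp
      qed
    qed (use w(1)[of m] in \<open>simp add: V_def\<close>)
    have main: "C * (1 - \<epsilon> m) * l1_norm y v \<le> N v"
    proof (cases "v = 0")
      case True
      have "csupp y 0 = {}" using csupp_finite_sum[OF y, of "{}"] by simp
      then show ?thesis using True by (simp add: l1_norm_def)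
    next
      case False
      have "csupp y v \<subseteq> (\<Union>i\<in>A. csupp y (a i *\<^sub>R w (m + i)))"
        unfolding v_def csupp_successive_sum[OF y fA sA] by simp
      also have "\<dots> \<subseteq> {nn m..}"
        using wm csupp_scaleR[OF y wsp] by (fastforce simp: A_def)
      finally have vV: "v \<in> V (nn m)" using False wsp
        by (auto simp: V_def v_def intro!: span_sum span_scale)
      then have "Inf (R (nn m)) \<le> N v / l1_norm y v" by (intro cInf_lower[OF _ Rbdd]) (simp add: R_def)
      then have "C * (1 - \<epsilon> m) \<le> N v / l1_norm y v" using nn[of m] by linarith
      then show ?thesis using l1pos[OF vV] by (simp add: pos_le_divide_eq)
    qed
    have v_eq: "v = (\<Sum>i<n. a i *\<^sub>R w (m + i))"
      unfolding v_def by (rule sum.mono_neutral_left) (auto simp: A_def)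
    have S_eq: "(\<Sum>i<n. \<bar>a i\<bar> * N (w (m + i))) = (\<Sum>i\<in>A. \<bar>a i\<bar> * N (w (m + i)))"
      by (rule sum.mono_neutral_right) (auto simp: A_def)
    have S_le: "(\<Sum>i\<in>A. \<bar>a i\<bar> * N (w (m + i))) \<le> C * (1 + \<epsilon> m) * l1_norm y v"
    proof -
      have "N (w (m + i)) \<le> C * (1 + \<epsilon> m) * l1_norm y (w (m + i))" for i
      proof -
        have "0 \<le> l1_norm y (w (m + i))" by (simp add: l1_norm_def sum_nonneg)
        then have "C * (1 + \<epsilon> (m + i)) * l1_norm y (w (m + i)) \<le> C * (1 + \<epsilon> m) * l1_norm y (w (m + i))"
          using Cpos eps_mono[of m i] by (intro mult_right_mono mult_left_mono) auto
        then show ?thesis using w(2)[of "m + i"] by linarith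
      qed
      then have "(\<Sum>i\<in>A. \<bar>a i\<bar> * N (w (m + i))) \<le> (\<Sum>i\<in>A. \<bar>a i\<bar> * (C * (1 + \<epsilon> m) * l1_norm y (w (m + i))))"
        by (intro sum_mono mult_left_mono) auto
      then show ?thesis by (simp add: l1v sum_distrib_left algebra_simps)
    qed
    have S0: "0 \<le> (\<Sum>i\<in>A. \<bar>a i\<bar> * N (w (m + i)))" by (intro sum_nonneg) simp
    have lv0: "0 \<le> l1_norm y v" by (simp add: l1_norm_def sum_nonneg)
    \<comment> \<open>With \<epsilon> = \<open>\<epsilon> m\<close>, the norm of v is at least C (1
      - \<epsilon>) times its \<open>\<ell>\<^sub>1\<close>-norm and the weighted sum at most C (1 +
      \<epsilon>) times it. The constant comes from (1 - 2\<epsilon>)(1 + \<epsilon>) \<le> 1 -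
      \<epsilon>.\<close>
    show "(1 - 2 / real (Suc m)) * (\<Sum>i<n. \<bar>a i\<bar> * N (w (m + i))) \<le> N (\<Sum>i<n. a i *\<^sub>R w (m + i))"
    proof (cases "1 - 2 * \<epsilon> m \<le> 0")
      case True
      then have "(1 - 2 * \<epsilon> m) * (\<Sum>i\<in>A. \<bar>a i\<bar> * N (w (m + i))) \<le> N v"
        using S0 N_nonneg[of v] by (meson mult_nonpos_nonneg order_trans)
      then show ?thesis unfolding S_eq v_eq[symmetric] by (simp add: \<epsilon>_def)
    next
      case False
      then have "(1 - 2 * \<epsilon> m) * (\<Sum>i\<in>A. \<bar>a i\<bar> * N (w (m + i))) \<le> (1 - 2 * \<epsilon> m) * (C * (1 + \<epsilon> m) * l1_norm y v)"
        by (intro mult_left_mono S_le) simp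
      also have "\<dots> = C * l1_norm y v * ((1 - 2 * \<epsilon> m) * (1 + \<epsilon> m))" by (simp add: algebra_simps)
      also have "\<dots> \<le> C * l1_norm y v * (1 - \<epsilon> m)"
        using eps[of m] Cpos lv0 by (intro mult_left_mono) (auto simp: algebra_simps)
      also have "\<dots> \<le> N v" using main by (simp add: algebra_simps)
      finally show ?thesis unfolding S_eq v_eq[symmetric] by (simp add: \<epsilon>_def)
    qed
  qed
  moreover have "block_basis y w" using sw by (simp add: block_basis_iff[OF y])
  ultimately show ?thesis using that by blast
qed

lemma l1_lower_stabilizes:
  assumes y: "basic_seq y" and c: "0 < c" "l1_lower c y"
  obtains w where "block_basis y w" "Delta_stabilizes L N w (\<lambda>_. 1)"
proof -
  obtain w where w: "block_basis y w" "\<And>m. l1_lower (1 - 2 / real (Suc m)) (\<lambda>i. w (m + i))"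
    using l1_lower_distortion[OF y c] by blast
  note bw = basic_seq_block[OF y w(1)]
  \<comment> \<open>The numerator 3 in place of 2 makes the inequality strict, and n \<ge> 1 makes 1
    - 2/(n + 1) nonnegative.\<close>
  have "\<bar>delta L N \<alpha> z - 1\<bar> < 3 / real (Suc n)" if n: "1 \<le> n" and z: "block_basis (\<lambda>i. w (n + i)) z" for n z \<alpha>
  proof -
    note bn = basic_seq_block[OF bw block_basis_tail[OF bw, of n]]
    have "1 - 2 / real (Suc n) \<le> delta L N \<alpha> z"
      by (rule l1_lower_delta[OF bn z _ w(2)]) (use n in \<open>simp add: field_simps\<close>)
    moreover have "delta L N \<alpha> z \<le> 1" by (rule delta_le_1[OF basic_seq_block[OF bn z]])
    moreover have "2 / real (Suc n) < 3 / real (Suc n)" by (simp add: divide_strict_right_mono)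
    ultimately show ?thesis by linarith
  qed
  moreover have "decseq (\<lambda>n. 3 / real (Suc n))" by (simp add: decseq_def frac_le)
  moreover have "(\<lambda>n. 3 / real (Suc n)) \<longlonglongrightarrow> 0"
    using tendsto_mult_right_zero[OF LIMSEQ_inverse_real_of_nat, of 3] by (simp add: divide_inverse)
  ultimately have "Delta_stabilizes L N w (\<lambda>_. 1)"
    unfolding Delta_stabilizes_def by blast
  then show ?thesis using that w(1) by blast
qed

section \<open>The tree of rational block sequences with a lower estimate\<close>

definition rational_span :: "(nat \<Rightarrow> 'a) \<Rightarrow> 'a set" where
  "rational_span x = (\<lambda>qs. \<Sum>j<length qs. real_of_rat (qs ! j) *\<^sub>R x j) ` UNIV"

lemma countable_rational_span: "countable (rational_span x)"
  by (simp add: rational_span_def)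

text \<open>Only nonzero coefficients are perturbed. The support does not grow, so approximants of
  successive vectors are successive.\<close>

lemma rational_span_approx:
  assumes x: "basic_seq x" and v: "v \<in> span (range x)" "v \<noteq> 0" and \<epsilon>: "0 < \<epsilon>" "\<epsilon> < 1"
  obtains u where "u \<in> rational_span x" "u \<in> span (range x)" "u \<noteq> 0" "csupp x u \<subseteq> csupp x v"
    "N (u - v) \<le> \<epsilon> * N v"
proof -
  let ?A = "csupp x v"
  have fA: "finite ?A" by (rule finite_csupp[OF x v(1)])
  define S where "S = 1 + (\<Sum>j\<in>?A. N (x j))"
  have S: "0 < S" unfolding S_def by (simp add: sum_nonneg add_pos_nonneg)
  \<comment> \<open>An error \<eta> in each coefficient adds up to at most \<eta> S, which is
    \<epsilon> times \<open>N v\<close>; the summand 1 in \<open>S\<close> makes it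
    positive.\<close>
  define \<eta> where "\<eta> = \<epsilon> * N v / S"
  have \<eta>: "0 < \<eta>" unfolding \<eta>_def using \<epsilon> N_pos[OF v(2)] S by simp
  have "\<exists>q. \<bar>real_of_rat q - coeffs x v j\<bar> \<le> \<eta>" for j
  proof -
    obtain q where "coeffs x v j < of_rat q" "of_rat q < coeffs x v j + \<eta>"
      using of_rat_dense[of "coeffs x v j" "coeffs x v j + \<eta>"] \<eta> by auto
    then show ?thesis by (intro exI[of _ q]) linarith
  qed
  then obtain q where q: "\<And>j. \<bar>real_of_rat (q j) - coeffs x v j\<bar> \<le> \<eta>" by metis
  obtain n where n: "?A \<subseteq> {..<n}" using finite_nat_iff_bounded fA by blast
  define u where "u = (\<Sum>j\<in>?A. real_of_rat (q j) *\<^sub>R x j)"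
  have "u = (\<Sum>j<n. real_of_rat (if j \<in> ?A then q j else 0) *\<^sub>R x j)"
    unfolding u_def by (rule sum.mono_neutral_cong_left) (use n in auto)
  also have "\<dots> = (\<Sum>j<n. real_of_rat (map (\<lambda>j. if j \<in> ?A then q j else 0) [0..<n] ! j) *\<^sub>R x j)"
    by (rule sum.cong) auto
  finally have "u = (\<Sum>j<length (map (\<lambda>j. if j \<in> ?A then q j else 0) [0..<n]).
      real_of_rat (map (\<lambda>j. if j \<in> ?A then q j else 0) [0..<n] ! j) *\<^sub>R x j)"
    by (simp only: length_map length_upt diff_zero)
  then have 1: "u \<in> rational_span x" unfolding rational_span_def by blast
  have 2: "u \<in> span (range x)" unfolding u_def by (intro span_sum span_scale span_base rangeI)
  have 3: "csupp x u \<subseteq> ?A" unfolding u_def csupp_finite_sum[OF x fA] by blast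
  have "u - v = (\<Sum>j\<in>?A. (real_of_rat (q j) - coeffs x v j) *\<^sub>R x j)"
    using span_range_expand[OF x v(1) fA order_refl]
    by (simp add: u_def scaleR_left_diff_distrib sum_subtractf)
  then have "N (u - v) \<le> (\<Sum>j\<in>?A. \<bar>real_of_rat (q j) - coeffs x v j\<bar> * N (x j))"
    using N_sum_scaleR by metis
  also have "\<dots> \<le> (\<Sum>j\<in>?A. \<eta> * N (x j))" by (intro sum_mono mult_right_mono q) simp
  also have "\<dots> \<le> \<eta> * S" using \<eta> by (simp add: S_def sum_distrib_left[symmetric] algebra_simps)
  also have "\<dots> = \<epsilon> * N v" using S by (simp add: \<eta>_def)
  finally have 4: "N (u - v) \<le> \<epsilon> * N v" .
  have "u \<noteq> 0"
  proof
    assume "u = 0"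
    then have "N v \<le> \<epsilon> * N v" using 4 by (simp add: N_minus)
    then show False using \<epsilon> N_pos[OF v(2)] by simp
  qed
  then show ?thesis using that 1 2 3 4 by blast
qed

definition l1_tree :: "real \<Rightarrow> (nat \<Rightarrow> 'a) \<Rightarrow> 'a list set" where
  "l1_tree c x = {vs. set vs \<subseteq> rational_span x \<and> successive {..<length vs} x ((!) vs) \<and>
     (\<forall>a. c * (\<Sum>i<length vs. \<bar>a i\<bar> * N (vs ! i)) \<le> N (\<Sum>i<length vs. a i *\<^sub>R vs ! i))}"

text \<open>Longer sequences are smaller, so infinite descent is an infinite branch. New entries
  come from the countable \<open>rational_span x\<close>, which bounds the predecessors of a
  node.\<close>

definition l1_tree_rel :: "real \<Rightarrow> (nat \<Rightarrow> 'a) \<Rightarrow> ('a list \<times> 'a list) set" where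
  "l1_tree_rel c x = {(vs @ [v], vs) | vs v. vs @ [v] \<in> l1_tree c x}"

text \<open>The entries along an infinite branch would form a block basis with lower estimate
  c.\<close>

lemma wf_l1_tree_rel:
  assumes x: "basic_seq x" and no: "\<And>y. block_basis x y \<Longrightarrow> \<not> l1_lower c y"
  shows "wf (l1_tree_rel c x)"
  unfolding wf_iff_no_infinite_down_chain
proof
  assume "\<exists>f. \<forall>i. (f (Suc i), f i) \<in> l1_tree_rel c x"
  then obtain f where f: "\<And>i. (f (Suc i), f i) \<in> l1_tree_rel c x" by blast
  \<comment> \<open>The relation puts only its longer member into the tree, so \<open>f 0\<close> is
    left aside.\<close>
  have fT: "f (Suc i) \<in> l1_tree c x" for i using f[of i] by (auto simp: l1_tree_rel_def)
  have fS: "\<exists>v. f (Suc i) = f i @ [v]" for i using f[of i] by (auto simp: l1_tree_rel_def)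
  have len: "n \<le> length (f n)" for n
  proof (induction n)
    case (Suc n)
    then show ?case using fS[of n] by auto
  qed simp
  have pre: "i < length (f n) \<Longrightarrow> f (n + k) ! i = f n ! i \<and> i < length (f (n + k))" for i n k
  proof (induction k)
    case (Suc k)
    then show ?case using fS[of "n + k"] by (auto simp: nth_append)
  qed simp
  define y where "y i = f (Suc i) ! i" for i
  have y: "f n ! i = y i" if "i < n" for i n
    using pre[of i "Suc i" "n - Suc i"] len[of "Suc i"] that by (simp add: y_def)
  have sf: "successive {..<length (f (Suc n))} x ((!) (f (Suc n)))" for n
    using fT[of n] by (simp add: l1_tree_def)
  have "successive UNIV x y"
  proof (rule successive_SucI[OF x])
    show "y i \<in> span (range x)" "y i \<noteq> 0" for i
      using successiveD[OF x sf[of i], of i] len[of "Suc i"] by (auto simp: y_def)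
    fix i a b assume "a \<in> csupp x (y i)" "b \<in> csupp x (y (Suc i))"
    moreover have "f (Suc (Suc i)) ! i = y i" "f (Suc (Suc i)) ! Suc i = y (Suc i)" using y by auto
    moreover have "i < length (f (Suc (Suc i)))" "Suc i < length (f (Suc (Suc i)))"
      using len[of "Suc (Suc i)"] by auto
    ultimately show "a < b" using sf[of "Suc i"] lessI[of i] unfolding successive_def by (metis lessThan_iff)
  qed
  then have "block_basis x y" by (simp add: block_basis_iff[OF x])
  moreover have "l1_lower c y"
    unfolding l1_lower_def
  proof (intro allI)
    fix n and a :: "nat \<Rightarrow> real"
    let ?vs = "f (Suc n)" and ?b = "\<lambda>i. if i < n then a i else 0"
    have n: "n \<le> length ?vs" using len[of "Suc n"] by simp
    have "c * (\<Sum>i<length ?vs. \<bar>?b i\<bar> * N (?vs ! i)) \<le> N (\<Sum>i<length ?vs. ?b i *\<^sub>R ?vs ! i)"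
      using fT[of n] unfolding l1_tree_def by (elim CollectE conjE allE[of _ ?b])
    moreover have "(\<Sum>i<length ?vs. \<bar>?b i\<bar> * N (?vs ! i)) = (\<Sum>i<n. \<bar>a i\<bar> * N (y i))"
      by (rule sum.mono_neutral_cong_right) (use n y[of _ "Suc n"] in auto)
    moreover have "(\<Sum>i<length ?vs. ?b i *\<^sub>R ?vs ! i) = (\<Sum>i<n. a i *\<^sub>R y i)"
      by (rule sum.mono_neutral_cong_right) (use n y[of _ "Suc n"] in auto)
    ultimately show "c * (\<Sum>i<n. \<bar>a i\<bar> * N (y i)) \<le> N (\<Sum>i<n. a i *\<^sub>R y i)" by simp
  qed
  ultimately show False using no by blast
qed

lemma sorted_list_of_set_insert_greater:
  assumes "finite F" "\<forall>j\<in>F. j < (i::nat)"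
  shows "sorted_list_of_set (insert i F) = sorted_list_of_set F @ [i]"
proof -
  have "i \<notin> F" using assms by blast
  then have "sorted_list_of_set (insert i F) = insort i (sorted_list_of_set F)"
    using assms(1) by (simp add: sorted_list_of_set_insert_remove)
  also have "\<dots> = sorted_list_of_set F @ [i]"
    by (rule sorted_insort_is_snoc) (use assms in auto)
  finally show ?thesis .
qed

text \<open>If \<open>\<delta>\<^sub>\<alpha>(y)\<close> is not small, the sets of the family \<open>S\<^sub>\<alpha>\<close> embed into the tree of rational
  \<open>\<ell>\<^sub>1\<close>-sequences, whose rank is then at least \<open>\<alpha>\<close>.\<close>

lemma delta_small_rank:
  assumes x: "basic_seq x" and no: "\<And>y. block_basis x y \<Longrightarrow> \<not> l1_lower c y" and c: "0 < c"
  shows "\<exists>\<beta>. \<forall>\<alpha> y. \<beta> < \<alpha> \<longrightarrow> block_basis x y \<longrightarrow> delta L N \<alpha> y < 4 * c"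
proof -
  let ?R = "l1_tree_rel c x"
  have "countable {s. (s, t) \<in> ?R}" for t
  proof (rule countable_subset)
    show "{s. (s, t) \<in> ?R} \<subseteq> (\<lambda>v. t @ [v]) ` rational_span x"
      by (auto simp: l1_tree_rel_def l1_tree_def)
  qed (simp add: countable_rational_span)
  from ex_omega1_rank[OF wf_l1_tree_rel[OF x no] this]
  obtain \<rho> :: "'a list \<Rightarrow> omega1" where \<rho>: "\<And>s t. (s, t) \<in> ?R \<Longrightarrow> \<rho> s < \<rho> t" by blast
  have "\<alpha> \<le> \<rho> []" if y: "block_basis x y" and d4: "4 * c \<le> delta L N \<alpha> y" for \<alpha> y
  proof -
    note by' = basic_seq_block[OF x y]
    \<comment> \<open>The factor 4 arises here: replacing the vectors by rational ones with relative
      error d/2 halves the lower estimate and at most doubles their norms, which leaves d/4 \<ge>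
      c.\<close>
    define d where "d = delta L N \<alpha> y"
    have d: "0 < d" "d \<le> 1" "c \<le> d / 4" using d4 c delta_le_1[OF by', of \<alpha>] by (auto simp: d_def)
    have "\<exists>u. u \<in> rational_span x \<and> u \<in> span (range x) \<and> u \<noteq> 0 \<and> csupp x u \<subseteq> csupp x (y i) \<and>
        N (u - y i) \<le> d / 2 * N (y i)" for i
    proof (rule rational_span_approx[OF x block_in_span[OF x y, of i] block_nonzero[OF x y]])
      show "0 < d / 2" "d / 2 < 1" using d by auto
    qed blast
    then obtain u where u: "\<And>i. u i \<in> rational_span x" "\<And>i. u i \<in> span (range x)" "\<And>i. u i \<noteq> 0"
      "\<And>i. csupp x (u i) \<subseteq> csupp x (y i)" "\<And>i. N (u i - y i) \<le> d / 2 * N (y i)" by metis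
    \<comment> \<open>Elements of F are counted from 1, terms of \<open>u\<close> from 0.\<close>
    define t where "t F = map (\<lambda>i. u (i - 1)) (sorted_list_of_set F)" for F
    have tT: "t F \<in> l1_tree c x" if F: "F \<in> schreier L \<alpha>" for F
    proof -
      have fF: "finite F" by (rule schreier_finite[OF L F])
      define xs where "xs = sorted_list_of_set F"
      have set_xs: "set xs = F" using fF by (simp add: xs_def)
      have len: "length (t F) = length xs" by (simp add: t_def xs_def)
      define h where "h i = xs ! i - 1" for i
      have tn: "t F ! i = u (h i)" if "i < length xs" for i using that by (simp add: t_def xs_def h_def)
      have pos: "0 < xs ! i" if "i < length xs" for i
        using schreier_pos[OF L F] nth_mem[OF that] set_xs by auto
      have h_less: "h i < h j" if "i < j" "j < length xs" for i j
      proof -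
        have "xs ! i < xs ! j"
          using strict_sorted_list_of_set[of F] that by (simp add: sorted_wrt_iff_nth_less xs_def)
        then show ?thesis using pos[of i] that by (simp add: h_def)
      qed
      have "set (t F) \<subseteq> rational_span x" using u(1) by (auto simp: t_def)
      moreover have "successive {..<length (t F)} x ((!) (t F))"
        unfolding successive_def len
      proof (intro conjI ballI impI)
        fix i j a b assume "i \<in> {..<length xs}" "j \<in> {..<length xs}" "i < j"
          "a \<in> csupp x (t F ! i)" "b \<in> csupp x (t F ! j)"
        then show "a < b"
          using h_less[of i j] u(4)[of "h i"] u(4)[of "h j"] tn csupp_block_less[OF x y, of a "h i" b "h j"]
          by auto
      qed (use u tn in auto)
      moreover have "c * (\<Sum>i<length (t F). \<bar>a i\<bar> * N (t F ! i)) \<le> N (\<Sum>i<length (t F). a i *\<^sub>R t F ! i)" for a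
      proof -
        let ?n = "length xs"
        \<comment> \<open>Blocks are nonzero, so terms with coefficient 0 are dropped; heredity
          keeps the remaining indices in \<open>S\<^sub>\<alpha>\<close>.\<close>
        define A where "A = {i. i < ?n \<and> a i \<noteq> 0}"
        have fA: "finite A" by (simp add: A_def)
        have sA: "successive A y (\<lambda>i. a i *\<^sub>R y (h i))"
        proof (rule successive_scaleR[OF by'])
          show "successive A y (\<lambda>i. y (h i))"
            using h_less basic_seq_nonzero[OF by']
            by (auto simp: successive_def A_def csupp_term[OF by'] intro: span_base)
        qed (simp add: A_def)
        have mins: "mins y (\<lambda>i. a i *\<^sub>R y (h i)) ` A \<in> schreier L \<alpha>"
        proof (rule schreier_hereditary[OF L F])
          have "Suc (Min (csupp y (a i *\<^sub>R y (h i)))) = xs ! i" if "i \<in> A" for i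
            using that pos[of i] csupp_scaleR[OF by', of "y (h i)" "a i"]
            by (simp add: A_def csupp_term[OF by'] span_base h_def)
          then show "mins y (\<lambda>i. a i *\<^sub>R y (h i)) ` A \<subseteq> F"
            using nth_mem[of _ xs] set_xs by (auto simp: A_def)
        qed
        define S where "S = (\<Sum>i<?n. \<bar>a i\<bar> * N (y (h i)))"
        have "d * (\<Sum>i\<in>A. N (a i *\<^sub>R y (h i))) \<le> N (\<Sum>i\<in>A. a i *\<^sub>R y (h i))"
          unfolding d_def by (rule delta_ineq[OF by' fA sA mins])
        moreover have "(\<Sum>i\<in>A. N (a i *\<^sub>R y (h i))) = S"
          unfolding S_def by (rule sum.mono_neutral_cong_left) (auto simp: A_def N_scaleR)
        moreover have "(\<Sum>i\<in>A. a i *\<^sub>R y (h i)) = (\<Sum>i<?n. a i *\<^sub>R y (h i))"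
          by (rule sum.mono_neutral_left) (auto simp: A_def)
        ultimately have 1: "d * S \<le> N (\<Sum>i<?n. a i *\<^sub>R y (h i))" by simp
        have "N (\<Sum>i<?n. a i *\<^sub>R (y (h i) - u (h i))) \<le> (\<Sum>i<?n. \<bar>a i\<bar> * N (y (h i) - u (h i)))"
          by (rule N_sum_scaleR)
        also have "\<dots> \<le> (\<Sum>i<?n. \<bar>a i\<bar> * (d / 2 * N (y (h i))))"
        proof (intro sum_mono mult_left_mono)
          show "N (y (h i) - u (h i)) \<le> d / 2 * N (y (h i))" for i
            using u(5)[of "h i"] N_minus[of "u (h i) - y (h i)"] by simp
        qed simp
        also have "\<dots> = d / 2 * S" by (simp add: S_def sum_distrib_left algebra_simps)
        finally have 2: "N (\<Sum>i<?n. a i *\<^sub>R (y (h i) - u (h i))) \<le> d / 2 * S" .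
        have "N (\<Sum>i<?n. a i *\<^sub>R y (h i)) \<le> N (\<Sum>i<?n. a i *\<^sub>R u (h i)) + N (\<Sum>i<?n. a i *\<^sub>R (y (h i) - u (h i)))"
          using N_add[of "\<Sum>i<?n. a i *\<^sub>R u (h i)" "\<Sum>i<?n. a i *\<^sub>R (y (h i) - u (h i))"]
          by (simp add: sum.distrib[symmetric] scaleR_right_diff_distrib)
        then have 3: "d / 2 * S \<le> N (\<Sum>i<?n. a i *\<^sub>R u (h i))" using 1 2 by (simp add: field_simps)
        have "(\<Sum>i<?n. \<bar>a i\<bar> * N (u (h i))) \<le> (\<Sum>i<?n. \<bar>a i\<bar> * (2 * N (y (h i))))"
        proof (intro sum_mono mult_left_mono)
          fix i
          have "N (u (h i)) \<le> N (y (h i)) + N (u (h i) - y (h i))"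
            using N_add[of "y (h i)" "u (h i) - y (h i)"] by simp
          also have "N (u (h i) - y (h i)) \<le> 1 * N (y (h i))"
            using u(5)[of "h i"] mult_right_mono[of "d / 2" 1 "N (y (h i))"] d by simp
          finally show "N (u (h i)) \<le> 2 * N (y (h i))" by simp
        qed simp
        also have "\<dots> = 2 * S" by (simp add: S_def sum_distrib_left algebra_simps)
        finally have "c * (\<Sum>i<?n. \<bar>a i\<bar> * N (u (h i))) \<le> d / 4 * (2 * S)"
          using d c by (intro mult_mono) (auto simp: S_def intro!: sum_nonneg)
        also have "d / 4 * (2 * S) = d / 2 * S" by simp
        also note 3
        finally have "c * (\<Sum>i<?n. \<bar>a i\<bar> * N (u (h i))) \<le> N (\<Sum>i<?n. a i *\<^sub>R u (h i))" .
        then show ?thesis by (simp add: len tn)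
      qed
      ultimately show ?thesis by (simp add: l1_tree_def)
    qed
    have "\<alpha> \<le> \<rho> (t {})"
    proof (rule schreier_rank[OF L, where m = 0 and \<rho> = "\<lambda>F. \<rho> (t F)"])
      fix F i assume F: "insert i F \<in> schreier L \<alpha>" "\<forall>j\<in>F. 0 \<le> j \<and> j < i"
      have "finite F" using schreier_finite[OF L F(1)] by simp
      then have ti: "t (insert i F) = t F @ [u (i - 1)]"
        using sorted_list_of_set_insert_greater[of F i] F(2) by (simp add: t_def)
      show "\<rho> (t (insert i F)) < \<rho> (t F)"
        using tT[OF F(1)] ti by (intro \<rho>) (auto simp: l1_tree_rel_def)
    qed
    then show ?thesis by (simp add: t_def)
  qed
  then show ?thesis by (intro exI[of _ "\<rho> []"]) (meson not_le)
qed

text \<open>Each constant 1/(n + 1) yields an ordinal beyond which \<open>delta\<close> is small.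
  These are countably many, so a single ordinal below \<open>\<omega>\<^sub>1\<close> exceeds them
  all.\<close>

lemma delta_eventually_0:
  assumes x: "basic_seq x" and no: "\<And>c y. 0 < c \<Longrightarrow> block_basis x y \<Longrightarrow> \<not> l1_lower c y"
  obtains \<beta> where "\<And>\<alpha> y. \<beta> \<le> \<alpha> \<Longrightarrow> block_basis x y \<Longrightarrow> delta L N \<alpha> y = 0"
proof -
  have "\<exists>\<beta>. \<forall>\<alpha> y. \<beta> < \<alpha> \<longrightarrow> block_basis x y \<longrightarrow> delta L N \<alpha> y < 4 * (1 / real (Suc n))" for n
    by (rule delta_small_rank[OF x]) (use no in simp_all)
  then obtain \<beta> where \<beta>: "\<And>n \<alpha> y. \<beta> n < \<alpha> \<Longrightarrow> block_basis x y \<Longrightarrow> delta L N \<alpha> y < 4 * (1 / real (Suc n))"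
    by metis
  obtain \<beta>' where \<beta>': "\<And>n. \<beta> n < \<beta>'"
    using countable_strict_bound_omega1[of "range \<beta>"] by auto
  have "delta L N \<alpha> y = 0" if "\<beta>' \<le> \<alpha>" "block_basis x y" for \<alpha> y
  proof (rule antisym[OF _ delta_nonneg[OF basic_seq_block[OF x that(2)]]])
    have "(\<lambda>n. 4 * inverse (real (Suc n))) \<longlonglongrightarrow> 4 * 0" by (intro tendsto_intros LIMSEQ_inverse_real_of_nat)
    moreover have "delta L N \<alpha> y \<le> 4 * inverse (real (Suc n))" for n
      using \<beta>[OF less_le_trans[OF \<beta>'[of n] that(1)] that(2)] by (simp add: divide_inverse)
    ultimately show "delta L N \<alpha> y \<le> 0" using LIMSEQ_le_const by (metis mult_zero_right)
  qed
  then show ?thesis using that by blast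
qed

text \<open>The indices are treated one at a time. Since \<open>delta\<close> increases along block
  bases, almost maximality for an earlier index persists when a further block basis is
  taken.\<close>

lemma delta_almost_max:
  assumes "basic_seq x" "finite B" "0 < \<tau>"
  shows "\<exists>y. block_basis x y \<and> (\<forall>\<alpha>\<in>B. \<forall>z. block_basis y z \<longrightarrow> delta L N \<alpha> z \<le> delta L N \<alpha> y + \<tau>)"
  using assms(2)
proof induction
  case empty
  then show ?case using block_basis_refl[OF assms(1)] by blast
next
  case (insert \<alpha> B)
  then obtain y where y: "block_basis x y"
    "\<And>\<beta> z. \<beta> \<in> B \<Longrightarrow> block_basis y z \<Longrightarrow> delta L N \<beta> z \<le> delta L N \<beta> y + \<tau>" by blast
  note by' = basic_seq_block[OF assms(1) y(1)]
  define D where "D = delta L N \<alpha> ` {z. block_basis y z}"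
  have bdd: "bdd_above D"
    using delta_le_1[OF basic_seq_block[OF by']] by (intro bdd_aboveI[of _ 1]) (auto simp: D_def)
  have "D \<noteq> {}" using block_basis_refl[OF by'] by (auto simp: D_def)
  then obtain d where "d \<in> D" "Sup D - \<tau> < d" using less_cSupD[of D "Sup D - \<tau>"] assms(3) by auto
  then obtain z where z: "block_basis y z" "Sup D - \<tau> < delta L N \<alpha> z" by (auto simp: D_def)
  have "delta L N \<alpha> w \<le> delta L N \<alpha> z + \<tau>" if "block_basis z w" for w
  proof -
    have "delta L N \<alpha> w \<le> Sup D"
      using block_basis_trans[OF by' z(1) that] by (intro cSup_upper[OF _ bdd]) (simp add: D_def)
    then show ?thesis using z by linarith
  qed
  moreover have "delta L N \<beta> w \<le> delta L N \<beta> z + \<tau>" if "\<beta> \<in> B" "block_basis z w" for \<beta> w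
    using y(2)[OF that(1) block_basis_trans[OF by' z(1) that(2)]] delta_block_mono[OF by' z(1), of \<beta>] by linarith
  ultimately show ?case using block_basis_trans[OF assms(1) y(1) z(1)] by blast
qed

lemma exists_stabilizing_block:
  assumes x: "basic_seq x"
  obtains w \<gamma> where "block_basis x w" "Delta_stabilizes L N w \<gamma>"
proof (cases "\<exists>c y. 0 < c \<and> block_basis x y \<and> l1_lower c y")
  case True
  then obtain c y where y: "0 < c" "block_basis x y" "l1_lower c y" by blast
  obtain w where "block_basis y w" "Delta_stabilizes L N w (\<lambda>_. 1)"
    using l1_lower_stabilizes[OF basic_seq_block[OF x y(2)] y(1,3)] by blast
  then show ?thesis using that block_basis_trans[OF x y(2)] by blast
next
  case False
  then obtain \<beta> where \<beta>: "\<And>\<alpha> y. \<beta> \<le> \<alpha> \<Longrightarrow> block_basis x y \<Longrightarrow> delta L N \<alpha> y = 0"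
    using delta_eventually_0[OF x] by metis
  \<comment> \<open>Inserting \<beta> makes the set nonempty, as the enumeration requires when
    \<beta> = 0.\<close>
  define \<alpha> where "\<alpha> = from_nat_into (insert \<beta> {..<\<beta>})"
  have \<alpha>: "\<exists>j. \<theta> = \<alpha> j" if "\<theta> < \<beta>" for \<theta>
    using from_nat_into_surj[of "insert \<beta> {..<\<beta>}" \<theta>] countable_lessThan_omega1[of \<beta>] that
    by (auto simp: \<alpha>_def)
  let ?Q = "\<lambda>n X X'. block_basis X X' \<and>
    (\<forall>\<theta>\<in>\<alpha> ` {..n}. \<forall>z. block_basis X' z \<longrightarrow> delta L N \<theta> z \<le> delta L N \<theta> X' + (1 / 2) ^ n)"
  have "\<exists>X. \<forall>n. block_basis x (X n) \<and> ?Q n (X n) (X (Suc n))"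
  proof (rule dependent_nat_choice)
    show "\<exists>X. block_basis x X" using block_basis_refl[OF x] by blast
    fix X n assume X: "block_basis x X"
    obtain X' where "?Q n X X'"
      using delta_almost_max[OF basic_seq_block[OF x X], of "\<alpha> ` {..n}" "(1 / 2) ^ n"] by auto
    then show "\<exists>X'. block_basis x X' \<and> ?Q n X X'" using block_basis_trans[OF x X] by blast
  qed
  then obtain X where X: "\<And>n. block_basis x (X n)" "\<And>n. block_basis (X n) (X (Suc n))"
    "\<And>n j z. j \<le> n \<Longrightarrow> block_basis (X (Suc n)) z \<Longrightarrow> delta L N (\<alpha> j) z \<le> delta L N (\<alpha> j) (X (Suc n)) + (1 / 2) ^ n"
    by auto
  have bX: "basic_seq (X n)" for n by (rule basic_seq_block[OF x X(1)])
  obtain w where w: "\<And>n. block_basis (X n) (\<lambda>i. w (n + i))"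
    using block_basis_diagonal[of X, OF bX X(2)] by blast
  have XX: "block_basis (X n) (X (n + k))" for n k
  proof (induction k)
    case (Suc k)
    show ?case using block_basis_trans[OF bX Suc X(2)] by simp
  qed (simp add: block_basis_refl[OF bX])
  define \<gamma> where "\<gamma> \<theta> = (SUP n. delta L N \<theta> (X n))" for \<theta>
  have bdd: "bdd_above (range (\<lambda>n. delta L N \<theta> (X n)))" for \<theta>
    using delta_le_1[OF bX] by (intro bdd_aboveI[of _ 1]) auto
  \<comment> \<open>For the j-th index and n > j, \<open>X n\<close> is maximal up to 2 (1/2)^n,
    because \<open>X (Suc n)\<close> was chosen with tolerance (1/2)^n. The factor 4 makes the
    inequality strict.\<close>
  have "\<exists>m. \<forall>n\<ge>m. \<forall>y. block_basis (\<lambda>i. w (n + i)) y \<longrightarrow> \<bar>delta L N \<theta> y - \<gamma> \<theta>\<bar> < 4 * (1 / 2) ^ n" for \<theta>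
  proof (cases "\<beta> \<le> \<theta>")
    case True
    then have "\<gamma> \<theta> = 0" by (simp add: \<gamma>_def \<beta>[OF True X(1)])
    moreover have "delta L N \<theta> y = 0" if "block_basis (\<lambda>i. w (n + i)) y" for n y
      using \<beta>[OF True block_basis_trans[OF x X(1) block_basis_trans[OF bX w that]]] .
    ultimately show ?thesis by simp
  next
    case False
    then obtain j where j: "\<theta> = \<alpha> j" using \<alpha> by (meson not_le)
    have "\<bar>delta L N \<theta> y - \<gamma> \<theta>\<bar> < 4 * (1 / 2) ^ n"
      if n: "Suc j \<le> n" and y: "block_basis (\<lambda>i. w (n + i)) y" for n y
    proof -
      obtain n' where n': "n = Suc n'" "j \<le> n'" using n by (cases n) simp_all
      let ?d = "delta L N \<theta> (X n)"
      have up: "delta L N \<theta> z \<le> ?d + (1 / 2) ^ n'" if "block_basis (X n) z" for z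
        using X(3)[OF n'(2)] that n' j by simp
      have "block_basis (X n) y" by (rule block_basis_trans[OF bX w y])
      then have 1: "?d \<le> delta L N \<theta> y" "delta L N \<theta> y \<le> ?d + (1 / 2) ^ n'"
        using delta_block_mono[OF bX] up by auto
      have 2: "?d \<le> \<gamma> \<theta>" unfolding \<gamma>_def by (rule cSUP_upper[OF UNIV_I bdd])
      have 3: "\<gamma> \<theta> \<le> ?d + (1 / 2) ^ n'"
        unfolding \<gamma>_def
      proof (rule cSUP_least)
        fix k
        show "delta L N \<theta> (X k) \<le> ?d + (1 / 2) ^ n'"
        proof (cases "n \<le> k")
          case True
          then show ?thesis using up XX[of n "k - n"] by simp
        next
          case False
          then have "block_basis (X k) (X n)" using XX[of k "n - k"] by simp
          then have "delta L N \<theta> (X k) \<le> ?d" by (rule delta_block_mono[OF bX])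
          then show ?thesis by (simp add: add_increasing2)
        qed
      qed simp
      have "(1 / 2 :: real) ^ n' < 4 * (1 / 2) ^ n" by (simp add: n')
      then show ?thesis using 1 2 3 by linarith
    qed
    then show ?thesis by blast
  qed
  moreover have "decseq (\<lambda>n. 4 * (1 / 2 :: real) ^ n)"
    by (auto simp: decseq_def intro!: power_decreasing)
  moreover have "(\<lambda>n. 4 * (1 / 2 :: real) ^ n) \<longlonglongrightarrow> 0"
    using tendsto_mult_right_zero[OF LIMSEQ_realpow_zero[of "1 / 2 :: real"], of 4] by simp
  ultimately have "Delta_stabilizes L N w \<gamma>" unfolding Delta_stabilizes_def by blast
  moreover have "block_basis x w" using block_basis_trans[OF x X(1)[of 0] w[of 0]] by simp
  ultimately show ?thesis using that by blast
qed

lemma stabilizes_one_l1_lower: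
  assumes x: "basic_seq x" and y: "block_basis x y" "Delta_stabilizes L N y \<gamma>" and 1: "\<gamma> 1 = 1"
  shows "\<exists>c z. 0 < c \<and> block_basis x z \<and> l1_lower c z"
proof (rule ccontr)
  assume "\<not> ?thesis"
  then obtain \<beta> where \<beta>: "\<And>\<alpha> z. \<beta> \<le> \<alpha> \<Longrightarrow> block_basis x z \<Longrightarrow> delta L N \<alpha> z = 0"
    using delta_eventually_0[OF x] by metis
  note by' = basic_seq_block[OF x y(1)]
  have "\<gamma> \<beta> \<le> 0"
  proof (rule stabilizes_le[OF by' y(2)])
    fix n z assume z: "block_basis (\<lambda>i. y (n + i)) z"
    have "block_basis x z"
      by (rule block_basis_trans[OF x y(1) block_basis_trans[OF by' block_basis_tail[OF by'] z]])
    then show "delta L N \<beta> z \<le> 0" using \<beta> by simp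
  qed
  then show False using stabilizes_one[OF by' y(2) 1] by simp
qed

end

section \<open>The basis constant\<close>

context
  fixes e :: "nat \<Rightarrow> 'a::banach"
  assumes e: "basis_of UNIV e"
begin

lemma basis_coeffs_unique: "(\<lambda>i. a i *\<^sub>R e i) sums v \<Longrightarrow> coeffs e v = a"
  and basis_coeffs_sums: "(\<lambda>i. coeffs e v i *\<^sub>R e i) sums v"
proof -
  have ex1: "\<exists>!a. (\<lambda>i. a i *\<^sub>R e i) sums v" for v using e by (simp add: basis_of_def)
  from theI'[OF ex1[of v]] show s: "(\<lambda>i. coeffs e v i *\<^sub>R e i) sums v" by (simp add: coeffs_def)
  show "coeffs e v = a" if "(\<lambda>i. a i *\<^sub>R e i) sums v"
    using ex1[of v] s that by blast
qed

lemma basis_coeffs_add: "coeffs e (u + v) i = coeffs e u i + coeffs e v i"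
proof -
  have "(\<lambda>i. (coeffs e u i + coeffs e v i) *\<^sub>R e i) sums (u + v)"
    using sums_add[OF basis_coeffs_sums[of u] basis_coeffs_sums[of v]] by (simp add: scaleR_left_distrib)
  from basis_coeffs_unique[OF this] show ?thesis by simp
qed

lemma basis_coeffs_scaleR: "coeffs e (r *\<^sub>R v) i = r * coeffs e v i"
proof -
  have "(\<lambda>i. (r * coeffs e v i) *\<^sub>R e i) sums (r *\<^sub>R v)"
    using sums_scaleR_right[OF basis_coeffs_sums[of v], of r] by simp
  from basis_coeffs_unique[OF this] show ?thesis by simp
qed

lemma basis_nonzero: "e i \<noteq> 0"
proof
  assume "e i = 0"
  then have "(\<lambda>j. (if j = i then 1 else 0) *\<^sub>R e j) = (\<lambda>j. 0)" by auto
  then have "coeffs e 0 = (\<lambda>j. if j = i then 1 else 0)"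
    by (intro basis_coeffs_unique) simp
  moreover have "coeffs e 0 = (\<lambda>j. 0)" by (intro basis_coeffs_unique) simp
  ultimately show False by (metis one_neq_zero)
qed

definition partial_sum :: "nat \<Rightarrow> 'a \<Rightarrow> 'a" where
  "partial_sum n v = (\<Sum>j<n. coeffs e v j *\<^sub>R e j)"

lemma partial_sum_tendsto: "(\<lambda>n. partial_sum n v) \<longlonglongrightarrow> v"
  using basis_coeffs_sums[of v] by (simp add: sums_def partial_sum_def)

lemma partial_sum_add: "partial_sum n (u + v) = partial_sum n u + partial_sum n v"
  by (simp add: partial_sum_def basis_coeffs_add scaleR_left_distrib sum.distrib)

lemma partial_sum_scaleR: "partial_sum n (r *\<^sub>R v) = r *\<^sub>R partial_sum n v"
  by (simp add: partial_sum_def basis_coeffs_scaleR scaleR_sum_right)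

lemma partial_sum_diff: "partial_sum n (u - v) = partial_sum n u - partial_sum n v"
  using partial_sum_add[of n u "- 1 *\<^sub>R v"] partial_sum_scaleR[of n "- 1" v] by simp

text \<open>The Baire category step in the classical proof that the partial sum operators of a basis are
  uniformly bounded.\<close>

lemma partial_sum_approx:
  obtains M where "0 < M"
    "\<And>u \<delta>. 0 < \<delta> \<Longrightarrow> \<exists>a. norm (u - a) < \<delta> \<and> (\<forall>n. norm (partial_sum n a) \<le> M * norm u)"
proof -
  define A where "A m = {v. \<forall>n. norm (partial_sum n v) \<le> real m}" for m
  have "\<exists>m. v \<in> A m" for v
  proof -
    obtain B where B: "\<And>n. norm (partial_sum n v) \<le> B"
      using convergent_imp_Bseq[OF convergentI[OF partial_sum_tendsto[of v]]] by (auto simp: Bseq_def)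
    obtain m where "B \<le> real m" using real_arch_simple by blast
    then show ?thesis using B by (intro exI[of _ m]) (auto simp: A_def intro: order_trans)
  qed
  then have un: "\<Union>(range (\<lambda>m. closure (A m))) = UNIV" using closure_subset by blast
  have "\<exists>m. interior (closure (A m)) \<noteq> {}"
  proof (rule ccontr)
    assume "\<not> ?thesis"
    then have "Met_TC.mtopology interior_of \<Union>(range (\<lambda>m. closure (A m))) = {}"
      by (intro Met_TC.metric_Baire_category_alt) (auto simp: complete_UNIV)
    then show False unfolding un by simp
  qed
  then obtain m v0 where "v0 \<in> interior (closure (A m))" by blast
  then obtain r where r: "0 < r" "ball v0 r \<subseteq> closure (A m)"
    using mem_interior by blast
  have near: "\<exists>a. norm (u - a) < \<delta> \<and> (\<forall>n. norm (partial_sum n a) \<le> 2 * real m)"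
    if u: "norm u < r" and \<delta>: "0 < \<delta>" for u \<delta>
  proof -
    have "v0 + u \<in> closure (A m)" "v0 \<in> closure (A m)" using r u by (auto simp: dist_norm subset_iff)
    then obtain a b where ab: "a \<in> A m" "dist a (v0 + u) < \<delta> / 2" "b \<in> A m" "dist b v0 < \<delta> / 2"
      using \<delta> unfolding closure_approachable by (meson half_gt_zero)
    have "u - (a - b) = (v0 + u - a) - (v0 - b)" by simp
    then have "norm (u - (a - b)) \<le> norm (v0 + u - a) + norm (v0 - b)" using norm_triangle_ineq4 by metis
    also have "\<dots> < \<delta>" using ab by (simp add: dist_norm norm_minus_commute)
    finally have "norm (u - (a - b)) < \<delta>" .
    moreover have "norm (partial_sum n (a - b)) \<le> 2 * real m" for n
    proof -
      have "norm (partial_sum n (a - b)) \<le> norm (partial_sum n a) + norm (partial_sum n b)"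
        unfolding partial_sum_diff by (rule norm_triangle_ineq4)
      also have "\<dots> \<le> real m + real m" using ab by (intro add_mono) (auto simp: A_def)
      finally show ?thesis by simp
    qed
    ultimately show ?thesis by blast
  qed
  \<comment> \<open>The factor 2/r comes from rescaling u into the ball of radius r; the summand 1
    keeps \<open>M\<close> positive when m = 0.\<close>
  define M where "M = (2 * real m + 1) * (2 / r)"
  have M: "0 < M" using r(1) by (simp add: M_def)
  have "\<exists>a. norm (u - a) < \<delta> \<and> (\<forall>n. norm (partial_sum n a) \<le> M * norm u)" if \<delta>: "0 < \<delta>" for u \<delta>
  proof (cases "u = 0")
    case True
    have "partial_sum n 0 = 0" for n using partial_sum_diff[of n 0 0] by simp
    then show ?thesis using True \<delta> by (intro exI[of _ 0]) simp
  next
    case False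
    define t where "t = r / (2 * norm u)"
    have t: "0 < t" using False r(1) by (simp add: t_def)
    have "norm (t *\<^sub>R u) < r" using False r(1) by (simp add: t_def)
    moreover have "0 < t * \<delta>" using t \<delta> by simp
    ultimately obtain a where a: "norm (t *\<^sub>R u - a) < t * \<delta>" "\<And>n. norm (partial_sum n a) \<le> 2 * real m"
      using near by blast
    have "u - a /\<^sub>R t = (t *\<^sub>R u - a) /\<^sub>R t" using t by (simp add: scaleR_right_diff_distrib)
    then have "norm (u - a /\<^sub>R t) = norm (t *\<^sub>R u - a) / t" using t by (simp add: divide_inverse)
    also have "\<dots> < \<delta>" using a(1) t by (simp add: pos_divide_less_eq mult.commute)
    finally have "norm (u - a /\<^sub>R t) < \<delta>" .
    moreover have "norm (partial_sum n (a /\<^sub>R t)) \<le> M * norm u" for n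
    proof -
      have "norm (partial_sum n (a /\<^sub>R t)) = norm (partial_sum n a) * inverse t"
        using t by (simp add: partial_sum_scaleR)
      also have "\<dots> \<le> (2 * real m + 1) * inverse t"
        using a(2)[of n] t by (intro mult_right_mono) auto
      also have "\<dots> = M * norm u" using r(1) by (simp add: M_def t_def field_simps)
      finally show ?thesis .
    qed
    ultimately show ?thesis by blast
  qed
  then show ?thesis using that M by blast
qed

text \<open>As in the open mapping theorem, v is written as a series of vectors \<open>a k\<close>
  whose partial sums are bounded by a geometric sequence. Continuity of the coefficient functionals
  is not yet available, so the coefficients of the \<open>a k\<close> are summed to
  \<open>b\<close>, the series with coefficients \<open>b\<close> is shown to converge to v, and
  uniqueness of expansions identifies \<open>b\<close> with the coefficients of v. The partial sums
  of v are then dominated by a geometric series.\<close>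

lemma partial_sum_bounded:
  obtains K where "\<And>n v. norm (partial_sum n v) \<le> K * norm v"
proof -
  obtain M where M: "0 < M"
    "\<And>u \<delta>. 0 < \<delta> \<Longrightarrow> \<exists>a. norm (u - a) < \<delta> \<and> (\<forall>n. norm (partial_sum n a) \<le> M * norm u)"
    using partial_sum_approx by blast
  have "norm (partial_sum n v) \<le> 2 * M * norm v" for n v
  proof (cases "v = 0")
    case True
    then show ?thesis using partial_sum_diff[of n 0 0] by simp
  next
    case False
    let ?P = "\<lambda>k r. (k = 0 \<longrightarrow> r = v) \<and> norm r \<le> norm v * (1 / 2) ^ k"
    let ?Q = "\<lambda>k r r'. \<forall>n. norm (partial_sum n (r - r')) \<le> M * norm r"
    have "\<exists>r. \<forall>k. ?P k (r k) \<and> ?Q k (r k) (r (Suc k))"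
    proof (rule dependent_nat_choice)
      show "\<exists>r. ?P 0 r" by auto
      fix u k assume "?P k u"
      have "0 < norm v * (1 / 2) ^ Suc k" using False by simp
      from M(2)[OF this, of u] obtain a where
        "norm (u - a) < norm v * (1 / 2) ^ Suc k" "\<forall>n. norm (partial_sum n a) \<le> M * norm u" by blast
      then show "\<exists>u'. ?P (Suc k) u' \<and> ?Q k u u'" by (intro exI[of _ "u - a"]) auto
    qed
    then obtain r where r: "r 0 = v" "\<And>k. norm (r k) \<le> norm v * (1 / 2) ^ k"
      "\<And>k n. norm (partial_sum n (r k - r (Suc k))) \<le> M * norm (r k)" by blast
    define a where "a k = r k - r (Suc k)" for k
    define B where "B = M * norm v"
    have B: "0 \<le> B" using M(1) by (simp add: B_def)
    have Pa: "norm (partial_sum n (a k)) \<le> B * (1 / 2) ^ k" for n k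
      unfolding a_def B_def mult.assoc
      by (rule order_trans[OF r(3) mult_left_mono[OF r(2) less_imp_le[OF M(1)]]])
    have geo: "(\<lambda>k. B * (1 / 2) ^ k) sums (2 * B)"
      using sums_mult[OF geometric_sums[of "1 / 2 :: real"], of B] by (simp add: mult.commute)
    have sumP: "summable (\<lambda>k. partial_sum n (a k))" for n
      by (rule summable_comparison_test'[OF sums_summable[OF geo]]) (rule Pa)
    define b where "b j = (\<Sum>k. coeffs e (a k) j)" for j
    have sumc: "summable (\<lambda>k. coeffs e (a k) j)" for j
    proof (rule summable_comparison_test'[OF summable_mult[OF sums_summable[OF geo], of "2 / norm (e j)"]])
      fix k
      have "coeffs e (a k) j *\<^sub>R e j = partial_sum (Suc j) (a k) - partial_sum j (a k)"
        by (simp add: partial_sum_def)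
      then have "\<bar>coeffs e (a k) j\<bar> * norm (e j) \<le> norm (partial_sum (Suc j) (a k)) + norm (partial_sum j (a k))"
        using norm_triangle_ineq4 by (metis norm_scaleR)
      also have "\<dots> \<le> 2 * (B * (1 / 2) ^ k)" using Pa[of "Suc j" k] Pa[of j k] by simp
      finally show "norm (coeffs e (a k) j) \<le> 2 / norm (e j) * (B * (1 / 2) ^ k)"
        using basis_nonzero[of j] by (simp add: field_simps)
    qed
    have W: "(\<Sum>j<n. b j *\<^sub>R e j) = (\<Sum>k. partial_sum n (a k))" for n
    proof -
      have "(\<lambda>k. \<Sum>j<n. coeffs e (a k) j *\<^sub>R e j) sums (\<Sum>j<n. b j *\<^sub>R e j)"
        unfolding b_def by (intro sums_sum sums_scaleR_left summable_sums sumc)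
      then show ?thesis by (simp add: partial_sum_def sums_iff)
    qed
    have suma: "(\<Sum>k<K. a k) = v - r K" for K
      by (induction K) (simp_all add: a_def r(1))
    have "(\<lambda>n. \<Sum>j<n. b j *\<^sub>R e j) \<longlonglongrightarrow> v"
    proof (rule metric_LIMSEQ_I)
      fix \<eta> :: real assume \<eta>: "0 < \<eta>"
      \<comment> \<open>This collects the tail of the geometric series and the remainder
        \<open>r K\<close>, both of which decay like (1/2)^K.\<close>
      define C where "C = 2 * B + norm v"
      have "(\<lambda>K. C * (1 / 2) ^ K) \<longlonglongrightarrow> 0"
        using tendsto_mult_right_zero[OF LIMSEQ_realpow_zero[of "1 / 2 :: real"], of C] by simp
      then obtain K where K: "C * (1 / 2) ^ K < \<eta> / 2"
        using order_tendstoD(2)[of _ 0 sequentially "\<eta> / 2"] \<eta>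
        by (metis (mono_tags, lifting) eventually_sequentially half_gt_zero order_refl)
      have lim: "(\<lambda>n. \<Sum>k<K. partial_sum n (a k)) \<longlonglongrightarrow> (\<Sum>k<K. a k)"
        by (intro tendsto_sum partial_sum_tendsto)
      have "0 < \<eta> / 2" using \<eta> by simp
      from LIMSEQ_D[OF lim this] obtain n0 where n0: "\<And>n. n0 \<le> n \<Longrightarrow> norm ((\<Sum>k<K. partial_sum n (a k)) - (\<Sum>k<K. a k)) < \<eta> / 2"
        by blast
      have "dist (\<Sum>j<n. b j *\<^sub>R e j) v < \<eta>" if "n0 \<le> n" for n
      proof -
        let ?S = "\<Sum>k<K. partial_sum n (a k)" and ?T = "\<Sum>k. partial_sum n (a (k + K))"
        have tail: "norm ?T \<le> 2 * B * (1 / 2) ^ K"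
        proof (rule norm_suminf_le[THEN order_trans])
          have g: "(\<lambda>k. B * (1 / 2) ^ (k + K)) sums (2 * B * (1 / 2) ^ K)"
            using sums_mult2[OF geo, of "(1 / 2) ^ K"] by (simp add: power_add mult.assoc)
          then show "summable (\<lambda>k. B * (1 / 2) ^ (k + K))" by (rule sums_summable)
          show "(\<Sum>k. B * (1 / 2) ^ (k + K)) \<le> 2 * B * (1 / 2) ^ K" using g by (simp add: sums_iff)
        qed (rule Pa)
        have "(\<Sum>j<n. b j *\<^sub>R e j) = ?T + ?S"
          unfolding W by (rule suminf_split_initial_segment[OF sumP])
        then have "(\<Sum>j<n. b j *\<^sub>R e j) - v = ?T + ((?S - (\<Sum>k<K. a k)) - r K)"
          by (simp add: suma)
        then have "norm ((\<Sum>j<n. b j *\<^sub>R e j) - v) \<le> norm ?T + (norm (?S - (\<Sum>k<K. a k)) + norm (r K))"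
          by (simp only:) (rule order_trans[OF norm_triangle_ineq add_left_mono[OF norm_triangle_ineq4]])
        also have "\<dots> < 2 * B * (1 / 2) ^ K + (\<eta> / 2 + norm v * (1 / 2) ^ K)"
          using tail n0[OF that] r(2)[of K] by linarith
        also have "\<dots> = C * (1 / 2) ^ K + \<eta> / 2" by (simp add: C_def algebra_simps)
        also have "\<dots> < \<eta>" using K by simp
        finally show ?thesis by (simp add: dist_norm)
      qed
      then show "\<exists>n0. \<forall>n\<ge>n0. dist (\<Sum>j<n. b j *\<^sub>R e j) v < \<eta>" by blast
    qed
    then have "coeffs e v = b" by (intro basis_coeffs_unique) (simp add: sums_def)
    then have "partial_sum n v = (\<Sum>k. partial_sum n (a k))" using W[of n] by (simp add: partial_sum_def)
    also have "norm \<dots> \<le> (\<Sum>k. B * (1 / 2) ^ k)"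
      by (rule norm_suminf_le[OF Pa sums_summable[OF geo]])
    also have "\<dots> = 2 * M * norm v" using geo by (simp add: sums_iff B_def)
    finally show ?thesis .
  qed
  then show ?thesis using that by blast
qed

lemma basic_seq_basis: "basic_seq e"
proof -
  obtain K where K: "\<And>n v. norm (partial_sum n v) \<le> K * norm v" using partial_sum_bounded by blast
  have "norm (\<Sum>j<n. a j *\<^sub>R e j) \<le> K * norm (\<Sum>j<m. a j *\<^sub>R e j)" if "n \<le> m" for a n m
  proof -
    let ?v = "\<Sum>j<m. a j *\<^sub>R e j"
    have "(\<lambda>j. (if j \<in> {..<m} then a j else 0) *\<^sub>R e j) sums ?v"
      using sums_If_finite_set[of "{..<m}" "\<lambda>j. a j *\<^sub>R e j"]
      by (simp add: if_distrib[of "\<lambda>r. r *\<^sub>R _"] cong: if_cong)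
    from basis_coeffs_unique[OF this] have "partial_sum n ?v = (\<Sum>j<n. a j *\<^sub>R e j)"
      unfolding partial_sum_def using that by (intro sum.cong) auto
    then show ?thesis using K[of n ?v] by simp
  qed
  then show ?thesis unfolding basic_seq_def using basis_nonzero by blast
qed

end

section \<open>Copies of \<open>\<ell>\<^sub>1\<close>\<close>

lemma finite_support_in_ell1: "finite {i. b i \<noteq> 0} \<Longrightarrow> b \<in> ell1"
  unfolding ell1_def by (intro CollectI summable_finite[of "{i. b i \<noteq> 0}"]) auto

lemma suminf_abs_finite_support: "finite {i. b i \<noteq> 0} \<Longrightarrow> (\<Sum>i. \<bar>b i :: real\<bar>) = (\<Sum>i | b i \<noteq> 0. \<bar>b i\<bar>)"
  by (rule suminf_finite) auto

lemma suminf_abs_disjoint: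
  assumes "a \<in> ell1" "b \<in> ell1" "\<And>i. a i = 0 \<or> b i = 0"
  shows "(\<Sum>i. \<bar>a i + b i\<bar>) = (\<Sum>i. \<bar>a i\<bar>) + (\<Sum>i. \<bar>b i\<bar>)"
proof -
  have "\<bar>a i + b i\<bar> = \<bar>a i\<bar> + \<bar>b i\<bar>" for i using assms(3)[of i] by auto
  then show ?thesis using suminf_add[of "\<lambda>i. \<bar>a i\<bar>" "\<lambda>i. \<bar>b i\<bar>"] assms by (simp add: ell1_def)
qed

locale ell1_embedding =
  fixes e :: "nat \<Rightarrow> 'a::banach" and T :: "(nat \<Rightarrow> real) \<Rightarrow> 'a" and c C :: real
  assumes e: "basis_of UNIV e"
    and T_add: "\<And>a b. a \<in> ell1 \<Longrightarrow> b \<in> ell1 \<Longrightarrow> T (\<lambda>i. a i + b i) = T a + T b"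
    and T_scale: "\<And>r a. a \<in> ell1 \<Longrightarrow> T (\<lambda>i. r * a i) = r *\<^sub>R T a"
    and c: "0 < c"
    and T_lower: "\<And>a. a \<in> ell1 \<Longrightarrow> c * (\<Sum>i. \<bar>a i\<bar>) \<le> norm (T a)"
    and T_upper: "\<And>a. a \<in> ell1 \<Longrightarrow> norm (T a) \<le> C * (\<Sum>i. \<bar>a i\<bar>)"
begin

text \<open>Two such sequences for n with disjoint supports have a combination whose coordinate n
  vanishes too; disjointness of the supports keeps it nonzero. The free bound M supplies the second
  sequence beyond the support of the first.\<close>

lemma finite_support_kill:
  "\<exists>b. (\<forall>i<M. b i = 0) \<and> finite {i. b i \<noteq> 0} \<and> (\<exists>i. b i \<noteq> 0) \<and> (\<forall>j<n. coeffs e (T b) j = 0)"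
proof (induction n arbitrary: M)
  case 0
  show ?case by (rule exI[of _ "\<lambda>i. if i = M then 1 else 0"]) auto
next
  case (Suc n)
  obtain b where b: "\<forall>i<M. b i = 0" "finite {i. b i \<noteq> 0}" "\<exists>i. b i \<noteq> 0" "\<forall>j<n. coeffs e (T b) j = 0"
    using Suc[of M] by blast
  obtain M' where M': "{i. b i \<noteq> 0} \<subseteq> {..<M'}" using finite_nat_iff_bounded b(2) by blast
  obtain b' where b': "\<forall>i<max M M'. b' i = 0" "finite {i. b' i \<noteq> 0}" "\<exists>i. b' i \<noteq> 0" "\<forall>j<n. coeffs e (T b') j = 0"
    using Suc[of "max M M'"] by blast
  define s where "s = coeffs e (T b') n"
  define t where "t = coeffs e (T b) n"
  show ?case
  proof (cases "t = 0")
    case True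
    then show ?thesis using b by (intro exI[of _ b]) (auto simp: t_def less_Suc_eq)
  next
    case False
    define d where "d = (\<lambda>i. s * b i + - t * b' i)"
    have ell: "b \<in> ell1" "b' \<in> ell1" using finite_support_in_ell1 b(2) b'(2) by auto
    have fin: "finite {i. r * b i \<noteq> 0}" "finite {i. r * b' i \<noteq> 0}" for r
      by (auto intro: finite_subset[OF _ b(2)] finite_subset[OF _ b'(2)])
    have "T d = T (\<lambda>i. s * b i) + T (\<lambda>i. - t * b' i)"
      unfolding d_def by (rule T_add) (rule finite_support_in_ell1[OF fin(1)], rule finite_support_in_ell1[OF fin(2)])
    also have "\<dots> = s *\<^sub>R T b + (- t) *\<^sub>R T b'" by (simp only: T_scale[OF ell(1)] T_scale[OF ell(2)])
    finally have Td: "coeffs e (T d) j = s * coeffs e (T b) j + - t * coeffs e (T b') j" for j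
      by (simp only: basis_coeffs_add[OF e] basis_coeffs_scaleR[OF e])
    obtain i where i: "b' i \<noteq> 0" using b'(3) by blast
    have "b i = 0" using i b'(1) M' by force
    then have "d i \<noteq> 0" using i False by (simp add: d_def)
    moreover have "finite {i. d i \<noteq> 0}"
      by (rule finite_subset[OF _ finite_UnI[OF b(2) b'(2)]]) (auto simp: d_def)
    moreover have "\<forall>j<Suc n. coeffs e (T d) j = 0"
      using b(4) b'(4) by (auto simp: Td less_Suc_eq s_def t_def)
    moreover have "\<forall>i<M. d i = 0" using b(1) b'(1) by (simp add: d_def)
    ultimately show ?thesis by (intro exI[of _ d]) blast
  qed
qed

text \<open>One step of a gliding hump. The coordinates of \<open>T b\<close> before p are
  annihilated, so cutting off its expansion at a late q leaves a block. The tolerance c/2 is half of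
  the lower bound c, so half of the estimate survives the perturbation.\<close>

lemma ell1_block_step:
  "\<exists>b h q. (\<forall>i<l. b i = 0) \<and> (\<forall>i\<ge>h. b i = 0) \<and> (\<Sum>i. \<bar>b i\<bar>) = 1 \<and> p < q \<and>
     norm (T b - (\<Sum>j\<in>{p..<q}. coeffs e (T b) j *\<^sub>R e j)) \<le> c / 2"
proof -
  obtain b where b: "\<forall>i<l. b i = 0" "finite {i. b i \<noteq> 0}" "\<exists>i. b i \<noteq> 0" "\<forall>j<p. coeffs e (T b) j = 0"
    using finite_support_kill by blast
  define s where "s = (\<Sum>i. \<bar>b i\<bar>)"
  have s: "0 < s"
  proof -
    obtain i where "b i \<noteq> 0" using b(3) by blast
    then show ?thesis unfolding s_def suminf_abs_finite_support[OF b(2)] using b(2) by (intro sum_pos2[of _ i]) auto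
  qed
  have ell: "b \<in> ell1" by (rule finite_support_in_ell1[OF b(2)])
  define d where "d i = (1 / s) * b i" for i
  have Td: "T d = (1 / s) *\<^sub>R T b" using T_scale[OF ell, of "1 / s"] by (simp add: d_def[abs_def])
  have "(\<Sum>i. \<bar>d i\<bar>) = (\<Sum>i. (1 / s) * \<bar>b i\<bar>)" using s by (simp add: d_def abs_mult)
  also have "\<dots> = 1" using suminf_mult[of "\<lambda>i. \<bar>b i\<bar>" "1 / s"] ell s by (simp add: ell1_def s_def)
  finally have 1: "(\<Sum>i. \<bar>d i\<bar>) = 1" .
  obtain h where h: "{i. b i \<noteq> 0} \<subseteq> {..<h}" using finite_nat_iff_bounded b(2) by blast
  have lim: "(\<lambda>n. \<Sum>j<n. coeffs e (T d) j *\<^sub>R e j) \<longlonglongrightarrow> T d"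
    using basis_coeffs_sums[OF e, of "T d"] by (simp add: sums_def)
  have "0 < c / 2" using c by simp
  from LIMSEQ_D[OF lim this]
  obtain q where q: "\<And>n. q \<le> n \<Longrightarrow> norm ((\<Sum>j<n. coeffs e (T d) j *\<^sub>R e j) - T d) < c / 2"
    by blast
  let ?q = "max q (Suc p)"
  have "(\<Sum>j<?q. coeffs e (T d) j *\<^sub>R e j) = (\<Sum>j\<in>{p..<?q}. coeffs e (T d) j *\<^sub>R e j)"
    by (rule sum.mono_neutral_right) (use b(4) in \<open>auto simp: Td basis_coeffs_scaleR[OF e]\<close>)
  then have "norm (T d - (\<Sum>j\<in>{p..<?q}. coeffs e (T d) j *\<^sub>R e j)) \<le> c / 2"
    using q[of ?q] by (simp add: norm_minus_commute)
  moreover have "\<forall>i<l. d i = 0" "\<forall>i\<ge>h. d i = 0" using b(1) h by (auto simp: d_def subset_iff)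
  ultimately show ?thesis using 1 by (intro exI[of _ d] exI[of _ h] exI[of _ ?q]) auto
qed

lemma exists_ell1_block:
  "\<exists>u c'. 0 < c' \<and> block_basis e u \<and>
     (\<forall>n a. c' * (\<Sum>i<n. \<bar>a i\<bar> * norm (u i)) \<le> norm (\<Sum>i<n. a i *\<^sub>R u i))"
proof -
  define R where "R l p b h q \<longleftrightarrow> (\<forall>i<l. b i = 0) \<and> (\<forall>i\<ge>h. b i = 0) \<and> (\<Sum>i. \<bar>b i\<bar>) = 1 \<and> p < q \<and>
     norm (T b - (\<Sum>j\<in>{p..<q}. coeffs e (T b) j *\<^sub>R e j)) \<le> c / 2" for l p b h q
  have "\<exists>b h q. R l p b h q" for l p unfolding R_def by (rule ell1_block_step)
  then obtain B H Q where "\<And>l p. R l p (B l p) (H l p) (Q l p)" by metis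
  then have BHQ: "\<And>l p i. i < l \<Longrightarrow> B l p i = 0" "\<And>l p i. H l p \<le> i \<Longrightarrow> B l p i = 0"
    "\<And>l p. (\<Sum>i. \<bar>B l p i\<bar>) = 1" "\<And>l p. p < Q l p"
    "\<And>l p. norm (T (B l p) - (\<Sum>j\<in>{p..<Q l p}. coeffs e (T (B l p)) j *\<^sub>R e j)) \<le> c / 2"
    unfolding R_def by blast+
  \<comment> \<open>The state consists of the first free coordinate in \<open>\<ell>\<^sub>1\<close>
    and the first free position in the basis.\<close>
  define f where "f = rec_nat (0, 0) (\<lambda>_ (l, p). (max l (H l p), Q l p))"
  define l where "l k = fst (f k)" for k
  define p where "p k = snd (f k)" for k
  define b where "b k = B (l k) (p k)" for k
  have lS: "l (Suc k) = max (l k) (H (l k) (p k))" and pS: "p (Suc k) = Q (l k) (p k)" for k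
    by (simp_all add: l_def p_def f_def split_beta)
  have b0: "b k i = 0" if "i < l k \<or> l (Suc k) \<le> i" for k i
    using that BHQ(1,2) by (auto simp: b_def lS)
  have l_mono: "l k \<le> l m" if "k \<le> m" for k m
    using that by (rule lift_Suc_mono_le[rotated]) (simp add: lS)
  have bfin: "finite {i. b k i \<noteq> 0}" for k
    by (rule finite_subset[of _ "{..<l (Suc k)}"]) (use b0 not_le in auto)
  have bell: "b k \<in> ell1" for k by (rule finite_support_in_ell1[OF bfin])
  have b1: "(\<Sum>i. \<bar>b k i\<bar>) = 1" for k by (simp add: b_def BHQ)
  have p: "strict_mono p" by (rule strict_monoI_Suc) (simp add: pS BHQ)
  define u where "u k = (\<Sum>j\<in>{p k..<p (Suc k)}. coeffs e (T (b k)) j *\<^sub>R e j)" for k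
  have Tu: "norm (T (b k) - u k) \<le> c / 2" for k
    using BHQ(5)[of "l k" "p k"] by (simp add: u_def b_def pS)
  have Tb: "c \<le> norm (T (b k))" "norm (T (b k)) \<le> C" for k
    using T_lower[OF bell] T_upper[OF bell] by (simp_all add: b1)
  have u0: "u k \<noteq> 0" for k using Tu[of k] Tb(1)[of k] c by auto
  have u_le: "norm (u k) \<le> C + c / 2" for k
    using norm_triangle_ineq4[of "T (b k)" "T (b k) - u k"] Tu[of k] Tb(2)[of k] by simp
  have "\<exists>a. \<forall>i. u i = (\<Sum>j\<in>{p i..<p (Suc i)}. a j *\<^sub>R e j)"
  proof (intro exI allI)
    fix i
    show "u i = (\<Sum>j\<in>{p i..<p (Suc i)}. coeffs e (T (b (LEAST i. j < p (Suc i)))) j *\<^sub>R e j)"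
      unfolding u_def by (rule sum.cong) (auto simp: Least_block_index[OF p])
  qed
  then have block: "block_basis e u" unfolding block_on_def using p u0 by blast
  \<comment> \<open>The \<open>b k\<close> have disjoint supports and norm 1, so the
    \<open>\<ell>\<^sub>1\<close>-norm of this combination is the sum of the absolute values of its
    coefficients.\<close>
  define d where "d a n i = (\<Sum>k<n. a k * b k i)" for a :: "nat \<Rightarrow> real" and n i
  have d: "d a n \<in> ell1 \<and> T (d a n) = (\<Sum>k<n. a k *\<^sub>R T (b k)) \<and> (\<Sum>i. \<bar>d a n i\<bar>) = (\<Sum>k<n. \<bar>a k\<bar>) \<and>
      (\<forall>i\<ge>l n. d a n i = 0)" for a n
  proof (induction n)
    case 0
    have z: "(\<lambda>i. 0) \<in> ell1" by (simp add: ell1_def)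
    show ?case using z T_scale[OF z, of 0] by (simp add: d_def[abs_def])
  next
    case (Suc n)
    have ab: "(\<lambda>i. a n * b n i) \<in> ell1"
      by (rule finite_support_in_ell1, rule finite_subset[OF _ bfin[of n]]) auto
    have dS: "d a (Suc n) = (\<lambda>i. d a n i + a n * b n i)" by (auto simp: d_def)
    have dz: "d a n i = 0 \<or> a n * b n i = 0" for i using Suc b0[of i n] by (cases "l n \<le> i") auto
    have z: "d a (Suc n) i = 0" if "l (Suc n) \<le> i" for i
    proof -
      have "d a n i = 0" using Suc order_trans[OF l_mono[of n "Suc n"] that] by simp
      moreover have "b n i = 0" using b0 that by blast
      ultimately show ?thesis by (simp add: dS)
    qed
    have fd: "finite {i. d a (Suc n) i \<noteq> 0}"
    proof (rule finite_subset)
      show "{i. d a (Suc n) i \<noteq> 0} \<subseteq> {..<l (Suc n)}" using z by (auto simp: not_le[symmetric])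
    qed simp
    have "(\<Sum>i. \<bar>a n * b n i\<bar>) = \<bar>a n\<bar>"
      using suminf_mult[of "\<lambda>i. \<bar>b n i\<bar>" "\<bar>a n\<bar>"] bell[of n] by (simp add: abs_mult ell1_def b1)
    then have "(\<Sum>i. \<bar>d a (Suc n) i\<bar>) = (\<Sum>k<Suc n. \<bar>a k\<bar>)"
      unfolding dS using suminf_abs_disjoint[OF _ ab dz] Suc by simp
    moreover have "T (d a (Suc n)) = (\<Sum>k<Suc n. a k *\<^sub>R T (b k))"
      unfolding dS using T_add[OF _ ab, of "d a n"] T_scale[OF bell[of n], of "a n"] Suc by simp
    ultimately show ?case using finite_support_in_ell1[OF fd] z by blast
  qed
  have lower: "c / 2 * (\<Sum>k<n. \<bar>a k\<bar>) \<le> norm (\<Sum>k<n. a k *\<^sub>R u k)" for n a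
  proof -
    have "c * (\<Sum>k<n. \<bar>a k\<bar>) \<le> norm (\<Sum>k<n. a k *\<^sub>R T (b k))"
      using T_lower[of "d a n"] d[of a n] by simp
    also have "(\<Sum>k<n. a k *\<^sub>R T (b k)) = (\<Sum>k<n. a k *\<^sub>R u k) + (\<Sum>k<n. a k *\<^sub>R (T (b k) - u k))"
      by (simp add: scaleR_right_diff_distrib sum_subtractf)
    also have "norm \<dots> \<le> norm (\<Sum>k<n. a k *\<^sub>R u k) + norm (\<Sum>k<n. a k *\<^sub>R (T (b k) - u k))"
      by (rule norm_triangle_ineq)
    also have "norm (\<Sum>k<n. a k *\<^sub>R (T (b k) - u k)) \<le> (\<Sum>k<n. \<bar>a k\<bar> * (c / 2))"
      by (rule sum_norm_le) (simp only: norm_scaleR mult_left_mono[OF Tu] abs_ge_zero)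
    also have "(\<Sum>k<n. \<bar>a k\<bar> * (c / 2)) = c / 2 * (\<Sum>k<n. \<bar>a k\<bar>)"
      by (simp only: sum_distrib_right[symmetric] mult.commute)
    finally show ?thesis by simp
  qed
  have C: "0 < C + c / 2" using Tb[of 0] c by linarith
  \<comment> \<open>Division by C + c/2, a bound for the norms of the \<open>u k\<close>, converts
    the estimate to the weighted form of \<open>l1_lower\<close>.\<close>
  define c' where "c' = c / 2 / (C + c / 2)"
  have c': "c' * (C + c / 2) = c / 2"
    by (rule nonzero_eq_divide_eq[THEN iffD1, OF _ c'_def]) (use C in simp)
  have "c' * (\<Sum>i<n. \<bar>a i\<bar> * norm (u i)) \<le> norm (\<Sum>i<n. a i *\<^sub>R u i)" for n a
  proof -
    have "(\<Sum>i<n. \<bar>a i\<bar> * norm (u i)) \<le> (\<Sum>i<n. \<bar>a i\<bar> * (C + c / 2))"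
      by (intro sum_mono mult_left_mono u_le) simp
    then have "c' * (\<Sum>i<n. \<bar>a i\<bar> * norm (u i)) \<le> c' * ((C + c / 2) * (\<Sum>i<n. \<bar>a i\<bar>))"
      using c C by (intro mult_left_mono) (simp_all add: c'_def sum_distrib_left mult.commute)
    also have "\<dots> = c / 2 * (\<Sum>i<n. \<bar>a i\<bar>)" by (simp only: c' mult.assoc[symmetric])
    also have "\<dots> \<le> norm (\<Sum>i<n. a i *\<^sub>R u i)" by (rule lower)
    finally show ?thesis .
  qed
  moreover have "0 < c'" using c C by (simp add: c'_def)
  ultimately show ?thesis using block by blast
qed

end

lemma ell1_block_contains_ell1:
  fixes z :: "nat \<Rightarrow> 'a::banach"
  assumes z: "\<And>i. z i \<noteq> 0" and c: "0 < c"
    and lower: "\<And>n a. c * (\<Sum>i<n. \<bar>a i\<bar> * norm (z i)) \<le> norm (\<Sum>i<n. a i *\<^sub>R z i)"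
  shows "contains_ell1 (UNIV :: 'a set)"
proof -
  define u where "u i = z i /\<^sub>R norm (z i)" for i
  have u: "norm (u i) = 1" for i using z by (simp add: u_def)
  define T where "T a = (\<Sum>i. a i *\<^sub>R u i)" for a :: "nat \<Rightarrow> real"
  have sn: "summable (\<lambda>i. norm (a i *\<^sub>R u i))" if "a \<in> ell1" for a using that by (simp add: u ell1_def)
  have sm: "summable (\<lambda>i. a i *\<^sub>R u i)" if "a \<in> ell1" for a by (rule summable_norm_cancel[OF sn[OF that]])
  have "T (\<lambda>i. a i + b i) = T a + T b" if "a \<in> ell1" "b \<in> ell1" for a b
    using suminf_add[OF sm sm, OF that] by (simp add: T_def scaleR_left_distrib)
  moreover have "T (\<lambda>i. r * a i) = r *\<^sub>R T a" if "a \<in> ell1" for r a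
    using suminf_scaleR_right[OF sm[OF that], of r] by (simp add: T_def)
  moreover have "norm (T a) \<le> 1 * (\<Sum>i. \<bar>a i\<bar>)" if "a \<in> ell1" for a
    using summable_norm[OF sn[OF that]] by (simp add: T_def u)
  moreover have "c * (\<Sum>i. \<bar>a i\<bar>) \<le> norm (T a)" if a: "a \<in> ell1" for a
  proof (rule LIMSEQ_le)
    show "(\<lambda>n. c * (\<Sum>i<n. \<bar>a i\<bar>)) \<longlonglongrightarrow> c * (\<Sum>i. \<bar>a i\<bar>)"
      using a by (intro tendsto_intros summable_LIMSEQ) (simp add: ell1_def)
    show "(\<lambda>n. norm (\<Sum>i<n. a i *\<^sub>R u i)) \<longlonglongrightarrow> norm (T a)"
      unfolding T_def by (intro tendsto_norm summable_LIMSEQ sm a)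
    have "c * (\<Sum>i<n. \<bar>a i\<bar>) \<le> norm (\<Sum>i<n. a i *\<^sub>R u i)" for n
      using lower[of "\<lambda>i. a i / norm (z i)" n] z by (simp add: u_def divide_inverse abs_mult mult.assoc)
    then show "\<exists>N. \<forall>n\<ge>N. c * (\<Sum>i<n. \<bar>a i\<bar>) \<le> norm (\<Sum>i<n. a i *\<^sub>R u i)" by blast
  qed
  ultimately show ?thesis unfolding contains_ell1_def using c by (intro exI[of _ T]) blast
qed

section \<open>Renormings\<close>

text \<open>The extension is the infimal convolution of the given norm with a large multiple of the original
  norm.\<close>

lemma equivalent_norm_extension:
  fixes Y :: "'a::real_normed_vector set"
  assumes Y: "subspace Y" and N: "equivalent_norm_on Y N"
  obtains N' where "equivalent_norm_on UNIV N'" "\<And>v. v \<in> Y \<Longrightarrow> N' v = N v"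
proof -
  obtain c K0 where cK: "0 < c" "\<And>v. v \<in> Y \<Longrightarrow> c * norm v \<le> N v" "\<And>v. v \<in> Y \<Longrightarrow> N v \<le> K0 * norm v"
    using N unfolding equivalent_norm_on_def by blast
  have Nadd: "N (u + v) \<le> N u + N v" if "u \<in> Y" "v \<in> Y" for u v
    using N that unfolding equivalent_norm_on_def by blast
  have Nscale: "N (r *\<^sub>R v) = \<bar>r\<bar> * N v" if "v \<in> Y" for r v
    using N that unfolding equivalent_norm_on_def by blast
  \<comment> \<open>K \<ge> c gives the lower bound for the convolution on the whole space; K \<ge>
    \<open>K0\<close> makes it agree with N on Y.\<close>
  define K where "K = max K0 c"
  have K: "0 < K" "c \<le> K" using cK(1) by (auto simp: K_def)
  have NK: "N v \<le> K * norm v" if "v \<in> Y" for v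
    using cK(3)[OF that] mult_right_mono[of K0 K "norm v"] by (simp add: K_def)
  have Y0: "0 \<in> Y" using Y by (rule subspace_0)
  have N0: "N 0 = 0" using Nscale[OF Y0, of 0] by simp
  define F where "F v = (\<lambda>u. N u + K * norm (v - u)) ` Y" for v
  define N' where "N' v = Inf (F v)" for v
  have Fne: "F v \<noteq> {}" for v using Y0 by (auto simp: F_def)
  have lower: "c * norm v \<le> N u + K * norm (v - u)" if "u \<in> Y" for u v
  proof -
    have "c * norm v \<le> c * (norm u + norm (v - u))"
      using cK(1) norm_triangle_ineq[of u "v - u"] by (intro mult_left_mono) auto
    also have "\<dots> \<le> N u + K * norm (v - u)"
      using cK(2)[OF that] mult_right_mono[OF K(2), of "norm (v - u)"] by (simp add: distrib_left)
    finally show ?thesis .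
  qed
  have bdd: "bdd_below (F v)" for v using lower by (intro bdd_belowI[of _ "c * norm v"]) (auto simp: F_def)
  have N'_le: "N' v \<le> N u + K * norm (v - u)" if "u \<in> Y" for u v
    unfolding N'_def by (rule cInf_lower[OF _ bdd]) (use that in \<open>auto simp: F_def\<close>)
  have N'_ge: "d \<le> N' v" if "\<And>u. u \<in> Y \<Longrightarrow> d \<le> N u + K * norm (v - u)" for d v
    unfolding N'_def by (rule cInf_greatest[OF Fne]) (use that in \<open>auto simp: F_def\<close>)
  have "N' (v + w) \<le> N' v + N' w" for v w
  proof -
    have "N' (v + w) - N' w \<le> N' v"
    proof (rule N'_ge)
      fix u assume u: "u \<in> Y"
      have "N' (v + w) - (N u + K * norm (v - u)) \<le> N' w"
      proof (rule N'_ge)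
        fix u' assume u': "u' \<in> Y"
        have "N' (v + w) \<le> N (u + u') + K * norm (v + w - (u + u'))"
          using subspace_add[OF Y u u'] by (rule N'_le)
        also have "\<dots> \<le> (N u + N u') + K * (norm (v - u) + norm (w - u'))"
          using K(1) norm_triangle_ineq[of "v - u" "w - u'"]
          by (intro add_mono mult_left_mono Nadd u u') (auto simp: algebra_simps)
        finally show "N' (v + w) - (N u + K * norm (v - u)) \<le> N u' + K * norm (w - u')"
          by (simp add: distrib_left)
      qed
      then show "N' (v + w) - N' w \<le> N u + K * norm (v - u)" by simp
    qed
    then show ?thesis by simp
  qed
  moreover have scale: "N' (r *\<^sub>R v) = \<bar>r\<bar> * N' v" for r v
  proof -
    have le: "N' (r *\<^sub>R v) \<le> \<bar>r\<bar> * N' v" if r: "r \<noteq> 0" for r v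
    proof -
      have "N' (r *\<^sub>R v) / \<bar>r\<bar> \<le> N' v"
      proof (rule N'_ge)
        fix u assume u: "u \<in> Y"
        have "N' (r *\<^sub>R v) \<le> N (r *\<^sub>R u) + K * norm (r *\<^sub>R v - r *\<^sub>R u)"
          using subspace_scale[OF Y u] by (rule N'_le)
        also have "\<dots> = \<bar>r\<bar> * (N u + K * norm (v - u))"
          unfolding Nscale[OF u] scaleR_right_diff_distrib[symmetric] norm_scaleR
          by (simp add: distrib_left)
        finally show "N' (r *\<^sub>R v) / \<bar>r\<bar> \<le> N u + K * norm (v - u)"
          using r by (simp add: divide_le_eq mult.commute)
      qed
      then show ?thesis using r by (simp add: divide_le_eq mult.commute)
    qed
    show ?thesis
    proof (cases "r = 0")
      case True
      have "N' 0 = 0" using N'_le[OF Y0, of 0] N'_ge[of 0 0] lower[of _ 0] by (simp add: N0)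
      then show ?thesis using True by simp
    next
      case False
      have "N' v \<le> \<bar>inverse r\<bar> * N' (r *\<^sub>R v)" using le[of "inverse r" "r *\<^sub>R v"] False by simp
      then have "\<bar>r\<bar> * N' v \<le> N' (r *\<^sub>R v)" using False by (simp add: field_simps)
      then show ?thesis using le[OF False, of v] by simp
    qed
  qed
  moreover have "c * norm v \<le> N' v" "N' v \<le> K * norm v" for v
    using N'_ge[OF lower] N'_le[OF Y0, of v] by (auto simp: N0)
  ultimately have "equivalent_norm_on UNIV N'" unfolding equivalent_norm_on_def using cK(1) by blast
  moreover have "N' v = N v" if v: "v \<in> Y" for v
  proof (rule antisym)
    show "N' v \<le> N v" using N'_le[OF v, of v] by simp
    show "N v \<le> N' v"
    proof (rule N'_ge)
      fix u assume u: "u \<in> Y"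
      have "v - u \<in> Y" by (rule subspace_diff[OF Y v u])
      then show "N v \<le> N u + K * norm (v - u)" using Nadd[OF u, of "v - u"] NK[of "v - u"] by simp
    qed
  qed
  ultimately show ?thesis using that by blast
qed

section \<open>Replacing a norm by another that agrees with it on the span\<close>

lemma delta_cong:
  assumes x: "basic_seq x" and N: "\<And>v. v \<in> span (range x) \<Longrightarrow> N v = N' v"
  shows "delta L N \<alpha> x = delta L N' \<alpha> x"
proof -
  have "N (\<Sum>i<k. z i) \<ge> d * (\<Sum>i<k. N (z i)) \<longleftrightarrow> N' (\<Sum>i<k. z i) \<ge> d * (\<Sum>i<k. N' (z i))"
    if "admissible L \<alpha> x k z" for d k z
  proof -
    have "z i \<in> span (range x)" if "i < k" for i
      using \<open>admissible L \<alpha> x k z\<close> successiveD[OF x block_on_successive[OF x]] that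
      unfolding admissible_def by blast
    moreover from this have "(\<Sum>i<k. z i) \<in> span (range x)" by (intro span_sum) simp
    ultimately show ?thesis using N by simp
  qed
  then show ?thesis unfolding delta_def by (intro arg_cong[of _ _ Sup] Collect_cong) blast
qed

lemma Delta_stabilizes_cong:
  assumes x: "basic_seq x" and N: "\<And>v. v \<in> span (range x) \<Longrightarrow> N v = N' v"
    and s: "Delta_stabilizes L N x \<gamma>"
  shows "Delta_stabilizes L N' x \<gamma>"
proof -
  have "delta L N \<alpha> y = delta L N' \<alpha> y" if y: "block_basis (\<lambda>i. x (n + i)) y" for n y \<alpha>
  proof (rule delta_cong)
    have xy: "block_basis x y" by (rule block_basis_trans[OF x block_basis_tail[OF x] y])
    show "basic_seq y" by (rule basic_seq_block[OF x xy])
    show "N v = N' v" if "v \<in> span (range y)" for v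
      using span_block_subset[OF x xy] that N by blast
  qed
  then show ?thesis using s unfolding Delta_stabilizes_def by metis
qed

theorem proposition4p11:
  fixes e :: "nat \<Rightarrow> 'a::banach" and L :: "omega1 \<Rightarrow> nat \<Rightarrow> omega1"
  assumes "basis_of UNIV e"
    and "fundamental_sequences L"
  shows
    "(Delta L e \<noteq> {} \<and> (\<forall>\<gamma>\<in>Delta L e. \<forall>\<alpha>. \<gamma> \<alpha> \<in> {0..1})) \<and>
     (contains_ell1 (UNIV :: 'a set) \<longleftrightarrow> (\<exists>\<gamma>\<in>Delta L e. \<gamma> 1 = 1)) \<and>
     (\<forall>\<gamma>\<in>Delta L e. \<forall>\<alpha> \<beta>. \<alpha> \<le> \<beta> \<longrightarrow> \<gamma> \<alpha> \<ge> \<gamma> \<beta>) \<and>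
     (\<forall>\<gamma>\<in>Delta L e. \<forall>\<alpha> \<beta>. \<gamma> \<alpha> * \<gamma> \<beta> \<le> \<gamma> (\<beta> + \<alpha>)) \<and>
     (\<forall>\<gamma>\<in>Delta L e. \<forall>\<alpha>. \<forall>n::nat. n \<ge> 1 \<longrightarrow> \<gamma> (omult_nat \<alpha> n) \<ge> \<gamma> \<alpha> ^ n) \<and>
     (\<forall>\<gamma>\<in>Delta L e. continuous_on UNIV \<gamma>) \<and>
     (\<forall>\<alpha>. delta_ddot L \<alpha> e = Sup {\<gamma> \<alpha> | \<gamma>. \<gamma> \<in> Delta_ddot L e})"
proof -
  note e = basic_seq_basis[OF assms(1)]
  have norm: "equivalent_norm_on UNIV (norm :: 'a \<Rightarrow> real)"
    unfolding equivalent_norm_on_def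
    by (auto simp: norm_triangle_ineq intro!: exI[of _ 1])
  interpret schreier_norm L "norm :: 'a \<Rightarrow> real" by unfold_locales (rule assms(2), rule norm)
  have DeltaE: "\<exists>x. block_basis e x \<and> basic_seq x \<and> Delta_stabilizes L norm x \<gamma>" if "\<gamma> \<in> Delta L e" for \<gamma>
    using that basic_seq_block[OF e] unfolding Delta_def by blast
  have a1: "Delta L e \<noteq> {}"
    using exists_stabilizing_block[OF e] unfolding Delta_def by blast
  have a2: "\<gamma> \<alpha> \<in> {0..1}" if "\<gamma> \<in> Delta L e" for \<gamma> \<alpha>
    using DeltaE[OF that] stabilizes_bounds by fastforce
  have b: "contains_ell1 (UNIV :: 'a set) \<longleftrightarrow> (\<exists>\<gamma>\<in>Delta L e. \<gamma> 1 = 1)"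
  proof
    assume "contains_ell1 (UNIV :: 'a set)"
    then obtain T :: "(nat \<Rightarrow> real) \<Rightarrow> 'a" and c C where T:
      "\<forall>a\<in>ell1. \<forall>b\<in>ell1. T (\<lambda>i. a i + b i) = T a + T b"
      "\<forall>r. \<forall>a\<in>ell1. T (\<lambda>i. r * a i) = r *\<^sub>R T a" "0 < c"
      "\<forall>a\<in>ell1. c * (\<Sum>i. \<bar>a i\<bar>) \<le> norm (T a) \<and> norm (T a) \<le> C * (\<Sum>i. \<bar>a i\<bar>)"
      unfolding contains_ell1_def by (elim exE conjE) (rule that)
    have "ell1_embedding e T c C"
      by unfold_locales (use T assms(1) in simp_all)
    then obtain u c' where u: "0 < c'" "block_basis e u" "l1_lower c' u"
      using ell1_embedding.exists_ell1_block unfolding l1_lower_def by blast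
    obtain w where w: "block_basis u w" "Delta_stabilizes L norm w (\<lambda>_. 1)"
      using l1_lower_stabilizes[OF basic_seq_block[OF e u(2)] u(1,3)] by blast
    then have "(\<lambda>_. 1) \<in> Delta L e" using block_basis_trans[OF e u(2)] unfolding Delta_def by blast
    then show "\<exists>\<gamma>\<in>Delta L e. \<gamma> 1 = 1" by (intro bexI[of _ "\<lambda>_. 1"]) simp_all
  next
    assume "\<exists>\<gamma>\<in>Delta L e. \<gamma> 1 = 1"
    then obtain c z where "0 < c" "block_basis e z" "l1_lower c z"
      using DeltaE stabilizes_one_l1_lower[OF e] by meson
    then show "contains_ell1 (UNIV :: 'a set)"
      using ell1_block_contains_ell1[of z c] block_nonzero[OF e] unfolding l1_lower_def by blast
  qed
  have g: "delta_ddot L \<alpha> e = Sup {\<gamma> \<alpha> | \<gamma>. \<gamma> \<in> Delta_ddot L e}" for \<alpha>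
  proof -
    let ?A = "{delta_dot L N \<alpha> e | N. equivalent_norm_on UNIV N}"
    let ?B = "{\<gamma> \<alpha> | \<gamma>. \<gamma> \<in> Delta_ddot L e}"
    have loc: "schreier_norm L N" if "equivalent_norm_on UNIV N" for N :: "'a \<Rightarrow> real"
      using that assms(2) by unfold_locales
    have dd: "bdd_above {delta L N \<alpha> x | x. block_basis e x}" "{delta L N \<alpha> x | x. block_basis e x} \<noteq> {}"
      "delta_dot L N \<alpha> e \<le> 1" if N: "equivalent_norm_on UNIV N" for N
    proof -
      have le: "delta L N \<alpha> x \<le> 1" if "block_basis e x" for x
        by (rule schreier_norm.delta_le_1[OF loc[OF N] basic_seq_block[OF e that]])
      show "bdd_above {delta L N \<alpha> x | x. block_basis e x}" using le by (intro bdd_aboveI[of _ 1]) blast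
      show ne: "{delta L N \<alpha> x | x. block_basis e x} \<noteq> {}" using block_basis_refl[OF e] by blast
      show "delta_dot L N \<alpha> e \<le> 1" unfolding delta_dot_def by (rule cSup_least[OF ne]) (use le in blast)
    qed
    have ext: "\<exists>x N. block_basis e x \<and> basic_seq x \<and> equivalent_norm_on UNIV N \<and> Delta_stabilizes L N x \<gamma>"
      if "\<gamma> \<in> Delta_ddot L e" for \<gamma>
    proof -
      obtain x N where x: "block_basis e x" "equivalent_norm_on (closed_span x) N" "Delta_stabilizes L N x \<gamma>"
        using \<open>\<gamma> \<in> Delta_ddot L e\<close> unfolding Delta_ddot_def by blast
      \<comment> \<open>All vectors that enter \<open>delta\<close> are finite combinations, so
        agreement of the extended norm with N on the span is enough.\<close>
      have "equivalent_norm_on (span (range x)) N"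
        using x(2) closure_subset[of "span (range x)"] unfolding equivalent_norm_on_def closed_span_def
        by (meson subsetD)
      then obtain N' where "equivalent_norm_on UNIV N'" "\<And>v. v \<in> span (range x) \<Longrightarrow> N' v = N v"
        using equivalent_norm_extension[OF subspace_span] by metis
      then show ?thesis
        using x Delta_stabilizes_cong[OF basic_seq_block[OF e x(1)], of N N' L \<gamma>] basic_seq_block[OF e x(1)] by metis
    qed
    have B1: "t \<le> 1" if "t \<in> ?B" for t
      using that ext schreier_norm.stabilizes_bounds(2)[OF loc] by blast
    have bddB: "bdd_above ?B" using B1 by (intro bdd_aboveI[of _ 1])
    have bddA: "bdd_above ?A" using dd(3) by (intro bdd_aboveI[of _ 1]) blast
    \<comment> \<open>A stabilizing block basis of x under the same norm has its limit at least
      \<open>delta L N \<alpha> x\<close>, since \<open>delta\<close> increases along block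
      bases.\<close>
    have key: "\<exists>t\<in>?B. delta L N \<alpha> x \<le> t" if N: "equivalent_norm_on UNIV N" and x: "block_basis e x" for N x
    proof -
      interpret N: schreier_norm L N by (rule loc[OF N])
      note bx = basic_seq_block[OF e x]
      obtain w \<gamma> where w: "block_basis x w" "Delta_stabilizes L N w \<gamma>" using N.exists_stabilizing_block[OF bx] .
      note bw = basic_seq_block[OF bx w(1)]
      have "delta L N \<alpha> x \<le> \<gamma> \<alpha>"
      proof (rule N.stabilizes_ge[OF bw w(2)])
        fix n y assume "block_basis (\<lambda>i. w (n + i)) y"
        then show "delta L N \<alpha> x \<le> delta L N \<alpha> y"
          by (intro N.delta_block_mono[OF bx] block_basis_trans[OF bx w(1)]
              block_basis_trans[OF bw block_basis_tail[OF bw]])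
      qed
      moreover have "equivalent_norm_on (closed_span w) N"
        using N unfolding equivalent_norm_on_def by blast
      then have "\<gamma> \<in> Delta_ddot L e"
        using block_basis_trans[OF e x w(1)] w(2) unfolding Delta_ddot_def by blast
      ultimately show ?thesis by blast
    qed
    show ?thesis
      unfolding delta_ddot_def
    proof (rule antisym)
      have "?A \<noteq> {}" using norm by blast
      then show "Sup ?A \<le> Sup ?B"
      proof (rule cSup_least)
        fix s assume "s \<in> ?A"
        then obtain N where N: "equivalent_norm_on UNIV N" "s = delta_dot L N \<alpha> e" by blast
        show "s \<le> Sup ?B"
          unfolding N(2) delta_dot_def
        proof (rule cSup_least[OF dd(2)[OF N(1)]])
          fix t assume "t \<in> {delta L N \<alpha> x | x. block_basis e x}"
          then obtain t' where "t' \<in> ?B" "t \<le> t'" using key[OF N(1)] by blast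
          then show "t \<le> Sup ?B" using cSup_upper[OF _ bddB] by (meson order_trans)
        qed
      qed
      have "?B \<noteq> {}" using key[OF norm block_basis_refl[OF e]] by blast
      then show "Sup ?B \<le> Sup ?A"
      proof (rule cSup_least)
        fix t assume "t \<in> ?B"
        then obtain \<gamma> where \<gamma>: "t = \<gamma> \<alpha>" "\<gamma> \<in> Delta_ddot L e" by blast
        obtain x N where x: "block_basis e x" "basic_seq x" "equivalent_norm_on UNIV N" "Delta_stabilizes L N x \<gamma>"
          using ext[OF \<gamma>(2)] by blast
        interpret N: schreier_norm L N by (rule loc[OF x(3)])
        \<comment> \<open>The values of \<open>delta\<close> approximating
          \<open>\<gamma> \<alpha>\<close> are taken at block bases of e, hence are bounded by
          \<open>delta_dot\<close>.\<close>
        have "\<gamma> \<alpha> \<le> delta_dot L N \<alpha> e"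
        proof (rule N.stabilizes_le[OF x(2,4)])
          fix n y assume y: "block_basis (\<lambda>i. x (n + i)) y"
          have "block_basis e y"
            by (rule block_basis_trans[OF e x(1) block_basis_trans[OF x(2) block_basis_tail[OF x(2)] y]])
          then show "delta L N \<alpha> y \<le> delta_dot L N \<alpha> e"
            unfolding delta_dot_def by (intro cSup_upper[OF _ dd(1)[OF x(3)]]) blast
        qed
        also have "\<dots> \<le> Sup ?A" by (rule cSup_upper[OF _ bddA]) (use x(3) in blast)
        finally show "t \<le> Sup ?A" by (simp add: \<gamma>(1))
      qed
    qed
  qed
  have mono: "\<gamma> \<beta> \<le> \<gamma> \<alpha>" if "\<alpha> \<le> \<beta>" "\<gamma> \<in> Delta L e" for \<gamma> \<alpha> \<beta>
    using DeltaE[OF that(2)] stabilizes_antimono that(1) by blast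
  have d: "\<gamma> \<alpha> * \<gamma> \<beta> \<le> \<gamma> (\<beta> + \<alpha>)" "\<gamma> \<alpha> ^ n \<le> \<gamma> (omult_nat \<alpha> n)" "continuous_on UNIV \<gamma>"
    if "\<gamma> \<in> Delta L e" for \<gamma> \<alpha> \<beta> n
    using DeltaE[OF that] stabilizes_add stabilizes_omult_nat stabilizes_continuous by blast+
  show ?thesis
    by (intro conjI ballI allI impI) (rule a1, erule a2, rule b, erule (1) mono, erule d, erule d, erule d, rule g)
qed

end
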